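(* Let $h$ be a nowhere vanishing smooth real solution of the Tzitzéica equation $h_{xy}h-h_xh_y=h^3-1$ on a connected open set $D\subset\mathbb{R}^2$, let $F=F(x,y,\lambda)$ be an affine frame of the associated family of proper indefinite affine spheres of $h$, and let $X_\lambda$ denote its third column. Let $\alpha\in\mathbb{R}\setminus\{0\}$, let $\ell=\mathbb{R}\cdot(a,b,1)\nsubseteq\Delta_0$ be a real line, and put $\phi:=(a,b,1)\,X_\alpha$, a scalar solution of $(\ast_{\alpha^3})$. (1) (Rank 1 type.) The dressing action of $g_{\alpha,\ell}$ on $F$ gives the classical Tzitzéica transformation, provided the open condition $\ell F(x,y,\alpha)\nsubseteq\Delta_0$ holds for $(x,y)\in D$. That is, $g_{\alpha,\ell}\ast F=\tilde F$ is defined and, for real $\lambda\neq0$ with $\lambda^3\ne\pm\alpha^3$, up to an invertible linear transformation of $\mathbb{R}^3$ independent of $(x,y)$ (namely $g_{\alpha,\ell}(\lambda)^{-1}$), the third column of $\tilde F(\cdot,\cdot,\lambda)$ is $$\hat X_\lambda=\frac{(\lambda^3-\alpha^3)\,h\,X_\lambda-2\lambda^3(\ln\phi)_x\,(X_\lambda)_y+2\alpha^3(\ln\phi)_y\,(X_\lambda)_x}{(\lambda^3+\alpha^3)\,h},$$ the Tzitzéica transform of $X_\lambda$ with $\gamma=\lambda^3$, $\gamma_1=\alpha^3$, $\phi_1=\phi$; the corresponding solution of the Tzitzéica equation is $\hat h=h-2(\ln\phi)_{xy}$. (2) (Rank 2 type.) The dressing action of $h_{\alpha,\ell}$ on $F$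 gives the dual transformation. That is, let $A$ be the matrix with $\mathrm{Res}_{\lambda=\alpha}h_{\alpha,\ell}=2\alpha A$, and suppose $\tilde\ell(x,y):=\{v^t: v\in\mathbb{R}^3,\ A\,F(x,y,\alpha)\,P\,v=0\}\nsubseteq\Delta_0$ for $(x,y)\in D$. Then $h_{\alpha,\ell}\ast F$ is defined, through the factorization $h_{\alpha,\ell}\cdot F=\tilde F\cdot h_{\alpha,\tilde\ell}$, and the corresponding transformation on affine spheres is (up to an invertible linear transformation of $\mathbb{R}^3$ independent of $(x,y)$) $$\tilde X_\lambda=\frac{(\lambda^3+\alpha^3)\,h\,X_\lambda-2\lambda^3(\ln\phi)_x\,(X_\lambda)_y-2\alpha^3(\ln\phi)_y\,(X_\lambda)_x}{(\lambda^3-\alpha^3)\,h},$$ where $\phi=(a,b,1)X_\alpha$ is the same scalar solution as in the rank 1 case. Moreover $\hat X_\lambda=-\tilde X_{-\lambda}$, i.e. $-\tilde X$ gives the dual of $\hat X$.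
   Context: Affine spheres and frames. For a solution $h$ of the Tzitzéica equation $h_{xy}h-h_xh_y=h^3-1$ and $\gamma\in\mathbb{R}\setminus\{0\}$ consider the compatible linear system $$(\ast_\gamma)\quad X_{xx}=\tfrac{h_x}{h}X_x+\tfrac{\gamma}{h}X_y,\qquad X_{xy}=hX,\qquad X_{yy}=\tfrac{1}{\gamma h}X_x+\tfrac{h_y}{h}X_y .$$ $\mathbb{R}^3$-valued solutions with independent components are (up to affine transformation) the proper indefinite affine spheres considered here, in asymptotic coordinates $(x,y)$ with affine metric $2h\,dx\,dy$. A scalar solution is a real-valued function solving $(\ast_\gamma)$. Duality: if $X$ solves $(\ast_\gamma)$, its dual $X^\ast:=\frac1hX_x\times X_y$ (vector cross product) solves $(\ast_{-\gamma})$, and $(X^\ast)^\ast=X$. An affine frame of the associated family is a smooth map $F$ from $D$ to $\Lambda_+^{\tau,\sigma}\mathrm{SL}(3,\mathbb{C})$ (defined below) with $$F^{-1}F_x=\begin{pmatrix}h_x/h&0&\lambda\\ \lambda&-h_x/h&0\\0&\lambda&0\end{pmatrix},\qquad F^{-1}F_y=\lambda^{-1}\begin{pmatrix}0&h^{-2}&0\\0&0&h\\ h&0&0\end{pmatrix}.$$ Then $F=\big((X_\lambda)_x/\lambda,\ \lambda (X_\lambda)_y/h,\ X_\lambda\big)$, where for real $\lambda\neq 0$ the third column $X_\lambda$ solves $(\ast_{\lambda^3})$. Classical Tzitzéica transformation. Given $(h,X)$ with $X$ solving $(\ast_\gamma)$, and a scalar solution $\phi_1$ of $(\ast_{\gamma_1})$,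 the Tzitzéica transform $(h_1,X_1)$ is $$h_1=h-2(\ln\phi_1)_{xy},\qquad X_1=\frac{(\gamma-\gamma_1)hX-2\gamma(\ln\phi_1)_xX_y+2\gamma_1(\ln\phi_1)_yX_x}{(\gamma+\gamma_1)h},$$ where $(\ln\phi)_x=\phi_x/\phi$ etc. Loop groups. $\mathbb{C}_*=\mathbb{C}\setminus\{0\}$, $\epsilon=e^{\pi i/3}$, $\mathcal{O}_r=\{|\lambda|<r\}$, $\mathcal{O}_{1/r}=\{\lambda\in\mathbb{C}\cup\{\infty\}:|\lambda|>1/r\}$ with $0<r<1$ sufficiently small. $\Lambda_+G$ is the set of holomorphic maps $\mathbb{C}_*\to G$; $\Lambda_-G$ is the set of holomorphic maps $f:\mathcal{O}_r\cup\mathcal{O}_{1/r}\to G$ with $f(\infty)=I$. The superscript $\tau,\sigma$ denotes the subgroup of those $g$ with $\overline{g(\bar\lambda)}=g(\lambda)$ and $\sigma(g(\lambda))=g(\epsilon\lambda)$, where $\sigma(g)=T(g^t)^{-1}T^{-1}$, $T=\begin{pmatrix}0&1&0\\-\epsilon&0&0\\0&0&\epsilon^2\end{pmatrix}$. Put $P=\begin{pmatrix}0&1&0\\1&0&0\\0&0&1\end{pmatrix}$. Dressing action. For $g\in\Lambda_-^{\tau,\sigma}\mathrm{GL}(3,\mathbb{C})$, if for each $(x,y)$ one can factor $g(\lambda)F(x,y,\lambda)=\tilde F(x,y,\lambda)\tilde g(x,y,\lambda)$ with $\tilde F(x,y,\cdot)\in\Lambda_+^{\tau,\sigma}\mathrm{SL}(3,\mathbb{C})$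 and $\tilde g(x,y,\cdot)\in\Lambda_-^{\tau,\sigma}\mathrm{GL}(3,\mathbb{C})$, then $g\ast F:=\tilde F$ is said to be defined. (Scalar factors of $g$ needed to normalize $\det g=1$ are ignored, as they do not affect the dressing action.) The third column of $\tilde F$ is the new affine sphere. Simple elements. $\Delta_0=\{(z_1,z_2,z_3)\in\mathbb{R}^3:2z_1z_2=z_3^2\text{ or }z_3=0\}$; vectors of $\ell=\mathbb{R}\cdot(a,b,1)$ are row vectors, multiplied on the right by matrices. For $\alpha\in\mathbb{R}\setminus\{0\}$ and $\ell=\mathbb{R}\cdot(a,b,1)\nsubseteq\Delta_0$ (i.e. $2ab\neq1$): $$g_{\alpha,\ell}(\lambda)=I+\frac{2}{\lambda^3-\alpha^3}\begin{pmatrix}\frac{\alpha^3ab}{2ab-1}&\frac{\alpha\lambda^2b^2}{2ab-1}&\frac{\alpha^2\lambda b}{2ab-1}\\ \alpha^2\lambda a^2&\alpha^3ab&\alpha\lambda^2a\\ \alpha\lambda^2a&\alpha^2\lambda b&\alpha^3\end{pmatrix},$$ $$h_{\alpha,\ell}(\lambda)=I+\frac{2}{\lambda^3-\alpha^3}\begin{pmatrix}\frac{\alpha^3(ab-1)}{2ab-1}&\frac{-\alpha\lambda^2b^2}{2ab-1}&\frac{\alpha^2\lambda b}{2ab-1}\\ \alpha^2\lambda a^2&\alpha^3(1-ab)&-\alpha\lambda^2a\\ -\alpha\lambda^2a&\alpha^2\lambda b&0\end{pmatrix}.$$ (The first is called rank 1 type, the second rank 2 type, after the rank of the residue at $\alpha$.)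 All formulas for $\hat X_\lambda$, $\tilde X_\lambda$ are understood wherever they are defined (real $\lambda\ne0$ with $\lambda^3\neq\pm\alpha^3$, $\phi\neq0$).
   Formalization: In (2) φ is (a,b,1)X_{-α}, as the claim fails for (a,b,1)X_α. "Moreover" is corrected: X̂_λ is the X̃ formula at -λ with X_λ kept and sign +; the dual of X̂ is (λ³-α³)/(λ³+α³) times X̃ applied to X_λ^*; with φ=(a,b,1)X_α, h_{α,ℓ} dresses the dual family F(-λ). *)

theory Defs
  imports "HOL-Complex_Analysis.Complex_Analysis"
begin

section \<open>Smooth functions and partial derivatives on the plane\<close>

primrec Ck_on :: "'a set \<Rightarrow> ('a::real_normed_vector \<Rightarrow> 'b::real_normed_vector) \<Rightarrow> nat \<Rightarrow> bool" where
  "Ck_on S f 0 \<longleftrightarrow> continuous_on S f"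
| "Ck_on S f (Suc k) \<longleftrightarrow> (\<forall>x\<in>S. f differentiable (at x)) \<and>
     (\<forall>v. Ck_on S (\<lambda>x. frechet_derivative f (at x) v) k)"

definition smooth_on :: "'a set \<Rightarrow> ('a::real_normed_vector \<Rightarrow> 'b::real_normed_vector) \<Rightarrow> bool" where
  "smooth_on S f \<longleftrightarrow> (\<forall>k. Ck_on S f k)"

definition dx :: "(real \<times> real \<Rightarrow> 'a::real_normed_vector) \<Rightarrow> real \<times> real \<Rightarrow> 'a" where
  "dx f p = vector_derivative (\<lambda>t. f (t, snd p)) (at (fst p))"

definition dy :: "(real \<times> real \<Rightarrow> 'a::real_normed_vector) \<Rightarrow> real \<times> real \<Rightarrow> 'a" where
  "dy f p = vector_derivative (\<lambda>t. f (fst p, t)) (at (snd p))"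

section \<open>The Tzitzeica equation and affine spheres\<close>

definition tzitzeica_solution :: "(real \<times> real) set \<Rightarrow> (real \<times> real \<Rightarrow> real) \<Rightarrow> bool" where
  "tzitzeica_solution D h \<longleftrightarrow> smooth_on D h \<and>
     (\<forall>p\<in>D. h p \<noteq> 0 \<and> dy (dx h) p * h p - dx h p * dy h p = h p ^ 3 - 1)"

text \<open>The linear system with parameter \<open>\<gamma>\<close>; it is used for scalar (\<open>'v = real\<close>) and
  for vector valued (\<open>'v = real^3\<close>) solutions.\<close>

definition solves_system ::
  "(real \<times> real) set \<Rightarrow> (real \<times> real \<Rightarrow> real) \<Rightarrow> real \<Rightarrow> (real \<times> real \<Rightarrow> 'v::real_normed_vector) \<Rightarrow> bool" where
  "solves_system D h \<gamma> X \<longleftrightarrow> smooth_on D X \<and>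
     (\<forall>p\<in>D. dx (dx X) p = (dx h p / h p) *\<^sub>R dx X p + (\<gamma> / h p) *\<^sub>R dy X p \<and>
            dy (dx X) p = h p *\<^sub>R X p \<and>
            dy (dy X) p = (1 / (\<gamma> * h p)) *\<^sub>R dx X p + (dy h p / h p) *\<^sub>R dy X p)"

definition dual_sphere :: "(real \<times> real \<Rightarrow> real) \<Rightarrow> (real \<times> real \<Rightarrow> real^3) \<Rightarrow> real \<times> real \<Rightarrow> real^3" where
  "dual_sphere h X p = (1 / h p) *\<^sub>R cross3 (dx X p) (dy X p)"

text \<open>The logarithmic derivatives are written as \<open>(ln \<phi>)\<^sub>x = \<phi>\<^sub>x / \<phi>\<close>, so that \<open>\<phi>\<close> may be negative.\<close>

definition tz_h :: "(real \<times> real \<Rightarrow> real) \<Rightarrow> (real \<times> real \<Rightarrow> real) \<Rightarrow> real \<times> real \<Rightarrow> real" where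
  "tz_h h \<phi> p = h p - 2 * dy (\<lambda>q. dx \<phi> q / \<phi> q) p"

definition tz_transform ::
  "(real \<times> real \<Rightarrow> real) \<Rightarrow> real \<Rightarrow> real \<Rightarrow> (real \<times> real \<Rightarrow> real) \<Rightarrow>
   (real \<times> real \<Rightarrow> real^3) \<Rightarrow> real \<times> real \<Rightarrow> real^3" where
  "tz_transform h \<gamma> \<gamma>1 \<phi> X p = (1 / ((\<gamma> + \<gamma>1) * h p)) *\<^sub>R
     (((\<gamma> - \<gamma>1) * h p) *\<^sub>R X p
      - (2 * \<gamma> * (dx \<phi> p / \<phi> p)) *\<^sub>R dy X p
      + (2 * \<gamma>1 * (dy \<phi> p / \<phi> p)) *\<^sub>R dx X p)"

text \<open>The expression for the transform of rank 2 type, with \<open>\<gamma> = \<lambda>\<^sup>3\<close> and \<open>\<gamma>1 = \<alpha>\<^sup>3\<close>.\<close>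

definition dual_transform ::
  "(real \<times> real \<Rightarrow> real) \<Rightarrow> real \<Rightarrow> real \<Rightarrow> (real \<times> real \<Rightarrow> real) \<Rightarrow>
   (real \<times> real \<Rightarrow> real^3) \<Rightarrow> real \<times> real \<Rightarrow> real^3" where
  "dual_transform h \<gamma> \<gamma>1 \<phi> X p = (1 / ((\<gamma> - \<gamma>1) * h p)) *\<^sub>R
     (((\<gamma> + \<gamma>1) * h p) *\<^sub>R X p
      - (2 * \<gamma> * (dx \<phi> p / \<phi> p)) *\<^sub>R dy X p
      - (2 * \<gamma>1 * (dy \<phi> p / \<phi> p)) *\<^sub>R dx X p)"

section \<open>Loop groups\<close>

definition eps :: complex where
  "eps = exp (\<i> * of_real pi / 3)"

definition T_mat :: "complex^3^3" where
  "T_mat = vector [vector [0, 1, 0], vector [- eps, 0, 0], vector [0, 0, eps ^ 2]]"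

definition P_mat :: "'a::{zero,one}^3^3" where
  "P_mat = vector [vector [0, 1, 0], vector [1, 0, 0], vector [0, 0, 1]]"

definition sigma :: "complex^3^3 \<Rightarrow> complex^3^3" where
  "sigma g = T_mat ** matrix_inv (transpose g) ** matrix_inv T_mat"

definition tau_sigma_on :: "complex set \<Rightarrow> (complex \<Rightarrow> complex^3^3) \<Rightarrow> bool" where
  "tau_sigma_on S f \<longleftrightarrow>
     (\<forall>z\<in>S. (\<forall>i j. cnj (f (cnj z) $ i $ j) = f z $ i $ j) \<and> sigma (f z) = f (eps * z))"

definition matrix_holomorphic_on :: "(complex \<Rightarrow> complex^3^3) \<Rightarrow> complex set \<Rightarrow> bool" where
  "matrix_holomorphic_on f S \<longleftrightarrow> (\<forall>i j. (\<lambda>z. f z $ i $ j) holomorphic_on S)"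

definition Lambda_plus_SL :: "(complex \<Rightarrow> complex^3^3) set" where
  "Lambda_plus_SL = {f. matrix_holomorphic_on f (- {0}) \<and> (\<forall>z\<in>- {0}. det (f z) = 1) \<and>
     tau_sigma_on (- {0}) f}"

text \<open>The finite part of \<open>\<O>\<^sub>r \<union> \<O>\<^sub>1\<^sub>/\<^sub>r\<close>. The point \<open>\<infinity>\<close> is handled in the chart \<open>w = 1/\<lambda>\<close>, in which
  \<open>\<O>\<^sub>1\<^sub>/\<^sub>r\<close> is the disc of radius \<open>r\<close>; the value there is prescribed to be the identity.\<close>

definition Om :: "real \<Rightarrow> complex set" where
  "Om r = {z. norm z < r} \<union> {z. norm z > 1 / r}"

definition Lambda_minus_GL :: "real \<Rightarrow> (complex \<Rightarrow> complex^3^3) set" where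
  "Lambda_minus_GL r = {f. matrix_holomorphic_on f {z. norm z < r} \<and>
     matrix_holomorphic_on (\<lambda>w. if w = 0 then mat 1 else f (1 / w)) {w. norm w < r} \<and>
     (\<forall>z\<in>Om r. invertible (f z)) \<and> tau_sigma_on (Om r) f}"

section \<open>Affine frames\<close>

definition frame_U :: "(real \<times> real \<Rightarrow> real) \<Rightarrow> real \<times> real \<Rightarrow> complex \<Rightarrow> complex^3^3" where
  "frame_U h p z = vector [
     vector [of_real (dx h p / h p), 0, z],
     vector [z, - of_real (dx h p / h p), 0],
     vector [0, z, 0]]"

definition frame_V :: "(real \<times> real \<Rightarrow> real) \<Rightarrow> real \<times> real \<Rightarrow> complex \<Rightarrow> complex^3^3" where
  "frame_V h p z = vector [
     vector [0, of_real (1 / h p ^ 2) / z, 0],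
     vector [0, 0, of_real (h p) / z],
     vector [of_real (h p) / z, 0, 0]]"

definition frame_equations ::
  "(real \<times> real) set \<Rightarrow> (real \<times> real \<Rightarrow> real) \<Rightarrow> complex \<Rightarrow> (real \<times> real \<Rightarrow> complex^3^3) \<Rightarrow> bool" where
  "frame_equations D h z G \<longleftrightarrow> smooth_on D G \<and>
     (\<forall>p\<in>D. matrix_inv (G p) ** dx G p = frame_U h p z \<and>
            matrix_inv (G p) ** dy G p = frame_V h p z)"

text \<open>Smoothness of a map into the loop group is joint smoothness in \<open>(x,y)\<close> and \<open>\<lambda>\<close>.\<close>

definition affine_frame ::
  "(real \<times> real) set \<Rightarrow> (real \<times> real \<Rightarrow> real) \<Rightarrow> (real \<times> real \<Rightarrow> complex \<Rightarrow> complex^3^3) \<Rightarrow> bool" where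
  "affine_frame D h F \<longleftrightarrow>
     smooth_on (D \<times> - {0}) (\<lambda>(p, z). F p z) \<and>
     (\<forall>p\<in>D. F p \<in> Lambda_plus_SL) \<and>
     (\<forall>z\<in>- {0}. frame_equations D h z (\<lambda>p. F p z))"

text \<open>For real \<open>\<lambda>\<close> the entries of \<open>F\<close> are real by the reality condition, so taking real parts in
  the next two definitions only changes the type.\<close>

definition re_matrix :: "complex^3^3 \<Rightarrow> real^3^3" where
  "re_matrix M = (\<chi> i j. Re (M $ i $ j))"

definition third_col :: "(real \<times> real \<Rightarrow> complex \<Rightarrow> complex^3^3) \<Rightarrow> real \<Rightarrow> real \<times> real \<Rightarrow> real^3" where
  "third_col F l p = column 3 (re_matrix (F p (of_real l)))"

definition scalar_solution ::
  "real \<Rightarrow> real \<Rightarrow> (real \<times> real \<Rightarrow> real^3) \<Rightarrow> real \<times> real \<Rightarrow> real" where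
  "scalar_solution a b X p = vector [a, b, 1] \<bullet> X p"

definition complex_vec :: "real^3 \<Rightarrow> complex^3" where
  "complex_vec v = (\<chi> i. of_real (v $ i))"

text \<open>The frame with the loop parameter reversed. The twisting condition gives
  \<open>F(-\<lambda>) = P (F(\<lambda>)\<^sup>t)\<^sup>-\<^sup>1 P\<close>, so its third column is \<open>P\<close> applied to the dual sphere.\<close>

definition dual_frame ::
  "(real \<times> real \<Rightarrow> complex \<Rightarrow> complex^3^3) \<Rightarrow> real \<times> real \<Rightarrow> complex \<Rightarrow> complex^3^3" where
  "dual_frame F p z = F p (- z)"

section \<open>Dressing action\<close>

text \<open>\<open>dressing r D g F Ft\<close> says that \<open>Ft\<close> is obtained from \<open>F\<close> by dressing with \<open>g\<close>, i.e. \<open>g * F = Ft\<close>.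
  The factorization \<open>g F = Ft gt\<close> is an identity on the common domain of the loops involved.
  The value of \<open>Ft p\<close> at \<open>0\<close> is irrelevant, since loops in \<open>\<Lambda>\<^sub>+\<close> live on the punctured plane.\<close>

definition dressing ::
  "real \<Rightarrow> (real \<times> real) set \<Rightarrow> (complex \<Rightarrow> complex^3^3) \<Rightarrow>
   (real \<times> real \<Rightarrow> complex \<Rightarrow> complex^3^3) \<Rightarrow> (real \<times> real \<Rightarrow> complex \<Rightarrow> complex^3^3) \<Rightarrow> bool" where
  "dressing r D g F Ft \<longleftrightarrow> g \<in> Lambda_minus_GL r \<and>
     (\<forall>p\<in>D. Ft p \<in> Lambda_plus_SL \<and>
        (\<exists>gt\<in>Lambda_minus_GL r. \<forall>z\<in>Om r - {0}. g z ** F p z = Ft p z ** gt z))"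

definition dressing_defined ::
  "real \<Rightarrow> (real \<times> real) set \<Rightarrow> (complex \<Rightarrow> complex^3^3) \<Rightarrow>
   (real \<times> real \<Rightarrow> complex \<Rightarrow> complex^3^3) \<Rightarrow> bool" where
  "dressing_defined r D g F \<longleftrightarrow> (\<exists>Ft. dressing r D g F Ft)"

section \<open>Simple elements\<close>

definition Delta0 :: "(real^3) set" where
  "Delta0 = {z. 2 * z $ 1 * z $ 2 = (z $ 3) ^ 2 \<or> z $ 3 = 0}"

definition real_line :: "real \<Rightarrow> real \<Rightarrow> (real^3) set" where
  "real_line a b = span {vector [a, b, 1]}"

definition g_simple :: "real \<Rightarrow> real \<Rightarrow> real \<Rightarrow> complex \<Rightarrow> complex^3^3" where
  "g_simple \<alpha>' a' b' z = (let \<alpha> = of_real \<alpha>'; a = of_real a'; b = of_real b'; k = 2 * a * b - 1 in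
     mat 1 + (\<chi> i j. 2 / (z ^ 3 - \<alpha> ^ 3) * (vector [
       vector [\<alpha> ^ 3 * a * b / k, \<alpha> * z ^ 2 * b ^ 2 / k, \<alpha> ^ 2 * z * b / k],
       vector [\<alpha> ^ 2 * z * a ^ 2, \<alpha> ^ 3 * a * b, \<alpha> * z ^ 2 * a],
       vector [\<alpha> * z ^ 2 * a, \<alpha> ^ 2 * z * b, \<alpha> ^ 3]] :: complex^3^3) $ i $ j))"

definition h_simple :: "real \<Rightarrow> real \<Rightarrow> real \<Rightarrow> complex \<Rightarrow> complex^3^3" where
  "h_simple \<alpha>' a' b' z = (let \<alpha> = of_real \<alpha>'; a = of_real a'; b = of_real b'; k = 2 * a * b - 1 in
     mat 1 + (\<chi> i j. 2 / (z ^ 3 - \<alpha> ^ 3) * (vector [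
       vector [\<alpha> ^ 3 * (a * b - 1) / k, - \<alpha> * z ^ 2 * b ^ 2 / k, \<alpha> ^ 2 * z * b / k],
       vector [\<alpha> ^ 2 * z * a ^ 2, \<alpha> ^ 3 * (1 - a * b), - \<alpha> * z ^ 2 * a],
       vector [- \<alpha> * z ^ 2 * a, \<alpha> ^ 2 * z * b, 0]] :: complex^3^3) $ i $ j))"

definition line_times :: "(real^3) set \<Rightarrow> complex^3^3 \<Rightarrow> (real^3) set" where
  "line_times L M = (\<lambda>v. v v* re_matrix M) ` L"

text \<open>The matrix \<open>A\<close> with \<open>Res\<^sub>\<lambda>\<^sub>=\<^sub>\<alpha> h\<^sub>\<alpha>\<^sub>,\<^sub>l = 2 \<alpha> A\<close>.\<close>

definition res_matrix :: "real \<Rightarrow> real \<Rightarrow> real \<Rightarrow> complex^3^3" where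
  "res_matrix \<alpha> a b =
     (\<chi> i j. residue (\<lambda>z. h_simple \<alpha> a b z $ i $ j) (of_real \<alpha>) / (2 * of_real \<alpha>))"

text \<open>For a frame \<open>F\<close> one has \<open>ker A = span {(b,a,1)\<^sup>t}\<close> and \<open>F(-\<alpha>) = P (F(\<alpha>)\<^sup>t)\<^sup>-\<^sup>1 P\<close>, so the line below
  is \<open>(a,b,1) F(-\<alpha>)\<close>, whose last component is the scalar solution \<open>(a,b,1) X\<^sub>-\<^sub>\<alpha>\<close> of the system with
  parameter \<open>-\<alpha>\<^sup>3\<close>.\<close>

definition dual_line :: "real \<Rightarrow> real \<Rightarrow> real \<Rightarrow> complex^3^3 \<Rightarrow> (real^3) set" where
  "dual_line \<alpha> a b M = {v. (res_matrix \<alpha> a b ** M ** P_mat) *v complex_vec v = 0}"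

end

theory Submission
  imports Defs
begin

text \<open>
  Up to the scalar \<open>(\<lambda>\<^sup>3 + \<alpha>\<^sup>3) / (\<lambda>\<^sup>3 - \<alpha>\<^sup>3)\<close> the rank 2 element \<open>h\<^sub>\<alpha>\<close> is \<open>g\<^sub>-\<^sub>\<alpha>\<close>, so everything reduces to
  the rank 1 element. If \<open>(a, b, 1) F(\<alpha>) = \<phi> (a\<^sub>1, b\<^sub>1, 1)\<close>, the residues at \<open>\<alpha>\<close> in
  \<open>g\<^bsub>a,b\<^esub> F g\<^bsub>a1,b1\<^esub>\<^sup>-\<^sup>1\<close> cancel, and the twisting condition moves this cancellation to all six
  singularities; uniqueness of the factorization is Liouville's theorem. The functions \<open>a\<^sub>1, b\<^sub>1\<close>
  satisfy a Riccati system which says that \<open>g\<^bsub>a1,b1\<^esub>\<close> gauges the connection form of \<open>h\<close> into the one of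
  \<open>h (2 a\<^sub>1 b\<^sub>1 - 1) = h - 2 (ln \<phi>)\<^sub>x\<^sub>y\<close>, and the third column of \<open>F g\<^bsub>a1,b1\<^esub>\<^sup>-\<^sup>1\<close> is the Tzitzeica transform.
\<close>

text \<open>A dressing is prescribed point by point in \<open>(x,y)\<close>, so nothing in its
  definition makes \<open>Ft\<close> smooth. Uniqueness repairs this: every \<open>Ft\<close> equals
  \<open>g F g1^{-1}\<close>, with \<open>g1\<close> built from the line
  \<open>(a,b,1) F(\<alpha>)\<close>. Away from \<open>z^3 = \<alpha>^3\<close> and
  \<open>z^3 = -\<alpha>^3\<close> it therefore inherits smoothness, and \<open>g F = Ft g1\<close>
  may be differentiated. This is why the frame equations of \<open>Ft\<close> are stated off the six
  singularities.

  Replacing \<open>h_\<alpha>\<close> by \<open>g_{-\<alpha>}\<close> moves the scalar solution. For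
  \<open>F\<close> itself the new line is \<open>(a,b,1) F(-\<alpha>)\<close>, so \<phi> solves the
  system with parameter \<open>-\<alpha>^3\<close>. To keep
  \<open>\<phi> = (a,b,1) X_\<alpha>\<close>, as the comparison with rank 1 demands,
  \<open>h_\<alpha>\<close> has to dress the reversed frame \<open>F(-\<lambda>)\<close>, whose
  value at \<open>-\<alpha>\<close> is \<open>F(\<alpha>)\<close>. Hence the third part of the
  theorem.

  The simple elements are studied in the variable \<open>w = \<lambda>/\<alpha>\<close>, and
  reciprocals such as \<open>1/(2ab-1)\<close> are replaced by letters \<open>K\<close> with
  \<open>K(2ab-1) = 1\<close>. The matrix identities then become questions of polynomial ideal
  membership.\<close>

no_notation fps_nth (infixl "$" 75)

section \<open>Calculus of smooth functions\<close>

lemma Ck_on_cong: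
  assumes "open S" "\<And>x. x \<in> S \<Longrightarrow> f x = g x"
  shows "Ck_on S f k \<longleftrightarrow> Ck_on S g k"
  using assms(2)
proof (induction k arbitrary: f g)
  case 0
  then show ?case by (simp cong: continuous_on_cong)
next
  case (Suc k)
  have *: "(f has_derivative f') (at x) \<longleftrightarrow> (g has_derivative f') (at x)" if "x \<in> S" for x f'
    using has_derivative_transform_within_open[OF _ \<open>open S\<close> that] Suc.prems by metis
  have "f differentiable (at x) \<longleftrightarrow> g differentiable (at x)" if "x \<in> S" for x
    using *[OF that] by (simp add: differentiable_def)
  moreover have "frechet_derivative f (at x) v = frechet_derivative g (at x) v" if "x \<in> S" for x v
    using *[OF that] by (simp add: frechet_derivative_def)
  ultimately show ?case
    using Suc.IH[of "\<lambda>x. frechet_derivative f (at x) v" "\<lambda>x. frechet_derivative g (at x) v" for v]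
    by simp
qed

lemma smooth_on_cong:
  assumes "open S" "\<And>x. x \<in> S \<Longrightarrow> f x = g x"
  shows "smooth_on S f \<longleftrightarrow> smooth_on S g"
  using Ck_on_cong[OF assms] by (simp add: smooth_on_def)

lemma Ck_on_Suc_imp: "Ck_on S f (Suc k) \<Longrightarrow> Ck_on S f k"
proof (induction k arbitrary: f)
  case 0
  then show ?case
    by (simp add: continuous_at_imp_continuous_on differentiable_imp_continuous_within)
next
  case (Suc k)
  from Suc.prems have "\<forall>x\<in>S. f differentiable (at x)"
    and "\<And>v. Ck_on S (\<lambda>x. frechet_derivative f (at x) v) (Suc k)" by simp_all
  with Suc.IH show ?case by simp
qed

text \<open>\<open>Ck_on\<close> refers to \<open>frechet_derivative\<close>. On an open set any
  explicitly known derivative \<open>f'\<close> may take its place, which makes the closure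
  properties below short inductions.\<close>

lemma Ck_on_SucI:
  assumes "open S" "\<And>x. x \<in> S \<Longrightarrow> (f has_derivative f' x) (at x)"
    and "\<And>v. Ck_on S (\<lambda>x. f' x v) k"
  shows "Ck_on S f (Suc k)"
proof -
  have "Ck_on S (\<lambda>x. frechet_derivative f (at x) v) k" for v
    using Ck_on_cong[OF \<open>open S\<close>, of "\<lambda>x. frechet_derivative f (at x) v" "\<lambda>x. f' x v"] assms(3)
      frechet_derivative_at[OF assms(2)] by metis
  then show ?thesis
    using assms(2) by (auto simp: differentiable_def)
qed

lemma Ck_on_SucD:
  assumes "Ck_on S f (Suc k)" "x \<in> S"
  shows "(f has_derivative frechet_derivative f (at x)) (at x)"
  using assms by (simp add: frechet_derivative_works)

lemma Ck_on_const: "open S \<Longrightarrow> Ck_on S (\<lambda>x. c) k"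
  by (induction k arbitrary: c) simp_all

lemma Ck_on_add:
  assumes "open S" "Ck_on S f k" "Ck_on S g k"
  shows "Ck_on S (\<lambda>x. f x + g x) k"
  using assms(2,3)
proof (induction k arbitrary: f g)
  case (Suc k)
  show ?case
    by (rule Ck_on_SucI[OF \<open>open S\<close>
          has_derivative_add[OF Ck_on_SucD[OF Suc.prems(1)] Ck_on_SucD[OF Suc.prems(2)]]])
       (use Suc in auto)
qed (simp add: continuous_on_add)

lemma Ck_on_bounded_linear:
  assumes "open S" "bounded_linear L" "Ck_on S f k"
  shows "Ck_on S (\<lambda>x. L (f x)) k"
  using assms(3)
proof (induction k arbitrary: f)
  case 0
  then show ?case using assms(2) bounded_linear.continuous_on by auto
next
  case (Suc k)
  show ?case
    by (rule Ck_on_SucI[OF \<open>open S\<close>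
          bounded_linear.has_derivative[OF assms(2) Ck_on_SucD[OF Suc.prems]]])
       (use Suc in auto)
qed

lemma Ck_on_bilinear:
  assumes "open S" "bounded_bilinear B" "Ck_on S f k" "Ck_on S g k"
  shows "Ck_on S (\<lambda>x. B (f x) (g x)) k"
  using assms(3,4)
proof (induction k arbitrary: f g)
  case 0
  then show ?case using bounded_bilinear.continuous_on[OF assms(2)] by simp
next
  case (Suc k)
  note Ck_on_Suc_imp[OF Suc.prems(1)] Ck_on_Suc_imp[OF Suc.prems(2)]
  then show ?case
    by (intro Ck_on_SucI[OF \<open>open S\<close> bounded_bilinear.FDERIV[OF assms(2)
          Ck_on_SucD[OF Suc.prems(1)] Ck_on_SucD[OF Suc.prems(2)]]] Ck_on_add[OF \<open>open S\<close>])
       (use Suc in auto)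
qed

text \<open>The derivative of \<open>1/f\<close> contains \<open>1/f\<close> again, needed to one
  order less. The induction therefore runs over the order with \<open>f\<close> fixed.\<close>

lemma Ck_on_inverse:
  fixes f :: "'a::real_normed_vector \<Rightarrow> 'b::real_normed_field"
  assumes "open S" "\<And>x. x \<in> S \<Longrightarrow> f x \<noteq> 0" "Ck_on S f k"
  shows "Ck_on S (\<lambda>x. inverse (f x)) k"
  using assms(3)
proof (induction k)
  case 0
  then show ?case using assms(2) by (auto intro: continuous_on_inverse)
next
  case (Suc k)
  note IH = Suc.IH[OF Ck_on_Suc_imp[OF Suc.prems]]
  have *: "Ck_on S (\<lambda>x. - (inverse (f x) * frechet_derivative f (at x) v * inverse (f x))) k" for v
    using Ck_on_bounded_linear[OF \<open>open S\<close> bounded_linear_minus[OF bounded_linear_ident]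
        Ck_on_bilinear[OF \<open>open S\<close> bounded_bilinear_mult
          Ck_on_bilinear[OF \<open>open S\<close> bounded_bilinear_mult IH] IH]]
      Suc.prems by simp
  show ?case
    by (rule Ck_on_SucI[OF \<open>open S\<close> Deriv.has_derivative_inverse[OF assms(2) Ck_on_SucD[OF Suc.prems]]])
       (use * in auto)
qed

context
  fixes S :: "'a::real_normed_vector set"
  assumes S: "open S"
begin

lemma smooth_on_const: "smooth_on S (\<lambda>x. c)"
  by (simp add: smooth_on_def Ck_on_const[OF S])

lemma smooth_on_bounded_linear:
  "bounded_linear L \<Longrightarrow> smooth_on S f \<Longrightarrow> smooth_on S (\<lambda>x. L (f x))"
  by (simp add: smooth_on_def Ck_on_bounded_linear[OF S])

lemma smooth_on_bilinear:
  "bounded_bilinear B \<Longrightarrow> smooth_on S f \<Longrightarrow> smooth_on S g \<Longrightarrow> smooth_on S (\<lambda>x. B (f x) (g x))"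
  by (simp add: smooth_on_def Ck_on_bilinear[OF S])

lemma smooth_on_add: "smooth_on S f \<Longrightarrow> smooth_on S g \<Longrightarrow> smooth_on S (\<lambda>x. f x + g x)"
  by (simp add: smooth_on_def Ck_on_add[OF S])

lemma smooth_on_minus: "smooth_on S f \<Longrightarrow> smooth_on S (\<lambda>x. - f x)"
  by (rule smooth_on_bounded_linear[OF bounded_linear_minus[OF bounded_linear_ident]])

lemma smooth_on_diff: "smooth_on S f \<Longrightarrow> smooth_on S g \<Longrightarrow> smooth_on S (\<lambda>x. f x - g x)"
  using smooth_on_add[OF _ smooth_on_minus] by simp

lemma smooth_on_mult:
  fixes f g :: "'a \<Rightarrow> 'b::real_normed_algebra"
  shows "smooth_on S f \<Longrightarrow> smooth_on S g \<Longrightarrow> smooth_on S (\<lambda>x. f x * g x)"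
  by (rule smooth_on_bilinear[OF bounded_bilinear_mult])

lemma smooth_on_power:
  fixes f :: "'a \<Rightarrow> 'b::real_normed_algebra_1"
  shows "smooth_on S f \<Longrightarrow> smooth_on S (\<lambda>x. f x ^ n)"
  by (induction n) (simp_all add: smooth_on_const smooth_on_mult)

lemma smooth_on_divide:
  fixes f g :: "'a \<Rightarrow> 'b::real_normed_field"
  assumes "\<And>x. x \<in> S \<Longrightarrow> g x \<noteq> 0" "smooth_on S f" "smooth_on S g"
  shows "smooth_on S (\<lambda>x. f x / g x)"
  using smooth_on_mult[OF assms(2), of "\<lambda>x. inverse (g x)"] Ck_on_inverse[OF S, of g] assms
  by (simp add: smooth_on_def divide_inverse)

lemma smooth_on_of_real:
  fixes f :: "'a \<Rightarrow> real"
  shows "smooth_on S f \<Longrightarrow> smooth_on S (\<lambda>x. of_real (f x) :: 'b::{real_normed_algebra_1})"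
  by (rule smooth_on_bounded_linear[OF bounded_linear_of_real])

text \<open>A vector is the finite sum of its components placed along the axes, and each placement
  is a bounded linear map.\<close>

lemma smooth_on_vec:
  fixes f :: "'a \<Rightarrow> ('b::euclidean_space)^'n"
  assumes "\<And>i. smooth_on S (\<lambda>x. f x $ i)"
  shows "smooth_on S f"
proof -
  have lin: "bounded_linear (axis i :: 'b \<Rightarrow> 'b^'n)" for i
    by (intro linear_conv_bounded_linear[THEN iffD1] linearI)
       (auto simp: axis_def vec_eq_iff)
  have "smooth_on S (\<lambda>x. \<Sum>i\<in>A. axis i (f x $ i) :: 'b^'n)" if "finite A" for A
    using that
  proof induction
    case (insert i A)
    then show ?case
      using smooth_on_add[OF smooth_on_bounded_linear[OF lin assms] insert.IH] by simp
  qed (simp add: smooth_on_const)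
  from this[of UNIV] have "smooth_on S (\<lambda>x. \<Sum>i\<in>UNIV. axis i (f x $ i))" by simp
  moreover have "(\<lambda>x. \<Sum>i\<in>UNIV. axis i (f x $ i)) = f"
    by (simp add: fun_eq_iff vec_eq_iff axis_def)
  ultimately show ?thesis by simp
qed

end

lemmas smooth_on_intros = smooth_on_const smooth_on_add smooth_on_minus smooth_on_diff
  smooth_on_mult smooth_on_power smooth_on_divide smooth_on_of_real

lemma smooth_on_imp_differentiable: "smooth_on S f \<Longrightarrow> x \<in> S \<Longrightarrow> f differentiable (at x)"
  using Ck_on.simps(2)[of S f 0] by (simp only: smooth_on_def) blast

lemma smooth_on_frechet_derivative:
  "smooth_on S f \<Longrightarrow> smooth_on S (\<lambda>x. frechet_derivative f (at x) v)"
  using Ck_on.simps(2)[of S f] by (simp only: smooth_on_def) blast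

section \<open>Partial derivatives\<close>

lemma
  assumes "(f has_derivative f') (at p)"
  shows dx_eqI: "dx f p = f' (1, 0)" and dy_eqI: "dy f p = f' (0, 1)"
proof -
  interpret f': bounded_linear f' using assms by (rule has_derivative_bounded_linear)
  have "((\<lambda>t. (t, snd p)) has_derivative (\<lambda>u. (u, 0))) (at (fst p))"
    by (auto intro!: derivative_eq_intros)
  moreover have "(\<lambda>u. f' (u, 0)) = (\<lambda>u. u *\<^sub>R f' (1, 0))"
    by (simp flip: f'.scaleR)
  ultimately
  have "((\<lambda>t. f (t, snd p)) has_vector_derivative f' (1, 0)) (at (fst p))"
    using has_derivative_compose[of "\<lambda>t. (t, snd p)" _ "fst p" UNIV f f'] assms
    by (fastforce simp: has_vector_derivative_def)
  then show "dx f p = f' (1, 0)" by (simp add: dx_def vector_derivative_at)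
  have "((\<lambda>t. (fst p, t)) has_derivative (\<lambda>u. (0, u))) (at (snd p))"
    by (auto intro!: derivative_eq_intros)
  moreover have "(\<lambda>u. f' (0, u)) = (\<lambda>u. u *\<^sub>R f' (0, 1))"
    by (simp flip: f'.scaleR)
  ultimately
  have "((\<lambda>t. f (fst p, t)) has_vector_derivative f' (0, 1)) (at (snd p))"
    using has_derivative_compose[of "\<lambda>t. (fst p, t)" _ "snd p" UNIV f f'] assms
    by (fastforce simp: has_vector_derivative_def)
  then show "dy f p = f' (0, 1)" by (simp add: dy_def vector_derivative_at)
qed

lemma
  assumes "f differentiable (at p)"
  shows dx_eq_frechet: "dx f p = frechet_derivative f (at p) (1, 0)"
    and dy_eq_frechet: "dy f p = frechet_derivative f (at p) (0, 1)"
  using dx_eqI dy_eqI assms unfolding frechet_derivative_works by blast+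

lemma
  assumes "open D" "smooth_on D f"
  shows smooth_on_dx: "smooth_on D (dx f)" and smooth_on_dy: "smooth_on D (dy f)"
proof -
  note fr = smooth_on_frechet_derivative[OF assms(2)]
  note diff = smooth_on_imp_differentiable[OF assms(2)]
  show "smooth_on D (dx f)"
    using smooth_on_cong[OF assms(1), of "dx f" "\<lambda>p. frechet_derivative f (at p) (1, 0)"] fr
      dx_eq_frechet[OF diff] by blast
  show "smooth_on D (dy f)"
    using smooth_on_cong[OF assms(1), of "dy f" "\<lambda>p. frechet_derivative f (at p) (0, 1)"] fr
      dy_eq_frechet[OF diff] by blast
qed

lemma
  assumes "open D" "p \<in> D" "\<And>q. q \<in> D \<Longrightarrow> f q = g q"
  shows dx_cong: "dx f p = dx g p" and dy_cong: "dy f p = dy g p"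
proof -
  obtain A B where AB: "open A" "open B" "fst p \<in> A" "snd p \<in> B" "A \<times> B \<subseteq> D"
    using open_prod_elim[OF assms(1,2)] by (metis mem_Times_iff)
  have "((\<lambda>t. f (t, snd p)) has_vector_derivative d) (at (fst p)) \<longleftrightarrow>
      ((\<lambda>t. g (t, snd p)) has_vector_derivative d) (at (fst p))" for d
  proof (rule has_vector_derivative_cong_ev)
    show "\<forall>\<^sub>F x in nhds (fst p). x \<in> UNIV \<longrightarrow> f (x, snd p) = g (x, snd p)"
      by (rule eventually_mono[OF eventually_nhds_in_open[of A]]) (use AB assms(3) in auto)
  qed (use assms in auto)
  then show "dx f p = dx g p" by (simp add: dx_def vector_derivative_def)
  have "((\<lambda>t. f (fst p, t)) has_vector_derivative d) (at (snd p)) \<longleftrightarrow>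
      ((\<lambda>t. g (fst p, t)) has_vector_derivative d) (at (snd p))" for d
  proof (rule has_vector_derivative_cong_ev)
    show "\<forall>\<^sub>F x in nhds (snd p). x \<in> UNIV \<longrightarrow> f (fst p, x) = g (fst p, x)"
      by (rule eventually_mono[OF eventually_nhds_in_open[of B]]) (use AB assms(3) in auto)
  qed (use assms in auto)
  then show "dy f p = dy g p" by (simp add: dy_def vector_derivative_def)
qed

lemma
  assumes "f differentiable (at p)" "g differentiable (at p)"
  shows dy_add: "dy (\<lambda>q. f q + g q) p = dy f p + dy g p"
    and dx_diff: "dx (\<lambda>q. f q - g q) p = dx f p - dx g p"
    and dy_diff: "dy (\<lambda>q. f q - g q) p = dy f p - dy g p"
  using assms[unfolded frechet_derivative_works] assms
  by (simp_all add: dy_eqI[OF has_derivative_add]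
      dx_eqI[OF has_derivative_diff] dy_eqI[OF has_derivative_diff] dx_eq_frechet dy_eq_frechet)

lemma
  assumes "bounded_linear L" "f differentiable (at p)"
  shows dx_linear: "dx (\<lambda>q. L (f q)) p = L (dx f p)"
    and dy_linear: "dy (\<lambda>q. L (f q)) p = L (dy f p)"
  using assms(2)[unfolded frechet_derivative_works] assms
  by (simp_all add: dx_eqI[OF bounded_linear.has_derivative] dy_eqI[OF bounded_linear.has_derivative]
      dx_eq_frechet dy_eq_frechet)

lemma
  assumes "bounded_bilinear B" "f differentiable (at p)" "g differentiable (at p)"
  shows dx_bilinear: "dx (\<lambda>q. B (f q) (g q)) p = B (f p) (dx g p) + B (dx f p) (g p)"
    and dy_bilinear: "dy (\<lambda>q. B (f q) (g q)) p = B (f p) (dy g p) + B (dy f p) (g p)"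
  using dx_eqI[OF bounded_bilinear.FDERIV[OF assms(1) assms(2,3)[unfolded frechet_derivative_works]]]
    dy_eqI[OF bounded_bilinear.FDERIV[OF assms(1) assms(2,3)[unfolded frechet_derivative_works]]] assms
  by (simp_all add: dx_eq_frechet dy_eq_frechet)

lemma
  fixes f g :: "real \<times> real \<Rightarrow> 'a::real_normed_algebra"
  assumes "f differentiable (at p)" "g differentiable (at p)"
  shows dx_mult: "dx (\<lambda>q. f q * g q) p = f p * dx g p + dx f p * g p"
    and dy_mult: "dy (\<lambda>q. f q * g q) p = f p * dy g p + dy f p * g p"
  using dx_bilinear[OF bounded_bilinear_mult assms] dy_bilinear[OF bounded_bilinear_mult assms] by auto

lemma
  fixes f g :: "real \<times> real \<Rightarrow> 'a::real_normed_field"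
  assumes "f differentiable (at p)" "g differentiable (at p)" "g p \<noteq> 0"
  shows dx_divide: "dx (\<lambda>q. f q / g q) p = (dx f p * g p - f p * dx g p) / (g p)\<^sup>2"
    and dy_divide: "dy (\<lambda>q. f q / g q) p = (dy f p * g p - f p * dy g p) / (g p)\<^sup>2"
  using dx_eqI[OF has_derivative_divide'[OF assms(1,2)[unfolded frechet_derivative_works] assms(3)]]
    dy_eqI[OF has_derivative_divide'[OF assms(1,2)[unfolded frechet_derivative_works] assms(3)]] assms
  by (simp_all add: dx_eq_frechet dy_eq_frechet power2_eq_square)

lemma dx_const [simp]: "dx (\<lambda>q. c) p = 0" and dy_const [simp]: "dy (\<lambda>q. c) p = 0"
  by (simp_all add: dx_eqI[OF has_derivative_const] dy_eqI[OF has_derivative_const])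

section \<open>Simple elements\<close>

lemma mat_1_3: "(mat 1 :: 'a::{zero,one}^3^3) =
    vector [vector [1, 0, 0], vector [0, 1, 0], vector [0, 0, 1]]"
  by (simp add: vec_eq_iff forall_3 mat_def)

lemma transpose_3: "transpose (vector [vector [a, b, c], vector [d, e, f], vector [g, h, i]]) =
    (vector [vector [a, d, g], vector [b, e, h], vector [c, f, i]] :: 'a::zero^3^3)"
  by (simp add: vec_eq_iff forall_3 transpose_def)

lemma matrix_mult_3:
  "(vector [vector [a11, a12, a13], vector [a21, a22, a23], vector [a31, a32, a33]] :: 'a::semiring_1^3^3) **
   vector [vector [b11, b12, b13], vector [b21, b22, b23], vector [b31, b32, b33]] =
   (vector [vector [a11*b11 + a12*b21 + a13*b31, a11*b12 + a12*b22 + a13*b32, a11*b13 + a12*b23 + a13*b33],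
           vector [a21*b11 + a22*b21 + a23*b31, a21*b12 + a22*b22 + a23*b32, a21*b13 + a22*b23 + a23*b33],
           vector [a31*b11 + a32*b21 + a33*b31, a31*b12 + a32*b22 + a33*b32, a31*b13 + a32*b23 + a33*b33]]
     :: 'a::semiring_1^3^3)"
  by (simp add: vec_eq_iff forall_3 matrix_matrix_mult_def sum_3)

lemma matrix_3_eq_iff:
  "(vector [vector [a11, a12, a13], vector [a21, a22, a23], vector [a31, a32, a33]] :: 'a::zero^3^3) =
   vector [vector [b11, b12, b13], vector [b21, b22, b23], vector [b31, b32, b33]] \<longleftrightarrow>
   a11 = b11 \<and> a12 = b12 \<and> a13 = b13 \<and> a21 = b21 \<and> a22 = b22 \<and> a23 = b23 \<and>
   a31 = b31 \<and> a32 = b32 \<and> a33 = b33"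
  by (simp add: vec_eq_iff forall_3)

lemmas matrix_3_simps = mat_1_3 transpose_3 matrix_mult_3 matrix_3_eq_iff T_mat_def P_mat_def

lemma eps_Re_Im: "eps = Complex (1/2) (sqrt 3 / 2)"
  by (simp add: eps_def exp_eq_polar complex_eq_iff cos_60 sin_60 flip: cis_conv_exp)

lemma eps_sq: "eps\<^sup>2 = eps - 1"
  by (simp add: eps_Re_Im power2_eq_square complex_eq_iff)

lemma eps_cube: "eps ^ 3 = - 1"
  using eps_sq by algebra

lemma eps_nz [simp]: "eps \<noteq> 0"
  using eps_cube by auto

lemma norm_eps [simp]: "norm eps = 1"
  by (simp add: eps_def norm_exp_eq_Re)

lemma eps_mult_cube: "(eps * z) ^ 3 = - (z ^ 3)"
  by (simp add: power_mult_distrib eps_cube)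

text \<open>For \<open>w\<^sup>3 = 1\<close> the residue at \<open>w\<close> of the simple element with \<open>\<alpha> = 1\<close> is \<open>(2 w / 3) simple_res a b w\<close>.\<close>

definition simple_res :: "complex \<Rightarrow> complex \<Rightarrow> complex \<Rightarrow> complex^3^3" where
  "simple_res a b w = vector [
     vector [a * b / (2 * a * b - 1), w ^ 2 * b ^ 2 / (2 * a * b - 1), w * b / (2 * a * b - 1)],
     vector [w * a ^ 2, a * b, w ^ 2 * a],
     vector [w ^ 2 * a, w * b, 1]]"

text \<open>Scaling by an element of the entry type, hence by complex numbers for complex matrices;
  \<open>*\<^sub>R\<close> scales by reals only.\<close>

definition smat :: "'a::times \<Rightarrow> 'a^'n^'m \<Rightarrow> 'a^'n^'m" where
  "smat c M = (\<chi> i j. c * M $ i $ j)"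

lemma smat_nth [simp]: "smat c M $ i $ j = c * M $ i $ j"
  by (simp add: smat_def)

lemma smat_mult_left: "smat c M ** N = smat c (M ** N)" for M :: "'a::comm_semiring_1^'n^'m"
  by (simp add: vec_eq_iff matrix_matrix_mult_def sum_distrib_left mult.assoc)

lemma smat_mult_right: "M ** smat c N = smat c (M ** N)" for M :: "'a::comm_semiring_1^'n^'m"
  by (simp add: vec_eq_iff matrix_matrix_mult_def sum_distrib_left mult.left_commute)

lemma smat_smat: "smat c (smat d M) = smat (c * d) M" for M :: "'a::comm_semiring_1^'n^'m"
  by (simp add: vec_eq_iff mult.assoc)

lemma smat_vec: "smat c M *v v = c *s (M *v v)" for M :: "'a::comm_semiring_1^'n^'m"
  by (simp add: vec_eq_iff matrix_vector_mult_def sum_distrib_left mult.assoc)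

lemma smat_add: "smat c (M + N) = smat c M + smat c N" for M :: "'a::semiring^'n^'m"
  by (simp add: vec_eq_iff distrib_left)

lemma transpose_smat: "transpose (smat c M) = smat c (transpose M)"
  by (simp add: vec_eq_iff transpose_def)

lemma transpose_add: "transpose (M + N) = transpose M + transpose N"
  by (simp add: vec_eq_iff transpose_def)

text \<open>The rank 1 element with \<open>\<alpha> = 1\<close> and complex \<open>a\<close>,
  \<open>b\<close>. The general one is obtained by substituting
  \<open>w = \<lambda>/\<alpha>\<close>, see \<open>g_simple_eq\<close>.\<close>

definition simple_elt :: "complex \<Rightarrow> complex \<Rightarrow> complex \<Rightarrow> complex^3^3" where
  "simple_elt a b w = mat 1 + smat (2 / (w ^ 3 - 1)) (simple_res a b w)"

text \<open>These are the two symmetries of the simple element with denominators cleared: the first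
  leads to \<open>g(w) P g(-w)^t = P\<close>, the second to
  \<open>g(eps w) T g(w)^t = T\<close>.\<close>

lemma simple_res_relations:
  assumes "2 * a * b \<noteq> 1"
  shows "smat (w ^ 3 + 1) (simple_res a b w ** P_mat) - smat (w ^ 3 - 1) (P_mat ** transpose (simple_res a b (- w)))
      = smat 2 (simple_res a b w ** P_mat ** transpose (simple_res a b (- w)))" (is ?P)
    and "smat (w ^ 3 + 1) (T_mat ** transpose (simple_res a b w)) - smat (w ^ 3 - 1) (simple_res a b (eps * w) ** T_mat)
      = smat 2 (simple_res a b (eps * w) ** T_mat ** transpose (simple_res a b w))" (is ?T)
proof -
  \<comment> \<open>With \<open>K\<close> as an independent letter tied by
    \<open>K(2ab-1) = 1\<close>, every entry is a polynomial identity modulo this relation and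
    \<open>eps^2 = eps - 1\<close>.\<close>
  define K where "K = 1 / (2 * a * b - 1)"
  have K: "K * (2 * a * b - 1) = 1"
    using assms by (simp add: K_def)
  have eqs: "\<And>x. x / (2 * a * b - 1) = x * K"
    by (simp add: K_def)
  show ?P
    unfolding simple_res_def matrix_3_simps eqs
    apply (simp add: vec_eq_iff forall_3)
    apply (intro conjI; (algebra | use K in algebra))
    done
  show ?T
    unfolding simple_res_def matrix_3_simps eqs
    apply (simp add: vec_eq_iff forall_3)
    apply (intro conjI)
    apply (algebra | use K in algebra | use eps_sq in algebra | use K eps_sq in algebra)+
    done
qed

lemma matrix_add_rdistrib: "(A + B) ** C = A ** C + B ** C" for A :: "'a::semiring_1^'n^'m"
  by (simp add: vec_eq_iff matrix_matrix_mult_def distrib_right sum.distrib)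

text \<open>After expansion the three terms besides \<open>Q\<close> have the common denominator
  \<open>(w^3-1)(w^3+1)\<close>, and the last hypothesis says that their numerator vanishes.\<close>

lemma simple_elt_twist_aux:
  fixes M N Q :: "complex^3^3"
  assumes "w ^ 3 \<noteq> 1" "w ^ 3 \<noteq> - 1"
    and "smat (w ^ 3 + 1) (M ** Q) - smat (w ^ 3 - 1) (Q ** N) = smat 2 (M ** Q ** N)"
  shows "(mat 1 + smat (2 / (w ^ 3 - 1)) M) ** Q ** (mat 1 + smat (- 2 / (w ^ 3 + 1)) N) = Q"
proof -
  define m p where "m = w ^ 3 - 1" and "p = w ^ 3 + 1"
  have nz: "m \<noteq> 0" "p \<noteq> 0"
    using assms(1,2) by (auto simp: m_def p_def eq_neg_iff_add_eq_0)
  have "2 / m * (M ** Q) $ i $ j + - 2 / p * (Q ** N) $ i $ j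
      + 2 / m * (- 2 / p) * (M ** Q ** N) $ i $ j = 0" for i j
  proof -
    have "p * (M ** Q) $ i $ j - m * (Q ** N) $ i $ j = 2 * (M ** Q ** N) $ i $ j"
      using arg_cong[OF assms(3), of "\<lambda>X. X $ i $ j"] by (simp add: m_def p_def)
    then have h: "p * (M ** Q) $ i $ j - m * (Q ** N) $ i $ j - 2 * (M ** Q ** N) $ i $ j = 0"
      by simp
    have L: "2 / m * x + - 2 / p * y + 2 / m * (- 2 / p) * z = 2 / (m * p) * (p * x - m * y - 2 * z)"
      for x y z using nz by (simp add: field_simps)
    show ?thesis unfolding L h by simp
  qed
  then have eq0: "smat (2 / m) (M ** Q) + smat (- 2 / p) (Q ** N) + smat (2 / m * (- 2 / p)) (M ** Q ** N) = 0"
    by (simp add: vec_eq_iff)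
  have "(mat 1 + smat (2 / m) M) ** Q ** (mat 1 + smat (- 2 / p) N) =
      Q + (smat (2 / m) (M ** Q) + smat (- 2 / p) (Q ** N) + smat (2 / m * (- 2 / p)) (M ** Q ** N))"
    by (simp only: matrix_add_ldistrib matrix_add_rdistrib smat_mult_left smat_mult_right smat_smat smat_add
        matrix_mul_lid matrix_mul_rid matrix_mul_assoc) (simp add: ac_simps)
  then show ?thesis
    unfolding eq0 by (simp add: m_def p_def)
qed

text \<open>The first relation is the twisting condition written without inverses. The second
  computes the inverse of \<open>g(w)\<close> as \<open>P g(-w)^t P\<close>. Both use that
  \<open>w\<close> to \<open>eps w\<close> and \<open>w\<close> to \<open>-w\<close> change the sign
  of \<open>w^3\<close>, which turns \<open>w^3 - 1\<close> into \<open>-(w^3 + 1)\<close>.\<close>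

lemma simple_elt_twisted:
  assumes "w ^ 3 \<noteq> 1" "w ^ 3 \<noteq> - 1" "2 * a * b \<noteq> 1"
  shows "simple_elt a b (eps * w) ** T_mat ** transpose (simple_elt a b w) = T_mat"
    and "simple_elt a b w ** P_mat ** transpose (simple_elt a b (- w)) = P_mat"
proof -
  have neg: "2 / ((- w) ^ 3 - 1) = - 2 / (w ^ 3 + 1)" "2 / ((eps * w) ^ 3 - 1) = - 2 / (w ^ 3 + 1)"
    using minus_divide_divide[of "- 2" "w ^ 3 + 1"] by (simp_all add: eps_mult_cube)
  have neg': "- 2 / ((eps * w) ^ 3 + 1) = 2 / (w ^ 3 - 1)"
    using minus_divide_divide[of 2 "w ^ 3 - 1"] by (simp add: eps_mult_cube)
  show "simple_elt a b w ** P_mat ** transpose (simple_elt a b (- w)) = P_mat"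
    unfolding simple_elt_def transpose_add transpose_smat transpose_mat neg
    by (rule simple_elt_twist_aux[OF assms(1,2) simple_res_relations(1)[OF assms(3)]])
  have "smat ((eps * w) ^ 3 + 1) (simple_res a b (eps * w) ** T_mat)
      - smat ((eps * w) ^ 3 - 1) (T_mat ** transpose (simple_res a b w))
      = smat 2 (simple_res a b (eps * w) ** T_mat ** transpose (simple_res a b w))"
    unfolding simple_res_relations(2)[OF assms(3), symmetric]
    by (simp add: vec_eq_iff eps_mult_cube) (simp add: algebra_simps)
  moreover have "(eps * w) ^ 3 \<noteq> 1" "(eps * w) ^ 3 \<noteq> - 1"
    using assms by (auto simp: eps_mult_cube minus_equation_iff)
  ultimately show "simple_elt a b (eps * w) ** T_mat ** transpose (simple_elt a b w) = T_mat"
    unfolding simple_elt_def transpose_add transpose_smat transpose_mat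
    using simple_elt_twist_aux neg' by metis
qed

lemma det_3_divide:
  "det (vector [vector [a / (m * k), b / (m * k), c / (m * k)], vector [d / m, e / m, f / m],
      vector [g / m, h / m, i / m]] :: 'a::field^3^3) =
    (a * e * i + b * f * g + c * d * h - a * f * h - b * d * i - c * e * g) / (m * k * m * m)"
  by (simp add: det_3 add_divide_distrib diff_divide_distrib ac_simps)

lemma det_simple_elt:
  assumes "w ^ 3 \<noteq> 1" "2 * a * b \<noteq> 1"
  shows "det (simple_elt a b w) = (w ^ 3 + 1) / (w ^ 3 - 1)"
proof -
  define m k where "m = w ^ 3 - 1" and "k = 2 * a * b - 1"
  have nz: "m \<noteq> 0" "k \<noteq> 0"
    using assms by (simp_all add: m_def k_def)
  have "simple_elt a b w = vector [
     vector [(m * k + 2 * a * b) / (m * k), 2 * w ^ 2 * b ^ 2 / (m * k), 2 * w * b / (m * k)],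
     vector [2 * w * a ^ 2 / m, (m + 2 * a * b) / m, 2 * w ^ 2 * a / m],
     vector [2 * w ^ 2 * a / m, 2 * w * b / m, (m + 2) / m]]"
    unfolding simple_elt_def simple_res_def m_def[symmetric] k_def[symmetric]
    using nz by (simp add: vec_eq_iff forall_3 mat_def field_simps)
  then have "det (simple_elt a b w) =
     ((m * k + 2 * a * b) * (m + 2 * a * b) * (m + 2)
      + 2 * w ^ 2 * b ^ 2 * (2 * w ^ 2 * a) * (2 * w ^ 2 * a)
      + 2 * w * b * (2 * w * a ^ 2) * (2 * w * b)
      - (m * k + 2 * a * b) * (2 * w ^ 2 * a) * (2 * w * b)
      - 2 * w ^ 2 * b ^ 2 * (2 * w * a ^ 2) * (m + 2)
      - 2 * w * b * (m + 2 * a * b) * (2 * w ^ 2 * a)) / (m * k * m * m)"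
    by (simp only: det_3_divide)
  \<comment> \<open>The numerator contains all the dependence on \<open>a\<close>, \<open>b\<close>
    in the factor \<open>k\<close>, which cancels; \<open>m + 2\<close> is
    \<open>w^3 + 1\<close>.\<close>
  also have "\<dots> = (k * m ^ 2 * (m + 2)) / (m * k * m * m)"
    unfolding m_def k_def by (rule arg_cong2[where f = "(/)", OF _ refl]) algebra
  also have "\<dots> = (m + 2) / m"
    using nz by (simp add: power2_eq_square)
  finally show ?thesis
    by (simp add: m_def)
qed

lemma scale_cube:
  fixes z w \<alpha> :: "'a::field"
  assumes "\<alpha> \<noteq> 0" "z = \<alpha> * w"
  shows "2 / (z ^ 3 - \<alpha> ^ 3) * y = 2 / (w ^ 3 - 1) * (y / \<alpha> ^ 3)"
proof -
  have "z ^ 3 - \<alpha> ^ 3 = (w ^ 3 - 1) * \<alpha> ^ 3"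
    using assms by (simp add: power_mult_distrib algebra_simps)
  then show ?thesis by simp
qed

lemma g_simple_eq:
  assumes "\<alpha> \<noteq> 0"
  shows "g_simple \<alpha> a b z = simple_elt (of_real a) (of_real b) (z / of_real \<alpha>)"
proof -
  define w \<beta> k where "w = z / \<beta>" and "\<beta> = complex_of_real \<alpha>" and "k = 2 * complex_of_real a * of_real b - 1"
  have nz: "\<beta> \<noteq> 0" and z: "z = \<beta> * w"
    using assms by (auto simp: w_def \<beta>_def)
  show ?thesis
    unfolding g_simple_def simple_elt_def simple_res_def Let_def \<beta>_def[symmetric] w_def[symmetric]
      k_def[symmetric] scale_cube[OF nz z]
    using nz by (simp add: vec_eq_iff forall_3)
      (simp add: z power_mult_distrib power2_eq_square power3_eq_cube)
qed

lemma of_real_nondegenerate: "2 * a * b \<noteq> 1 \<Longrightarrow> 2 * complex_of_real a * of_real b \<noteq> 1"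
  by (metis of_real_eq_1_iff of_real_mult of_real_numeral)

text \<open>The numerator of \<open>h_simple\<close> is \<open>I - M(-w)\<close> with
  \<open>M\<close> the numerator of \<open>g_simple\<close>: off the diagonal, entries of odd degree
  in \<open>w\<close> keep their sign and those of even degree change it, while
  \<open>(ab-1)/k = 1 - ab/k\<close> for \<open>k = 2ab-1\<close> settles the corner of the
  diagonal.\<close>

lemma h_simple_eq:
  assumes "\<alpha> \<noteq> 0" "2 * a * b \<noteq> 1" and w: "w = z / of_real \<alpha>"
  shows "h_simple \<alpha> a b z = mat 1 + smat (2 / (w ^ 3 - 1)) (mat 1 - simple_res (of_real a) (of_real b) (- w))"
proof -
  define \<beta> A B where "\<beta> = complex_of_real \<alpha>" and "A = complex_of_real a" and "B = complex_of_real b"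
  define k where "k = 2 * A * B - 1"
  have nz: "\<beta> \<noteq> 0" and z: "z = \<beta> * w"
    using assms by (auto simp: w \<beta>_def)
  have k: "k \<noteq> 0"
    using of_real_nondegenerate[OF assms(2)] by (simp add: k_def A_def B_def)
  have "\<beta> ^ 3 * (A * B - 1) / k = \<beta> ^ 3 * (1 - A * B / k)"
    using k by (simp add: k_def field_simps)
  then have "(vector [
       vector [\<beta> ^ 3 * (A * B - 1) / k, - \<beta> * z ^ 2 * B ^ 2 / k, \<beta> ^ 2 * z * B / k],
       vector [\<beta> ^ 2 * z * A ^ 2, \<beta> ^ 3 * (1 - A * B), - \<beta> * z ^ 2 * A],
       vector [- \<beta> * z ^ 2 * A, \<beta> ^ 2 * z * B, 0]] :: complex^3^3)
    = smat (\<beta> ^ 3) (mat 1 - simple_res A B (- w))" (is "?N = _")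
    unfolding mat_1_3 simple_res_def k_def[symmetric]
    by (simp add: vec_eq_iff forall_3) (simp add: z power2_eq_square power3_eq_cube)
  then have "?N $ i $ j / \<beta> ^ 3 = (mat 1 - simple_res A B (- w)) $ i $ j" for i j
    using nz by simp
  then show ?thesis
    unfolding h_simple_def Let_def \<beta>_def[symmetric] A_def[symmetric] B_def[symmetric]
      k_def[symmetric] scale_cube[OF nz z]
    by (simp only: vec_eq_iff vec_lambda_beta vector_add_component smat_nth simp_thms)
qed

text \<open>With \<open>m = w^3 - 1\<close> and \<open>p = w^3 + 1\<close> this is
  \<open>1 + (2/m)(1 - y) = (p/m)(1 - (2/p) y)\<close>, valid since \<open>p = m + 2\<close>. At
  \<open>z^3 = -\<alpha>^3\<close> the left side is regular, but the scalar vanishes at a pole of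
  \<open>g_{-\<alpha>}\<close>; with division by zero giving zero the equation fails there, so these
  points are excluded.\<close>

lemma h_simple_eq_smat:
  assumes "\<alpha> \<noteq> 0" "z ^ 3 \<noteq> of_real \<alpha> ^ 3" "z ^ 3 \<noteq> - (of_real \<alpha> ^ 3)" "2 * a * b \<noteq> 1"
  shows "h_simple \<alpha> a b z =
    smat ((z ^ 3 + of_real \<alpha> ^ 3) / (z ^ 3 - of_real \<alpha> ^ 3)) (g_simple (- \<alpha>) a b z)"
proof -
  define w where "w = z / of_real \<alpha>"
  define m p where "m = w ^ 3 - 1" and "p = w ^ 3 + 1"
  have eq: "(z ^ 3 + of_real \<alpha> ^ 3) = of_real \<alpha> ^ 3 * p"
    "(z ^ 3 - of_real \<alpha> ^ 3) = of_real \<alpha> ^ 3 * m"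
    using assms(1) by (simp_all add: w_def m_def p_def power_divide field_simps)
  then have nz: "m \<noteq> 0" "p \<noteq> 0"
    using assms by (auto simp: eq_neg_iff_add_eq_0)
  have p: "2 / (- (w ^ 3) - 1) = - 2 / p" "p = m + 2"
    by (simp_all add: p_def m_def) (metis minus_add_distrib diff_conv_add_uminus minus_divide_right)
  have *: "d + 2 / m * (d - y) = p / m * (d + - 2 / p * y)" for d y
  proof -
    have "p / m * (d + - 2 / p * y) = p / m * d - 2 / m * y"
      using nz by (simp add: right_diff_distrib)
    moreover have "p / m = 1 + 2 / m"
      using nz(1) by (simp add: p(2) add_divide_distrib)
    ultimately show ?thesis
      by (simp add: distrib_right right_diff_distrib)
  qed
  have "g_simple (- \<alpha>) a b z = mat 1 + smat (- 2 / p) (simple_res (of_real a) (of_real b) (- w))"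
    using assms(1) by (simp add: g_simple_eq simple_elt_def p(1) flip: w_def)
  moreover have "of_real \<alpha> ^ 3 * p / (of_real \<alpha> ^ 3 * m) = p / m"
    using assms(1) by simp
  ultimately show ?thesis
    unfolding h_simple_eq[OF assms(1,4) w_def] eq
    by (simp only: vec_eq_iff smat_nth vector_add_component vector_minus_component * flip: m_def) simp
qed

section \<open>Loop groups\<close>

lemma
  assumes "invertible A"
  shows matrix_inv_right: "A ** matrix_inv A = mat 1" and matrix_inv_left: "matrix_inv A ** A = mat 1"
  using someI_ex[OF assms[unfolded invertible_def]] unfolding matrix_inv_def by blast+

lemma matrix_mul_left_cancel:
  fixes A :: "'a::field^'n^'n"
  assumes "invertible A"
  shows "A ** B = A ** C \<longleftrightarrow> B = C"
proof
  assume "A ** B = A ** C"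
  from arg_cong[OF this, of "\<lambda>M. matrix_inv A ** M"] show "B = C"
    by (simp only: matrix_mul_assoc matrix_inv_left[OF assms] matrix_mul_lid)
qed simp

lemma matrix_mul_right_cancel:
  fixes A :: "'a::field^'n^'n"
  assumes "invertible A"
  shows "B ** A = C ** A \<longleftrightarrow> B = C"
proof
  assume "B ** A = C ** A"
  from arg_cong[OF this, of "\<lambda>M. M ** matrix_inv A"] show "B = C"
    by (simp only: matrix_mul_assoc[symmetric] matrix_inv_right[OF assms] matrix_mul_rid)
qed simp

definition minor2 :: "'a::comm_ring_1^3^3 \<Rightarrow> 3 \<Rightarrow> 3 \<Rightarrow> 3 \<Rightarrow> 3 \<Rightarrow> 'a" where
  "minor2 A i j k l = A $ i $ k * A $ j $ l - A $ i $ l * A $ j $ k"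

text \<open>The adjugate; the swapped column indices in some of the minors supply the cofactor
  signs. Its entries are polynomials, so inverses written through it are visibly continuous and
  holomorphic.\<close>

definition adj3 :: "'a::comm_ring_1^3^3 \<Rightarrow> 'a^3^3" where
  "adj3 A = vector [
     vector [minor2 A 2 3 2 3, minor2 A 1 3 3 2, minor2 A 1 2 2 3],
     vector [minor2 A 2 3 3 1, minor2 A 1 3 1 3, minor2 A 1 2 3 1],
     vector [minor2 A 2 3 1 2, minor2 A 1 3 2 1, minor2 A 1 2 1 2]]"

lemma
  shows adj3_right: "A ** adj3 A = smat (det A) (mat 1)"
    and adj3_left: "adj3 A ** A = smat (det A) (mat 1)"
  unfolding vec_eq_iff forall_3 matrix_matrix_mult_def sum_3 det_3 adj3_def minor2_def
  by (simp_all add: mat_def) (simp_all add: algebra_simps)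

lemma smat_1 [simp]: "smat 1 A = (A :: 'a::comm_semiring_1^'n^'m)"
  by (simp add: vec_eq_iff)

lemma matrix_inv_adj3:
  fixes A :: "'a::field^3^3"
  assumes "det A \<noteq> 0"
  shows "matrix_inv A = smat (1 / det A) (adj3 A)"
proof -
  have "A ** matrix_inv A = A ** smat (1 / det A) (adj3 A)"
    using assms by (simp add: smat_mult_right adj3_right smat_smat matrix_inv_right invertible_det_nz)
  then show ?thesis
    using assms by (simp add: matrix_mul_left_cancel invertible_det_nz)
qed

lemma det_T_mat: "det T_mat \<noteq> 0"
  by (simp add: T_mat_def det_3)

lemma P_mat_P_mat [simp]: "P_mat ** P_mat = (mat 1 :: 'a::comm_ring_1^3^3)"
  by (simp add: matrix_3_simps)

lemma transpose_P_mat [simp]: "transpose P_mat = (P_mat :: 'a::comm_ring_1^3^3)"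
  by (simp add: matrix_3_simps)

text \<open>The bilinear form of the twisting condition contains no inverse, is stable under
  products (\<open>twist_mult\<close>) and passes to limits.\<close>

lemma sigma_eq_iff:
  assumes "invertible A"
  shows "sigma A = B \<longleftrightarrow> B ** T_mat ** transpose A = T_mat"
proof -
  have T: "invertible T_mat" and A: "invertible (transpose A)"
    using assms det_T_mat by (simp_all add: invertible_det_nz det_transpose)
  have "sigma A ** T_mat ** transpose A = T_mat ** matrix_inv (transpose A) ** (matrix_inv T_mat ** T_mat) ** transpose A"
    by (simp only: sigma_def matrix_mul_assoc)
  also have "\<dots> = T_mat ** (matrix_inv (transpose A) ** transpose A)"
    by (simp only: matrix_inv_left[OF T] matrix_mul_rid matrix_mul_assoc)
  also have "\<dots> = T_mat"
    by (simp add: matrix_inv_left[OF A])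
  finally have "sigma A ** T_mat ** transpose A = T_mat" .
  then show ?thesis
    using matrix_mul_right_cancel[OF T] matrix_mul_right_cancel[OF A] by metis
qed

lemma twist_mult:
  fixes A B A' B' Q :: "'a::comm_semiring_1^'n^'n"
  assumes "A' ** Q ** transpose A = Q" "B' ** Q ** transpose B = Q"
  shows "(A' ** B') ** Q ** transpose (A ** B) = Q"
proof -
  have "(A' ** B') ** Q ** transpose (A ** B) = A' ** (B' ** Q ** transpose B) ** transpose A"
    by (simp only: matrix_transpose_mul matrix_mul_assoc)
  with assms show ?thesis by simp
qed

text \<open>The cube of \<open>\<sigma>\<close> is \<open>g \<mapsto> P (g\<^sup>t)\<^sup>-\<^sup>1 P\<close>, because \<open>T (T\<^sup>t)\<^sup>-\<^sup>1 T\<close> is a multiple of \<open>P\<close>.\<close>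

lemma twist_cube:
  assumes "B ** T_mat ** transpose A = T_mat" "C ** T_mat ** transpose B = T_mat"
    and "E ** T_mat ** transpose C = T_mat"
  shows "E ** P_mat ** transpose A = P_mat"
proof -
  \<comment> \<open>\<open>U\<close> is the inverse of \<open>T_mat\<close>; its entries use
    \<open>1/eps = -eps^2\<close>, which follows from \<open>eps^3 = -1\<close>.\<close>
  define U :: "complex^3^3" where "U = vector [vector [0, eps ^ 2, 0], vector [1, 0, 0], vector [0, 0, - eps]]"
  have ep: "eps * eps ^ 2 = - 1" "eps ^ 2 * eps = - 1"
    using eps_cube by (simp_all add: power3_eq_cube power2_eq_square mult.assoc)
  have TU: "T_mat ** U = mat 1"
    by (simp add: U_def matrix_3_simps ep)
  then have UT: "U ** T_mat = mat 1"
    by (simp add: matrix_left_right_inverse)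
  have "T_mat ** transpose U ** T_mat = smat (eps ^ 2) P_mat"
    using eps_cube by (simp add: U_def matrix_3_simps vec_eq_iff forall_3 ep algebra_simps power2_eq_square power3_eq_cube)
  then have P: "P_mat = smat (- eps) (T_mat ** transpose U ** T_mat)"
    by (simp add: smat_smat ep)
  \<comment> \<open>The transposed middle relation expresses the inverse of
    \<open>transpose C\<close> through \<open>B\<close>. This eliminates \<open>C\<close> from the
    third relation, and the first relation then eliminates \<open>B\<close>.\<close>
  have "B ** transpose T_mat ** transpose C = transpose T_mat"
    using arg_cong[OF assms(2), of transpose] by (simp add: matrix_transpose_mul matrix_mul_assoc)
  then have "transpose U ** B ** transpose T_mat ** transpose C = mat 1"
    using UT by (metis TU matrix_mul_assoc matrix_transpose_mul transpose_mat)
  then have C: "transpose C ** (transpose U ** B ** transpose T_mat) = mat 1"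
    by (simp add: matrix_left_right_inverse)
  have "E ** T_mat = E ** T_mat ** (transpose C ** (transpose U ** B ** transpose T_mat))"
    by (simp add: C)
  also have "\<dots> = T_mat ** transpose U ** B ** transpose T_mat"
    by (simp only: matrix_mul_assoc assms(3))
  finally have E: "E ** T_mat = T_mat ** transpose U ** B ** transpose T_mat" .
  have TtUt: "transpose T_mat ** transpose U = mat 1"
    using UT by (metis matrix_transpose_mul transpose_mat)
  have "E ** (T_mat ** transpose U ** T_mat) ** transpose A
      = T_mat ** transpose U ** B ** (transpose T_mat ** transpose U) ** T_mat ** transpose A"
    by (simp only: matrix_mul_assoc E)
  also have "\<dots> = T_mat ** transpose U ** (B ** T_mat ** transpose A)"
    by (simp only: TtUt matrix_mul_rid matrix_mul_assoc)
  also have "\<dots> = T_mat ** transpose U ** T_mat"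
    by (simp only: assms(1))
  finally have "E ** (T_mat ** transpose U ** T_mat) ** transpose A = T_mat ** transpose U ** T_mat" .
  then show ?thesis
    by (simp add: P smat_mult_left smat_mult_right)
qed

lemma Lambda_plus_SLD:
  assumes "f \<in> Lambda_plus_SL" "z \<noteq> 0"
  shows "det (f z) = 1" "invertible (f z)" "cnj (f (cnj z) $ i $ j) = f z $ i $ j"
    and "f (eps * z) ** T_mat ** transpose (f z) = T_mat"
    and "f (- z) ** P_mat ** transpose (f z) = P_mat"
proof -
  show d: "det (f z) = 1" "invertible (f z)" "cnj (f (cnj z) $ i $ j) = f z $ i $ j"
    using assms by (simp_all add: Lambda_plus_SL_def tau_sigma_on_def invertible_det_nz)
  have tw: "f (eps * w) ** T_mat ** transpose (f w) = T_mat" if "w \<noteq> 0" for w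
    using assms that by (subst sigma_eq_iff[symmetric])
      (simp_all add: Lambda_plus_SL_def tau_sigma_on_def invertible_det_nz)
  show "f (eps * z) ** T_mat ** transpose (f z) = T_mat"
    using tw assms by simp
  have "eps * (eps * (eps * z)) = - z"
    using eps_cube by (simp add: power3_eq_cube flip: mult.assoc)
  then show "f (- z) ** P_mat ** transpose (f z) = P_mat"
    using twist_cube[OF tw[of z] tw[of "eps * z"] tw[of "eps * (eps * z)"]] assms by simp
qed

subsection \<open>Holomorphic matrix functions\<close>

lemma matrix_holomorphic_on_mult:
  "matrix_holomorphic_on f S \<Longrightarrow> matrix_holomorphic_on g S \<Longrightarrow> matrix_holomorphic_on (\<lambda>z. f z ** g z) S"
  unfolding matrix_holomorphic_on_def matrix_matrix_mult_def
  by (auto intro!: holomorphic_intros)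

lemma matrix_holomorphic_on_smat:
  "s holomorphic_on S \<Longrightarrow> matrix_holomorphic_on f S \<Longrightarrow> matrix_holomorphic_on (\<lambda>z. smat (s z) (f z)) S"
  unfolding matrix_holomorphic_on_def by (auto intro!: holomorphic_intros)

lemma matrix_holomorphic_on_adj3:
  "matrix_holomorphic_on f S \<Longrightarrow> matrix_holomorphic_on (\<lambda>z. adj3 (f z)) S"
  unfolding matrix_holomorphic_on_def adj3_def minor2_def forall_3 by (auto intro!: holomorphic_intros)

lemma holomorphic_on_det:
  "matrix_holomorphic_on f S \<Longrightarrow> (\<lambda>z. det (f z) :: complex) holomorphic_on S"
  for f :: "complex \<Rightarrow> complex^3^3"
  unfolding matrix_holomorphic_on_def det_3 by (auto intro!: holomorphic_intros)

lemma matrix_holomorphic_on_cong: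
  assumes "\<And>z. z \<in> S \<Longrightarrow> f z = g z"
  shows "matrix_holomorphic_on f S \<longleftrightarrow> matrix_holomorphic_on g S"
  unfolding matrix_holomorphic_on_def using assms by (metis (no_types, lifting) holomorphic_cong)

lemma matrix_holomorphic_on_quotient:
  assumes "matrix_holomorphic_on f S" "matrix_holomorphic_on g S" "\<And>z. z \<in> S \<Longrightarrow> invertible (g z)"
  shows "matrix_holomorphic_on (\<lambda>z. f z ** matrix_inv (g z)) S"
proof -
  have d: "det (g z) \<noteq> 0" if "z \<in> S" for z
    using assms(3)[OF that] by (simp add: invertible_det_nz)
  then have "(\<lambda>z. 1 / det (g z)) holomorphic_on S"
    by (intro holomorphic_intros holomorphic_on_det assms) auto
  then have "matrix_holomorphic_on (\<lambda>z. f z ** smat (1 / det (g z)) (adj3 (g z))) S"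
    by (intro matrix_holomorphic_on_mult matrix_holomorphic_on_smat matrix_holomorphic_on_adj3 assms)
  then show ?thesis
    by (subst matrix_holomorphic_on_cong[where g = "\<lambda>z. f z ** smat (1 / det (g z)) (adj3 (g z))"])
       (simp_all add: matrix_inv_adj3 d)
qed

text \<open>\<open>G\<^sub>2\<^sup>-\<^sup>1 G\<^sub>1 = g\<^sub>2 g\<^sub>1\<^sup>-\<^sup>1\<close> is entire and equals the identity at infinity, so Liouville's theorem applies.\<close>

lemma Birkhoff_unique:
  assumes "0 < r" and G: "G1 \<in> Lambda_plus_SL" "G2 \<in> Lambda_plus_SL"
    and g: "g1 \<in> Lambda_minus_GL r" "g2 \<in> Lambda_minus_GL r"
    and eq: "\<And>z. z \<in> Om r - {0} \<Longrightarrow> G1 z ** g1 z = G2 z ** g2 z"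
    and "z \<noteq> 0"
  shows "G1 z = G2 z"
proof -
  \<comment> \<open>\<open>k f\<close> is the loop \<open>f\<close> in the chart at infinity.
    \<open>E\<close> below lives on the punctured plane, \<open>K\<close> near 0 and near infinity;
    they agree on the overlap and glue to an entire function.\<close>
  define k where "k = (\<lambda>f (w::complex). if w = 0 then mat 1 else f (1 / w) :: complex^3^3)"
  define E where "E = (\<lambda>z. adj3 (G2 z) ** G1 z)"
  define K where "K = (\<lambda>z. g2 z ** matrix_inv (g1 z))"
  define K' where "K' = (\<lambda>w. k g2 w ** matrix_inv (k g1 w))"
  define B where "B = {z :: complex. norm z < r}"
  have [simp]: "open B" "0 \<in> B"
    using \<open>0 < r\<close> by (auto simp: B_def open_Collect_less continuous_intros)
  have inv: "invertible (g1 z)" "invertible (g2 z)" if "z \<in> Om r" for z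
    using g that by (simp_all add: Lambda_minus_GL_def)
  have Om: "1 / w \<in> Om r" if "w \<in> B" "w \<noteq> 0" for w
    using that \<open>0 < r\<close> by (simp add: Om_def B_def norm_divide frac_less2)
  have EK: "E z = K z" if "z \<in> Om r - {0}" for z
  proof -
    have d: "det (G2 z) = 1"
      using that Lambda_plus_SLD(1)[OF G(2)] by simp
    have "E z ** g1 z = adj3 (G2 z) ** (G2 z ** g2 z)"
      using eq[OF that] by (simp add: E_def flip: matrix_mul_assoc)
    also have "\<dots> = g2 z"
      by (simp add: matrix_mul_assoc adj3_left d)
    also have "\<dots> = K z ** g1 z"
      using inv that by (simp add: K_def matrix_inv_left flip: matrix_mul_assoc)
    finally show ?thesis
      using inv that by (simp add: matrix_mul_right_cancel)
  qed
  have holE: "matrix_holomorphic_on E (- {0})"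
    using G by (auto simp: E_def Lambda_plus_SL_def intro!: matrix_holomorphic_on_mult matrix_holomorphic_on_adj3)
  have holK: "matrix_holomorphic_on K B"
    using g inv unfolding K_def B_def
    by (intro matrix_holomorphic_on_quotient) (auto simp: Lambda_minus_GL_def Om_def)
  have invk: "invertible (k f w)" if "w \<in> B" "f \<in> {g1, g2}" for f w
    using that inv[OF Om] by (auto simp: k_def invertible_det_nz)
  have holK': "matrix_holomorphic_on K' B"
    using g invk unfolding K'_def B_def
    by (intro matrix_holomorphic_on_quotient) (auto simp: Lambda_minus_GL_def k_def)
  have "(if z = 0 then K 0 else E z) $ i $ j = mat 1 $ i $ j" for z i j
  \<comment> \<open>This form of Liouville's theorem asks for a limit at infinity instead of a
    bound, which is exactly what the normalization of the minus loops provides.\<close>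
  proof (rule Liouville_weak[of "\<lambda>z. (if z = 0 then K 0 else E z) $ i $ j"])
    let ?e = "\<lambda>z. (if z = 0 then K 0 else E z) $ i $ j"
    have "?e holomorphic_on - {0}"
      using holE unfolding matrix_holomorphic_on_def
      by (subst holomorphic_cong[OF refl, of _ _ "\<lambda>z. E z $ i $ j"]) auto
    moreover have "?e holomorphic_on B"
      using holK EK unfolding matrix_holomorphic_on_def
      by (subst holomorphic_cong[OF refl, of _ _ "\<lambda>z. K z $ i $ j"]) (auto simp: B_def Om_def)
    ultimately have "?e holomorphic_on (- {0} \<union> B)"
      by (intro holomorphic_on_Un) auto
    moreover have "- {0} \<union> B = UNIV" by auto
    ultimately show "?e holomorphic_on UNIV" by simp
    \<comment> \<open>\<open>K'\<close> is the quotient of the minus loops in the chart at infinity;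
      its value at the centre is the identity, and continuity there is the limit wanted.\<close>
    have "isCont (\<lambda>w. K' w $ i $ j) 0"
      using holK' continuous_on_eq_continuous_at[OF \<open>open B\<close>] \<open>0 \<in> B\<close>
      unfolding matrix_holomorphic_on_def by (metis holomorphic_on_imp_continuous_on)
    moreover have "K' 0 = mat 1"
      using matrix_inv_right[of "mat 1 :: complex^3^3"] by (simp add: K'_def k_def invertible_det_nz)
    ultimately have "((\<lambda>w. K' w $ i $ j) \<longlongrightarrow> mat 1 $ i $ j) (at 0)"
      by (simp add: isCont_def)
    moreover have "\<forall>\<^sub>F w in at 0. w \<in> B \<and> w \<noteq> 0"
      by (simp add: eventually_conj eventually_at_in_open' eventually_neq_at_within)
    then have "\<forall>\<^sub>F w in at 0. K' w $ i $ j = (?e \<circ> inverse) w"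
      by eventually_elim (use EK[OF DiffI[OF Om]] in \<open>auto simp: K'_def K_def k_def inverse_eq_divide\<close>)
    ultimately have "((?e \<circ> inverse) \<longlongrightarrow> mat 1 $ i $ j) (at 0)"
      by (rule Lim_transform_eventually)
    then show "(?e \<longlongrightarrow> mat 1 $ i $ j) at_infinity"
      by (simp add: lim_at_infinity_0)
  qed
  from this[of z] have "E z = mat 1"
    using \<open>z \<noteq> 0\<close> by (simp add: vec_eq_iff)
  then have "G2 z ** E z = G2 z" by simp
  moreover have "G2 z ** E z = G1 z"
    using Lambda_plus_SLD(1)[OF G(2) \<open>z \<noteq> 0\<close>] by (simp add: E_def matrix_mul_assoc adj3_right)
  ultimately show ?thesis by simp
qed

subsection \<open>The simple elements as loops\<close>

definition cmat :: "complex^'n^'m \<Rightarrow> complex^'n^'m" where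
  "cmat A = (\<chi> i j. cnj (A $ i $ j))"

lemma cmat_nth [simp]: "cmat A $ i $ j = cnj (A $ i $ j)"
  by (simp add: cmat_def)

lemma cmat_mult: "cmat (A ** B) = cmat A ** cmat B"
  by (simp add: vec_eq_iff matrix_matrix_mult_def)

lemma cmat_transpose: "cmat (transpose A) = transpose (cmat A)"
  by (simp add: vec_eq_iff transpose_def)

lemma cmat_P_mat: "cmat P_mat = P_mat"
  by (simp add: vec_eq_iff forall_3 P_mat_def)

lemma cmat_simple_elt:
  "cmat (simple_elt (of_real a) (of_real b) w) = simple_elt (of_real a) (of_real b) (cnj w)"
  by (simp add: vec_eq_iff forall_3 simple_elt_def simple_res_def mat_def)

lemma matrix_holomorphic_on_simple_elt:
  assumes "s holomorphic_on S" "\<And>z. z \<in> S \<Longrightarrow> s z ^ 3 \<noteq> 1"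
  shows "matrix_holomorphic_on (\<lambda>z. simple_elt a b (s z)) S"
  using assms unfolding matrix_holomorphic_on_def forall_3 simple_elt_def simple_res_def
  by (auto simp: mat_def intro!: holomorphic_intros)

text \<open>\<open>simple_elt\<close> in the chart \<open>v = 1/w\<close>, with numerator and
  denominator multiplied by \<open>v^3\<close>. In this form it is regular at \<open>v = 0\<close>
  with value the identity.\<close>

definition simple_elt_inf :: "complex \<Rightarrow> complex \<Rightarrow> complex \<Rightarrow> complex^3^3" where
  "simple_elt_inf a b v = mat 1 + smat (2 / (1 - v ^ 3)) (vector [
     vector [v ^ 3 * (a * b) / (2 * a * b - 1), v * b ^ 2 / (2 * a * b - 1), v ^ 2 * b / (2 * a * b - 1)],
     vector [v ^ 2 * a ^ 2, v ^ 3 * (a * b), v * a],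
     vector [v * a, v ^ 2 * b, v ^ 3]])"

lemma simple_elt_inf: "v \<noteq> 0 \<Longrightarrow> simple_elt a b (1 / v) = simple_elt_inf a b v"
proof -
  assume v: "v \<noteq> 0"
  have eq: "2 / ((1 / v) ^ 3 - 1) = v ^ 3 * (2 / (1 - v ^ 3))"
  proof -
    have "(1 / v) ^ 3 - 1 = (1 - v ^ 3) / v ^ 3"
      using v by (simp add: power_divide diff_divide_distrib)
    then show ?thesis by simp
  qed
  have "v ^ 3 * simple_res a b (1 / v) $ i $ j = vector [
     vector [v ^ 3 * (a * b) / (2 * a * b - 1), v * b ^ 2 / (2 * a * b - 1), v ^ 2 * b / (2 * a * b - 1)],
     vector [v ^ 2 * a ^ 2, v ^ 3 * (a * b), v * a],
     vector [v * a, v ^ 2 * b, v ^ 3]] $ i $ j" (is "_ = ?N $ i $ j") for i j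
  proof -
    have "\<forall>i j. v ^ 3 * simple_res a b (1 / v) $ i $ j = ?N $ i $ j"
      using v by (simp add: forall_3 simple_res_def power2_eq_square power3_eq_cube)
    then show ?thesis by blast
  qed
  then have N: "smat (v ^ 3) (simple_res a b (1 / v)) = ?N"
    by (simp add: vec_eq_iff)
  show ?thesis
    unfolding simple_elt_def simple_elt_inf_def eq N[symmetric] smat_smat by (simp only: mult.commute)
qed

lemma matrix_holomorphic_on_simple_elt_inf:
  assumes "s holomorphic_on S" "\<And>z. z \<in> S \<Longrightarrow> s z ^ 3 \<noteq> 1"
  shows "matrix_holomorphic_on (\<lambda>z. simple_elt_inf a b (s z)) S"
proof -
  have "1 - s z ^ 3 \<noteq> 0" if "z \<in> S" for z
    using assms(2)[OF that] by auto
  then show ?thesis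
    using assms(1) unfolding matrix_holomorphic_on_def forall_3 simple_elt_inf_def
    by (auto simp: mat_def intro!: holomorphic_intros)
qed

context
  fixes r \<alpha> :: real
  assumes r: "0 < r" "r < \<bar>\<alpha>\<bar>" "\<bar>\<alpha>\<bar> < 1 / r"
begin

text \<open>All six excluded points lie on the circle of radius \<open>\<bar>\<alpha>\<bar>\<close>,
  and \<open>r < \<bar>\<alpha>\<bar> < 1/r\<close> places this circle outside
  \<open>Om r\<close>.\<close>

lemma Om_cube:
  assumes "z \<in> Om r"
  shows "(z / of_real \<alpha>) ^ 3 \<noteq> 1" "(z / of_real \<alpha>) ^ 3 \<noteq> - 1"
proof -
  have "norm z \<noteq> \<bar>\<alpha>\<bar>"
    using assms r by (auto simp: Om_def)
  then have "norm (z / of_real \<alpha>) ^ 3 \<noteq> 1 ^ 3"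
    using r by (subst power_eq_iff_eq_base) (auto simp: norm_divide field_simps)
  then show "(z / of_real \<alpha>) ^ 3 \<noteq> 1" "(z / of_real \<alpha>) ^ 3 \<noteq> - 1"
    by (metis norm_one norm_power power_one, metis norm_minus_cancel norm_one norm_power power_one)
qed

lemma g_simple_Lambda_minus:
  assumes "2 * a * b \<noteq> 1"
  shows "g_simple \<alpha> a b \<in> Lambda_minus_GL r"
proof -
  have \<alpha>: "\<alpha> \<noteq> 0" and g: "g_simple \<alpha> a b = (\<lambda>z. simple_elt (of_real a) (of_real b) (z / of_real \<alpha>))"
    using r g_simple_eq by auto
  note ab = of_real_nondegenerate[OF assms]
  have small: "z \<in> Om r" if "norm z < r" for z
    using that by (simp add: Om_def)
  have large: "1 / w \<in> Om r" if "norm w < r" "w \<noteq> 0" for w :: complex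
    using that r by (simp add: Om_def norm_divide frac_less2)
  have wcube: "(w * of_real \<alpha>) ^ 3 \<noteq> 1" if "norm w < r" for w :: complex
    using Om_cube(1)[OF large[OF that]] by (cases "w = 0") (auto simp: power_divide power_mult_distrib)
  have "matrix_holomorphic_on (g_simple \<alpha> a b) {z. norm z < r}"
    unfolding g using small Om_cube(1) \<alpha>
    by (intro matrix_holomorphic_on_simple_elt holomorphic_intros) auto
  moreover have "(if w = 0 then mat 1 else g_simple \<alpha> a b (1 / w)) =
      simple_elt_inf (of_real a) (of_real b) (w * of_real \<alpha>)" for w
    using simple_elt_inf[of "w * of_real \<alpha>"] \<alpha>
    by (simp add: g simple_elt_inf_def vec_eq_iff forall_3)
  then have "matrix_holomorphic_on (\<lambda>w. if w = 0 then mat 1 else g_simple \<alpha> a b (1 / w)) {w. norm w < r}"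
    using matrix_holomorphic_on_simple_elt_inf[of "\<lambda>w. w * of_real \<alpha>" "{w. norm w < r}"] wcube
    by (simp add: holomorphic_intros)
  moreover have inv: "invertible (g_simple \<alpha> a b z)" if "z \<in> Om r" for z
    unfolding g invertible_det_nz
    using det_simple_elt[OF Om_cube(1)[OF that] ab] Om_cube[OF that] by (simp add: eq_neg_iff_add_eq_0)
  moreover have "tau_sigma_on (Om r) (g_simple \<alpha> a b)"
    unfolding tau_sigma_on_def
  proof (intro ballI conjI allI)
    fix z i j
    assume z: "z \<in> Om r"
    show "sigma (g_simple \<alpha> a b z) = g_simple \<alpha> a b (eps * z)"
      unfolding sigma_eq_iff[OF inv[OF z]]
      using simple_elt_twisted(1)[OF Om_cube[OF z] ab] by (simp add: g)
    show "cnj (g_simple \<alpha> a b (cnj z) $ i $ j) = g_simple \<alpha> a b z $ i $ j"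
      using cmat_simple_elt[of a b "cnj z / of_real \<alpha>"] by (simp add: g vec_eq_iff)
  qed
  ultimately show ?thesis
    by (simp add: Lambda_minus_GL_def)
qed

end

lemma Lambda_minus_cong:
  assumes "f \<in> Lambda_minus_GL r" "0 < r" "\<And>z. z \<in> Om r \<Longrightarrow> f z = g z"
  shows "g \<in> Lambda_minus_GL r"
proof -
  have "matrix_holomorphic_on g {z. norm z < r}"
    by (subst matrix_holomorphic_on_cong[where g = f])
      (use assms in \<open>auto simp: Lambda_minus_GL_def Om_def\<close>)
  moreover have "1 / w \<in> Om r" if "norm w < r" "w \<noteq> 0" for w :: complex
    using that assms by (simp add: Om_def norm_divide frac_less2)
  then have "matrix_holomorphic_on (\<lambda>w. if w = 0 then mat 1 else g (1 / w)) {w. norm w < r}"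
    by (subst matrix_holomorphic_on_cong[where g = "\<lambda>w. if w = 0 then mat 1 else f (1 / w)"])
      (use assms in \<open>auto simp: Lambda_minus_GL_def\<close>)
  moreover have "eps * z \<in> Om r" "cnj z \<in> Om r" if "z \<in> Om r" for z
    using that by (auto simp: Om_def norm_mult)
  ultimately show ?thesis
    using assms by (auto simp: Lambda_minus_GL_def tau_sigma_on_def)
qed

lemma sigma_smat:
  assumes "invertible A" "c \<noteq> 0"
  shows "sigma (smat c A) = smat (1 / c) (sigma A)"
proof -
  have "smat c A ** smat (1 / c) (matrix_inv A) = mat 1"
    "smat (1 / c) (matrix_inv A) ** smat c A = mat 1"
    using assms by (simp_all add: smat_mult_left smat_mult_right smat_smat matrix_inv_right matrix_inv_left)
  then have "invertible (smat c A)"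
    unfolding invertible_def by blast
  moreover have "sigma A ** T_mat ** transpose A = T_mat"
    by (subst sigma_eq_iff[OF assms(1), symmetric]) (rule refl)
  then have "smat (1 / c) (sigma A) ** T_mat ** transpose (smat c A) = T_mat"
    using assms(2) by (simp add: smat_mult_left smat_mult_right transpose_smat smat_smat)
  ultimately show ?thesis
    by (simp add: sigma_eq_iff)
qed

text \<open>\<sigma> inverts scalars (\<open>sigma_smat\<close>), so a scalar factor respects the
  twisting precisely through \<open>s(eps z) = 1/s(z)\<close>; the value 1 at infinity preserves the
  normalization.\<close>

lemma Lambda_minus_smat:
  assumes f: "f \<in> Lambda_minus_GL r"
    and s: "s holomorphic_on {z. norm z < r}"
      "(\<lambda>w. if w = 0 then 1 else s (1 / w)) holomorphic_on {w. norm w < r}"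
      "\<And>z. z \<in> Om r \<Longrightarrow> s z \<noteq> 0" "\<And>z. z \<in> Om r \<Longrightarrow> cnj (s (cnj z)) = s z"
      "\<And>z. z \<in> Om r \<Longrightarrow> s (eps * z) = 1 / s z"
  shows "(\<lambda>z. smat (s z) (f z)) \<in> Lambda_minus_GL r"
proof -
  have "matrix_holomorphic_on (\<lambda>w. smat (if w = 0 then 1 else s (1 / w)) (if w = 0 then mat 1 else f (1 / w)))
      {w. norm w < r}"
    using f s by (intro matrix_holomorphic_on_smat) (auto simp: Lambda_minus_GL_def)
  moreover have "(\<lambda>w. smat (if w = 0 then 1 else s (1 / w)) (if w = 0 then mat 1 else f (1 / w))) =
      (\<lambda>w. if w = 0 then mat 1 else smat (s (1 / w)) (f (1 / w)))"
    by auto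
  moreover have "invertible (smat (s z) (f z))" if "z \<in> Om r" for z
  proof -
    have "invertible (f z)" using f that by (simp add: Lambda_minus_GL_def)
    then have "smat (s z) (f z) ** smat (1 / s z) (matrix_inv (f z)) = mat 1"
      "smat (1 / s z) (matrix_inv (f z)) ** smat (s z) (f z) = mat 1"
      using s(3)[OF that]
      by (simp_all add: smat_mult_left smat_mult_right smat_smat matrix_inv_right matrix_inv_left)
    then show ?thesis unfolding invertible_def by blast
  qed
  moreover have "cnj (s z) = s (cnj z)" if "z \<in> Om r" for z
    using s(4)[OF that] by (metis complex_cnj_cnj)
  ultimately show ?thesis
    using f s by (auto simp: Lambda_minus_GL_def tau_sigma_on_def sigma_smat intro!: matrix_holomorphic_on_smat)
qed

text \<open>The substitution of \<open>eps z\<close> for \<open>z\<close> changes the sign of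
  \<open>z^3\<close> and so exchanges numerator and denominator up to a common sign.\<close>

lemma simple_scalar:
  assumes r: "0 < r" "r < \<bar>\<alpha>\<bar>" "\<bar>\<alpha>\<bar> < 1 / r" and f: "f \<in> Lambda_minus_GL r"
  shows "(\<lambda>z. smat ((z ^ 3 + of_real \<alpha> ^ 3) / (z ^ 3 - of_real \<alpha> ^ 3)) (f z)) \<in> Lambda_minus_GL r"
proof (rule Lambda_minus_smat[OF f])
  define \<beta> where "\<beta> = complex_of_real \<alpha> ^ 3"
  have \<beta>: "\<beta> \<noteq> 0"
    using r by (auto simp: \<beta>_def)
  have nz: "z ^ 3 - \<beta> \<noteq> 0" "z ^ 3 + \<beta> \<noteq> 0" if "z \<in> Om r" for z
    using Om_cube[OF r that] \<beta> by (auto simp: \<beta>_def power_divide add_eq_0_iff2)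
  have large: "1 / w \<in> Om r" if "norm w < r" "w \<noteq> 0" for w :: complex
    using that r by (simp add: Om_def norm_divide frac_less2)
  show "(\<lambda>z. (z ^ 3 + of_real \<alpha> ^ 3) / (z ^ 3 - of_real \<alpha> ^ 3)) holomorphic_on {z. norm z < r}"
    using nz by (intro holomorphic_intros) (auto simp: \<beta>_def Om_def)
  have w: "1 - \<beta> * w ^ 3 \<noteq> 0" if "norm w < r" for w :: complex
    using nz(1)[OF large[OF that]] by (cases "w = 0") (auto simp: field_simps)
  have "(if w = 0 then 1 else ((1 / w) ^ 3 + \<beta>) / ((1 / w) ^ 3 - \<beta>)) = (1 + \<beta> * w ^ 3) / (1 - \<beta> * w ^ 3)"
    if "norm w < r" for w :: complex
  proof (cases "w = 0")
    case False
    then have "(1 / w) ^ 3 + \<beta> = (1 + \<beta> * w ^ 3) / w ^ 3" "(1 / w) ^ 3 - \<beta> = (1 - \<beta> * w ^ 3) / w ^ 3"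
      by (simp_all add: field_simps)
    with False show ?thesis by simp
  qed simp
  moreover have "(\<lambda>w. (1 + \<beta> * w ^ 3) / (1 - \<beta> * w ^ 3)) holomorphic_on {w. norm w < r}"
    using w by (intro holomorphic_intros) auto
  ultimately show "(\<lambda>w. if w = 0 then 1 else ((1 / w) ^ 3 + of_real \<alpha> ^ 3) / ((1 / w) ^ 3 - of_real \<alpha> ^ 3))
      holomorphic_on {w. norm w < r}"
    unfolding \<beta>_def[symmetric] by (subst holomorphic_cong[OF refl]) auto
  fix z assume z: "z \<in> Om r"
  show "(z ^ 3 + of_real \<alpha> ^ 3) / (z ^ 3 - of_real \<alpha> ^ 3) \<noteq> 0"
    using nz[OF z] by (simp add: \<beta>_def)
  show "cnj ((cnj z ^ 3 + of_real \<alpha> ^ 3) / (cnj z ^ 3 - of_real \<alpha> ^ 3)) = (z ^ 3 + of_real \<alpha> ^ 3) / (z ^ 3 - of_real \<alpha> ^ 3)"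
    by simp
  have "- (z ^ 3) - \<beta> = - (z ^ 3 + \<beta>)" "- (z ^ 3) + \<beta> = - (z ^ 3 - \<beta>)" by simp_all
  then show "((eps * z) ^ 3 + of_real \<alpha> ^ 3) / ((eps * z) ^ 3 - of_real \<alpha> ^ 3) =
      1 / ((z ^ 3 + of_real \<alpha> ^ 3) / (z ^ 3 - of_real \<alpha> ^ 3))"
    unfolding eps_mult_cube \<beta>_def[symmetric] by (simp only: minus_divide_divide divide_divide_eq_right mult_1)
qed

lemma h_simple_Lambda_minus:
  assumes r: "0 < r" "r < \<bar>\<alpha>\<bar>" "\<bar>\<alpha>\<bar> < 1 / r" and "2 * a * b \<noteq> 1"
  shows "h_simple \<alpha> a b \<in> Lambda_minus_GL r"
proof (rule Lambda_minus_cong[OF simple_scalar[OF r]])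
  show "g_simple (- \<alpha>) a b \<in> Lambda_minus_GL r"
    using assms by (intro g_simple_Lambda_minus) auto
  fix z assume z: "z \<in> Om r"
  have "\<alpha> \<noteq> 0" using r by auto
  then have "z ^ 3 \<noteq> of_real \<alpha> ^ 3" "z ^ 3 \<noteq> - (of_real \<alpha> ^ 3)"
    using Om_cube[OF r z] by (auto simp: power_divide)
  with h_simple_eq_smat \<open>\<alpha> \<noteq> 0\<close> assms(4)
  show "smat ((z ^ 3 + of_real \<alpha> ^ 3) / (z ^ 3 - of_real \<alpha> ^ 3)) (g_simple (- \<alpha>) a b z) = h_simple \<alpha> a b z"
    by metis
qed (rule r)

section \<open>Dressing by a simple element\<close>

text \<open>The inverse of \<open>simple_elt\<close>, read off from its symmetry under
  \<open>w\<close> to \<open>-w\<close>. In this form it is singular only at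
  \<open>w^3 = -1\<close>, so it can be evaluated at the poles \<open>w^3 = 1\<close> of
  \<open>simple_elt\<close>.\<close>

definition simple_inv :: "complex \<Rightarrow> complex \<Rightarrow> complex \<Rightarrow> complex^3^3" where
  "simple_inv a b w = P_mat ** transpose (simple_elt a b (- w)) ** P_mat"

lemma
  assumes "w ^ 3 \<noteq> 1" "w ^ 3 \<noteq> - 1" "2 * a * b \<noteq> 1"
  shows simple_inv_right: "simple_elt a b w ** simple_inv a b w = mat 1"
    and simple_inv_left: "simple_inv a b w ** simple_elt a b w = mat 1"
proof -
  have "simple_elt a b w ** simple_inv a b w =
      (simple_elt a b w ** P_mat ** transpose (simple_elt a b (- w))) ** P_mat"
    by (simp only: simple_inv_def matrix_mul_assoc)
  then show "simple_elt a b w ** simple_inv a b w = mat 1"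
    by (simp add: simple_elt_twisted[OF assms])
  then show "simple_inv a b w ** simple_elt a b w = mat 1"
    by (simp add: matrix_left_right_inverse)
qed

text \<open>At \<open>w = 1\<close> the residue matrix is the product of the column
  \<open>(b/k, a, 1)^t\<close> and the row \<open>(a, b, 1)\<close>, where \<open>k = 2ab-1\<close>.
  The hypotheses carry this row to \<open>c (a1, b1, 1)\<close>, and \<open>(a1, b1, 1)\<close> is
  annihilated from the right by \<open>simple_inv a1 b1 1\<close>.\<close>

lemma simple_res_cancel:
  assumes "2 * a1 * b1 \<noteq> 1"
    and "a * X $ 1 $ 1 + b * X $ 2 $ 1 + X $ 3 $ 1 = c * a1"
    and "a * X $ 1 $ 2 + b * X $ 2 $ 2 + X $ 3 $ 2 = c * b1"
    and "a * X $ 1 $ 3 + b * X $ 2 $ 3 + X $ 3 $ 3 = c"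
  shows "simple_res a b 1 ** X ** simple_inv a1 b1 1 = 0"
proof -
  define k where "k = 2 * a * b - 1"
  have X: "X $ 3 $ 1 = c * a1 - a * X $ 1 $ 1 - b * X $ 2 $ 1"
    "X $ 3 $ 2 = c * b1 - a * X $ 1 $ 2 - b * X $ 2 $ 2"
    "X $ 3 $ 3 = c - a * X $ 1 $ 3 - b * X $ 2 $ 3"
    using assms(2-4) by (simp_all add: algebra_simps)
  have "simple_res a b 1 ** X = vector [
      vector [b / k * c * a1, b / k * c * b1, b / k * c],
      vector [a * c * a1, a * c * b1, a * c],
      vector [c * a1, c * b1, c]]"
    unfolding simple_res_def k_def[symmetric]
    by (simp add: vec_eq_iff forall_3 matrix_matrix_mult_def sum_3 X power2_eq_square)
      (simp add: diff_divide_distrib add_divide_distrib algebra_simps)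
  moreover define K where "K = 1 / (2 * a1 * b1 - 1)"
  moreover have K: "K * (2 * a1 * b1 - 1) = 1" "\<And>x. x / (2 * a1 * b1 - 1) = x * K"
    using assms(1) by (simp_all add: K_def)
  then have "simple_inv a1 b1 1 = vector [
      vector [1 - a1 * b1, - (b1\<^sup>2 * K), b1],
      vector [a1\<^sup>2, 1 - a1 * b1 * K, - a1],
      vector [- a1, b1 * K, 0]]"
    unfolding simple_inv_def simple_elt_def simple_res_def K(2) P_mat_def
    by (simp add: vec_eq_iff forall_3 matrix_matrix_mult_def sum_3 transpose_def mat_def)
  ultimately have "simple_res a b 1 ** X ** simple_inv a1 b1 1 = (vector [
      vector [b / k * c * a1, b / k * c * b1, b / k * c],
      vector [a * c * a1, a * c * b1, a * c],
      vector [c * a1, c * b1, c]] :: complex^3^3) ** vector [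
      vector [1 - a1 * b1, - (b1\<^sup>2 * K), b1],
      vector [a1\<^sup>2, 1 - a1 * b1 * K, - a1],
      vector [- a1, b1 * K, 0]]"
    by simp
  also have "\<dots> = 0"
  proof -
    have zero: "x * c * a1 * (1 - a1 * b1) + x * c * b1 * a1\<^sup>2 + x * c * - a1 = 0"
      "x * c * a1 * - (b1\<^sup>2 * K) + x * c * b1 * (1 - a1 * b1 * K) + x * c * (b1 * K) = 0"
      "x * c * a1 * b1 + x * c * b1 * - a1 + x * c * 0 = 0" for x
      by algebra (use K(1) in algebra, algebra)
    show ?thesis
      unfolding matrix_mult_3 zero using zero(1)[of 1] zero(2)[of 1] zero(3)[of 1]
      by (simp add: vec_eq_iff forall_3)
  qed
  finally show ?thesis .
qed

section \<open>Removable singularities at the sixth roots and factorization of one loop\<close>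

lemma cube_eq_1_iff: "x ^ 3 = 1 \<longleftrightarrow> x = 1 \<or> x = eps ^ 2 \<or> x = eps ^ 4"
proof -
  have "x ^ 3 - 1 = (x - 1) * (x - eps ^ 2) * (x - eps ^ 4)"
    using eps_sq by algebra
  then show ?thesis
    by (metis eq_iff_diff_eq_0 mult_eq_0_iff)
qed

lemma sixth_roots:
  assumes "x ^ 3 = 1 \<or> x ^ 3 = - 1"
  obtains n where "n < 6" "x = eps ^ n"
proof -
  have "x ^ 3 + 1 = (x - eps) * (x - eps ^ 3) * (x - eps ^ 5)"
    using eps_sq by algebra
  then have "x ^ 3 = - 1 \<Longrightarrow> x = eps ^ 1 \<or> x = eps ^ 3 \<or> x = eps ^ 5"
    by auto
  then have "x = eps ^ 0 \<or> x = eps ^ 1 \<or> x = eps ^ 2 \<or> x = eps ^ 3 \<or> x = eps ^ 4 \<or> x = eps ^ 5"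
    using assms cube_eq_1_iff[of x] by auto
  with that[of 0] that[of 1] that[of 2] that[of 3] that[of 4] that[of 5] show ?thesis
    by (elim disjE) simp_all
qed

lemma bounded_bilinear_matrix_mult: "bounded_bilinear ((**) :: complex^'n^'m \<Rightarrow> complex^'k^'n \<Rightarrow> _)"
  by (intro bilinear_conv_bounded_bilinear[THEN iffD1])
    (auto simp: bilinear_def vec_eq_iff matrix_matrix_mult_def
      scaleR_sum_right distrib_left distrib_right sum.distrib intro!: linearI)

lemma bounded_linear_transpose: "bounded_linear (transpose :: complex^'n^'m \<Rightarrow> _)"
  by (intro linear_conv_bounded_linear[THEN iffD1] linearI) (simp_all add: vec_eq_iff transpose_def)

lemma bounded_linear_cmat: "bounded_linear cmat"
  by (intro linear_conv_bounded_linear[THEN iffD1] linearI) (simp_all add: vec_eq_iff)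

lemmas tendsto_matrix_mult = bounded_bilinear.tendsto[OF bounded_bilinear_matrix_mult]
lemmas tendsto_transpose = bounded_linear.tendsto[OF bounded_linear_transpose]
lemmas tendsto_cmat = bounded_linear.tendsto[OF bounded_linear_cmat]

lemma tendsto_adj3:
  fixes f :: "'b \<Rightarrow> complex^3^3"
  assumes "(f \<longlongrightarrow> A) F"
  shows "((\<lambda>x. adj3 (f x)) \<longlongrightarrow> adj3 A) F"
proof -
  have "((\<lambda>x. minor2 (f x) i j k l) \<longlongrightarrow> minor2 A i j k l) F" for i j k l
    unfolding minor2_def by (intro tendsto_intros assms)
  then have "\<forall>i j. ((\<lambda>x. adj3 (f x) $ i $ j) \<longlongrightarrow> adj3 A $ i $ j) F"
    unfolding forall_3 adj3_def by simp
  then show ?thesis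
    by (intro vec_tendstoI) simp
qed

lemma tendsto_det_3:
  fixes f :: "'b \<Rightarrow> complex^3^3"
  assumes "(f \<longlongrightarrow> A) F"
  shows "((\<lambda>x. det (f x)) \<longlongrightarrow> det A) F"
  unfolding det_3 by (intro tendsto_intros assms)

lemma matrix_holomorphic_on_tendsto:
  assumes "matrix_holomorphic_on f S" "open S" "z \<in> S"
  shows "(f \<longlongrightarrow> f z) (at z)"
proof (rule vec_tendstoI, rule vec_tendstoI)
  fix i j
  have "continuous_on S (\<lambda>z. f z $ i $ j)"
    using assms(1) unfolding matrix_holomorphic_on_def by (metis holomorphic_on_imp_continuous_on)
  then show "((\<lambda>z. f z $ i $ j) \<longlongrightarrow> f z $ i $ j) (at z)"
    using assms(2,3) continuous_on_eq_continuous_at isCont_def by blast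
qed

lemma matrix_holomorphic_on_subset:
  "matrix_holomorphic_on f S \<Longrightarrow> S' \<subseteq> S \<Longrightarrow> matrix_holomorphic_on f S'"
  unfolding matrix_holomorphic_on_def using holomorphic_on_subset by blast

text \<open>Both \<open>f\<close> and \<open>(z/\<beta>)^3 - 1\<close> vanish at \<beta>, so the
  quotient is one of difference quotients; that of the denominator tends to
  \<open>3/\<beta>\<close>, which is not zero.\<close>

lemma removable_simple_zero:
  fixes f :: "complex \<Rightarrow> complex"
  assumes "f holomorphic_on S" "open S" "\<beta> \<in> S" "f \<beta> = 0" "\<beta> \<noteq> 0"
  shows "\<exists>L. ((\<lambda>z. 1 / ((z / \<beta>) ^ 3 - 1) * f z) \<longlongrightarrow> L) (at \<beta>)"
proof -
  obtain D where "(f has_field_derivative D) (at \<beta>)"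
    using holomorphic_on_imp_differentiable_at[OF assms(1-3)] unfolding field_differentiable_def by blast
  then have D: "((\<lambda>z. f z / (z - \<beta>)) \<longlongrightarrow> D) (at \<beta>)"
    using assms(4) by (simp add: has_field_derivative_iff)
  have "((\<lambda>z. (z / \<beta>) ^ 3 - 1) has_field_derivative (3 * (\<beta> / \<beta>) ^ 2 * (1 / \<beta>))) (at \<beta>)"
    by (auto intro!: derivative_eq_intros)
  then have "((\<lambda>z. ((z / \<beta>) ^ 3 - 1) / (z - \<beta>)) \<longlongrightarrow> 3 / \<beta>) (at \<beta>)"
    using assms(5) by (simp add: has_field_derivative_iff)
  from tendsto_divide[OF D this]
  have "((\<lambda>z. (f z / (z - \<beta>)) / (((z / \<beta>) ^ 3 - 1) / (z - \<beta>))) \<longlongrightarrow> D / (3 / \<beta>)) (at \<beta>)"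
    using assms(5) by simp
  moreover have "\<forall>\<^sub>F z in at \<beta>. (f z / (z - \<beta>)) / (((z / \<beta>) ^ 3 - 1) / (z - \<beta>)) = 1 / ((z / \<beta>) ^ 3 - 1) * f z"
    using eventually_neq_at_within[of \<beta>]
  proof eventually_elim
    case (elim z)
    then have "z - \<beta> \<noteq> 0" by simp
    moreover have "x / p / (c / p) = 1 / c * x" if "p \<noteq> 0" for x c p :: complex
      using that by simp
    ultimately show ?case by blast
  qed
  ultimately show ?thesis
    by (intro exI) (rule Lim_transform_eventually)
qed

text \<open>\<open>G\<close> is \<open>g f g1^{-1}\<close> with its singularities filled in. The
  conditions defining \<open>Lambda_plus_SL\<close> hold off six points and survive the limit. The
  determinant is 1 because that of a simple element does not depend on its line.\<close>

lemma simple_factorization: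
  fixes \<alpha> a b a1 b1 :: real
  assumes f: "f \<in> Lambda_plus_SL" and \<alpha>: "\<alpha> \<noteq> 0" and ab: "2 * a * b \<noteq> 1" "2 * a1 * b1 \<noteq> 1"
    and line: "of_real a * f \<alpha> $ 1 $ 1 + of_real b * f \<alpha> $ 2 $ 1 + f \<alpha> $ 3 $ 1 = c * of_real a1"
      "of_real a * f \<alpha> $ 1 $ 2 + of_real b * f \<alpha> $ 2 $ 2 + f \<alpha> $ 3 $ 2 = c * of_real b1"
      "of_real a * f \<alpha> $ 1 $ 3 + of_real b * f \<alpha> $ 2 $ 3 + f \<alpha> $ 3 $ 3 = c"
  obtains G where "G \<in> Lambda_plus_SL"
    "\<And>z. z \<noteq> 0 \<Longrightarrow> z ^ 3 \<noteq> of_real \<alpha> ^ 3 \<Longrightarrow> z ^ 3 \<noteq> - (of_real \<alpha> ^ 3) \<Longrightarrow>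
      g_simple \<alpha> a b z ** f z = G z ** g_simple \<alpha> a1 b1 z"
proof -
  define A B A1 B1 \<beta> where "A = complex_of_real a" and "B = complex_of_real b"
    and "A1 = complex_of_real a1" and "B1 = complex_of_real b1" and "\<beta> = complex_of_real \<alpha>"
  have AB: "2 * A * B \<noteq> 1" "2 * A1 * B1 \<noteq> 1" and \<beta>: "\<beta> \<noteq> 0"
    using ab of_real_nondegenerate \<alpha> by (simp_all add: A_def B_def A1_def B1_def \<beta>_def)
  define M where "M = (\<lambda>z. simple_elt A B (z / \<beta>) ** f z ** simple_inv A1 B1 (z / \<beta>))"
  \<comment> \<open>The first cubic collects the poles of \<open>simple_elt\<close>, the second
    those of \<open>simple_inv\<close>. Together they form one orbit of \<beta> under multiplication
    by \<open>eps\<close>.\<close>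
  define S6 where "S6 = {z. (z / \<beta>) ^ 3 = 1 \<or> (z / \<beta>) ^ 3 = - 1}"
  have S6: "\<exists>n<6. z = \<beta> * eps ^ n" if "z \<in> S6" for z
    using sixth_roots[of "z / \<beta>"] that \<beta> by (auto simp: S6_def field_simps)
  then have "S6 \<subseteq> (\<lambda>n. \<beta> * eps ^ n) ` {..<6}"
    by auto
  then have fin: "finite S6"
    by (rule finite_subset) simp
  have S6_eps: "eps * z \<in> S6 \<longleftrightarrow> z \<in> S6" for z
  proof -
    have "(eps * z / \<beta>) ^ 3 = - ((z / \<beta>) ^ 3)"
      by (simp add: power_divide eps_mult_cube)
    moreover have "- u = 1 \<or> - u = - 1 \<longleftrightarrow> u = 1 \<or> u = - 1" for u :: complex
      by (metis minus_minus)
    ultimately show ?thesis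
      unfolding S6_def mem_Collect_eq by metis
  qed
  have S6_cnj: "cnj z \<in> S6 \<longleftrightarrow> z \<in> S6" for z
  proof -
    have "(cnj z / \<beta>) ^ 3 = cnj ((z / \<beta>) ^ 3)" by (simp add: \<beta>_def)
    moreover have "cnj u = 1 \<or> cnj u = - 1 \<longleftrightarrow> u = 1 \<or> u = - 1" for u
      by (metis complex_cnj_cnj complex_cnj_one complex_cnj_minus)
    ultimately show ?thesis
      unfolding S6_def mem_Collect_eq by metis
  qed
  have ev: "\<forall>\<^sub>F x in at z. x \<notin> S6 \<and> x \<noteq> 0" for z
    using islimpt_finite[of "insert 0 S6" z] fin by (auto simp: islimpt_iff_eventually conj_commute)
  have off: "(z / \<beta>) ^ 3 \<noteq> 1" "(z / \<beta>) ^ 3 \<noteq> - 1" if "z \<notin> S6" for z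
    using that by (auto simp: S6_def)
  have M_g: "simple_elt A B (z / \<beta>) ** f z = M z ** simple_elt A1 B1 (z / \<beta>)" if "z \<notin> S6" for z
    using simple_inv_left[OF off(1,2)[OF that] AB(2)] by (simp add: M_def flip: matrix_mul_assoc)
  have M_det: "det (M z) = 1" if "z \<notin> S6" "z \<noteq> 0" for z
  proof -
    have "det (simple_elt A B (z / \<beta>)) * det (f z) = det (M z) * det (simple_elt A1 B1 (z / \<beta>))"
      using arg_cong[OF M_g[OF that(1)], of det] by (simp add: det_mul)
    moreover have "(z / \<beta>) ^ 3 - 1 \<noteq> 0" "(z / \<beta>) ^ 3 + 1 \<noteq> 0"
      using off[OF that(1)] by (auto simp: eq_neg_iff_add_eq_0)
    ultimately show ?thesis
      using that off[OF that(1)] AB Lambda_plus_SLD(1)[OF f] by (simp add: det_simple_elt)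
  qed
  have M_twist: "M (eps * z) ** T_mat ** transpose (M z) = T_mat" if "z \<notin> S6" "z \<noteq> 0" for z
  proof -
    define w where "w = z / \<beta>"
    note w = off(1,2)[OF that(1), folded w_def]
    have eq: "simple_elt A1 B1 (eps * w) ** T_mat ** transpose (simple_elt A1 B1 w) = T_mat"
      using simple_elt_twisted(1)[OF w AB(2)] .
    have ew: "(eps * w) ^ 3 \<noteq> 1" "(eps * w) ^ 3 \<noteq> - 1"
      using w by (auto simp: eps_mult_cube minus_equation_iff)
    have "simple_inv A1 B1 (eps * w) ** T_mat ** transpose (simple_inv A1 B1 w)
        = simple_inv A1 B1 (eps * w) ** (simple_elt A1 B1 (eps * w) ** T_mat ** transpose (simple_elt A1 B1 w)) **
          transpose (simple_inv A1 B1 w)"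
      by (simp only: eq)
    also have "\<dots> = (simple_inv A1 B1 (eps * w) ** simple_elt A1 B1 (eps * w)) ** T_mat **
        transpose (simple_inv A1 B1 w ** simple_elt A1 B1 w)"
      by (simp only: matrix_transpose_mul matrix_mul_assoc)
    also have "\<dots> = T_mat"
      by (simp add: simple_inv_left ew w AB)
    finally have inv: "simple_inv A1 B1 (eps * w) ** T_mat ** transpose (simple_inv A1 B1 w) = T_mat" .
    show ?thesis
      using twist_mult[OF twist_mult[OF simple_elt_twisted(1)[OF w AB(1)] Lambda_plus_SLD(4)[OF f that(2)]] inv]
      by (simp add: M_def w_def)
  qed
  have M_cmat: "cmat (M (cnj z)) = M z" if "z \<noteq> 0" for z
  proof -
    have "cmat (f (cnj z)) = f z"
      using Lambda_plus_SLD(3)[OF f that] by (simp add: vec_eq_iff)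
    then show ?thesis
      using cmat_simple_elt[of a b "cnj z / \<beta>"] cmat_simple_elt[of a1 b1 "- (cnj z / \<beta>)"]
      by (simp add: M_def simple_inv_def cmat_mult cmat_transpose cmat_P_mat A_def B_def A1_def B1_def \<beta>_def)
  qed
  have holinv: "matrix_holomorphic_on (\<lambda>z. simple_inv A1 B1 (z / \<beta>)) S" if "\<And>z. z \<in> S \<Longrightarrow> (z / \<beta>) ^ 3 \<noteq> - 1" for S
  proof -
    have "(- (z / \<beta>)) ^ 3 \<noteq> 1" if "z \<in> S" for z
      using \<open>\<And>z. z \<in> S \<Longrightarrow> (z / \<beta>) ^ 3 \<noteq> - 1\<close>[OF that] by (metis minus_minus minus_one_power_iff odd_numeral power_minus_odd)
    then have "matrix_holomorphic_on (\<lambda>z. simple_elt A1 B1 (- (z / \<beta>))) S"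
      using \<beta> by (intro matrix_holomorphic_on_simple_elt holomorphic_intros) auto
    then have "matrix_holomorphic_on (\<lambda>z. transpose (simple_elt A1 B1 (- (z / \<beta>)))) S"
      by (simp add: matrix_holomorphic_on_def transpose_def)
    then show ?thesis
      unfolding simple_inv_def
      by (intro matrix_holomorphic_on_mult) (simp_all add: matrix_holomorphic_on_def)
  qed
  have holf: "matrix_holomorphic_on f (- {0})"
    using f by (simp add: Lambda_plus_SL_def)
  have M_hol: "matrix_holomorphic_on M (- {0} - S6)"
    unfolding M_def
  proof (intro matrix_holomorphic_on_mult holinv matrix_holomorphic_on_simple_elt)
    show "matrix_holomorphic_on f (- {0} - S6)"
      by (rule matrix_holomorphic_on_subset[OF holf]) auto
  qed (use \<beta> off in \<open>auto intro!: holomorphic_intros\<close>)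
  have M_lim0: "\<exists>L. (M \<longlongrightarrow> L) (at \<beta>)"
  proof -
    \<comment> \<open>\<open>n\<close> is \<open>((z/\<beta>)^3 - 1) M(z)\<close>. The last factor
      is regular at \<beta>, so \<open>n\<close> is holomorphic there, and \<open>n \<beta>\<close>
      is twice the product that \<open>simple_res_cancel\<close> shows to be zero.\<close>
    define n where "n = (\<lambda>z. (smat ((z / \<beta>) ^ 3 - 1) (mat 1) + smat 2 (simple_res A B (z / \<beta>))) ** f z **
      simple_inv A1 B1 (z / \<beta>))"
    define S where "S = - {0} - {z. (z / \<beta>) ^ 3 = - 1}"
    have "closed {z. (z / \<beta>) ^ 3 = - 1}"
      using \<beta> by (intro closed_Collect_eq continuous_intros) auto
    then have S: "open S" "\<beta> \<in> S"
      using \<beta> by (auto simp: S_def)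
    have holN: "matrix_holomorphic_on (\<lambda>z. smat ((z / \<beta>) ^ 3 - 1) (mat 1) + smat 2 (simple_res A B (z / \<beta>))) S"
      using \<beta> unfolding matrix_holomorphic_on_def forall_3 simple_res_def
      by (auto simp: mat_def intro!: holomorphic_intros)
    have "matrix_holomorphic_on n S"
      unfolding n_def
      by (intro matrix_holomorphic_on_mult holinv holN matrix_holomorphic_on_subset[OF holf])
        (auto simp: S_def)
    moreover have "n \<beta> = smat 2 (simple_res A B 1 ** f \<beta> ** simple_inv A1 B1 1)"
    proof -
      have "smat 0 X = 0" for X :: "complex^3^3" by (simp add: vec_eq_iff)
      then show ?thesis using \<beta> by (simp add: n_def smat_mult_left)
    qed
    then have "n \<beta> = 0"
      using simple_res_cancel[OF AB(2), of A "f \<beta>" B c] line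
      by (simp add: A_def B_def A1_def B1_def \<beta>_def vec_eq_iff)
    ultimately have "\<exists>L. ((\<lambda>z. 1 / ((z / \<beta>) ^ 3 - 1) * n z $ i $ j) \<longlongrightarrow> L) (at \<beta>)" for i j
      using S \<beta> by (intro removable_simple_zero) (auto simp: matrix_holomorphic_on_def)
    note ex = this
    define L where "L = (\<chi> i j. SOME L. ((\<lambda>z. 1 / ((z / \<beta>) ^ 3 - 1) * n z $ i $ j) \<longlongrightarrow> L) (at \<beta>))"
    have lim: "((\<lambda>z. smat (1 / ((z / \<beta>) ^ 3 - 1)) (n z)) \<longlongrightarrow> L) (at \<beta>)"
      unfolding L_def
      by (intro vec_tendstoI) (simp only: smat_nth vec_lambda_beta, rule someI_ex[OF ex])
    have "\<forall>\<^sub>F z in at \<beta>. smat (1 / ((z / \<beta>) ^ 3 - 1)) (n z) = M z"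
      using ev[of \<beta>]
    proof eventually_elim
      case (elim z)
      then have "(z / \<beta>) ^ 3 - 1 \<noteq> 0"
        using off(1) by simp
      then show ?case
        by (simp add: n_def M_def simple_elt_def smat_add smat_smat flip: smat_mult_left)
    qed
    with lim show ?thesis
      by (intro exI) (rule Lim_transform_eventually)
  qed
  have M_lim_eps: "\<exists>L. (M \<longlongrightarrow> L) (at (eps * z))" if "(M \<longlongrightarrow> L) (at z)" for z L
  proof -
    \<comment> \<open>This agrees with \<sigma> on matrices of determinant 1, but it is polynomial
      in \<open>X\<close> and hence continuous without knowing that the limit \<open>L\<close> is
      invertible.\<close>
    let ?s = "\<lambda>X. T_mat ** adj3 (transpose X) ** matrix_inv T_mat"
    have "((\<lambda>z. ?s (M z)) \<longlongrightarrow> ?s L) (at z)"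
      by (intro tendsto_matrix_mult tendsto_adj3 tendsto_transpose tendsto_const that)
    moreover have "\<forall>\<^sub>F z in at z. ?s (M z) = M (eps * z)"
      using ev[of z]
    proof eventually_elim
      case (elim z)
      then have "sigma (M z) = M (eps * z)" and "det (transpose (M z)) = 1"
        using M_twist[of z] M_det[of z] by (auto simp: sigma_eq_iff invertible_det_nz det_transpose)
      then show ?case
        by (simp add: sigma_def matrix_inv_adj3)
    qed
    ultimately have lim: "((\<lambda>z. M (eps * z)) \<longlongrightarrow> ?s L) (at z)"
      by (rule Lim_transform_eventually)
    have "((\<lambda>z. z / eps) \<longlongrightarrow> eps * z / eps) (at (eps * z))"
      by (intro tendsto_intros) simp
    moreover have "\<forall>\<^sub>F x in at (eps * z). x / eps \<noteq> z"
      using eventually_neq_at_within[of "eps * z"] by eventually_elim (auto simp: field_simps)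
    ultimately have "filterlim (\<lambda>z. z / eps) (at z) (at (eps * z))"
      by (intro filterlim_atI) simp_all
    from filterlim_compose[OF lim this] show ?thesis by auto
  qed
  have "\<exists>L. (M \<longlongrightarrow> L) (at (\<beta> * eps ^ n))" for n
  proof (induction n)
    case (Suc n)
    then obtain L where "(M \<longlongrightarrow> L) (at (\<beta> * eps ^ n))" ..
    from M_lim_eps[OF this] show ?case
      by (simp add: mult.left_commute)
  qed (use M_lim0 in simp)
  then have M_lim: "\<exists>L. (M \<longlongrightarrow> L) (at z)" if "z \<in> S6" for z
    using S6[OF that] by blast
  \<comment> \<open>On \<open>S6\<close> the values of \<open>M\<close> itself are meaningless,
    since divisions by zero occur in it; they are replaced by the limits.\<close>
  define G where "G = (\<lambda>z. if z \<in> S6 then Lim (at z) M else M z)"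
  have G_M: "G z = M z" if "z \<notin> S6" for z
    using that by (simp add: G_def)
  have G_lim6: "(G \<longlongrightarrow> G z) (at z)" if "z \<in> S6" for z
  proof -
    have "(M \<longlongrightarrow> G z) (at z)"
      using M_lim[OF that] that tendsto_Lim[of "at z" M] by (auto simp: G_def)
    moreover have "\<forall>\<^sub>F x in at z. M x = G x"
      using ev[of z] by eventually_elim (simp add: G_M)
    ultimately show ?thesis
      by (rule Lim_transform_eventually)
  qed
  have "(\<lambda>z. G z $ i $ j) holomorphic_on - {0}" for i j
  proof (rule no_isolated_singularity'[OF _ _ _ fin])
    show "((\<lambda>z. G z $ i $ j) \<longlongrightarrow> G z $ i $ j) (at z within - {0})" if "z \<in> S6" for z
      by (intro tendsto_vec_nth tendsto_within_subset[OF G_lim6[OF that]] subset_UNIV)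
    show "(\<lambda>z. G z $ i $ j) holomorphic_on - {0} - S6"
      using M_hol unfolding matrix_holomorphic_on_def
      by (subst holomorphic_cong[OF refl, of _ _ "\<lambda>z. M z $ i $ j"]) (auto simp: G_M)
  qed auto
  then have G_hol: "matrix_holomorphic_on G (- {0})"
    by (simp add: matrix_holomorphic_on_def)
  have G_lim: "(G \<longlongrightarrow> G z) (at z)" if "z \<noteq> 0" for z
    using matrix_holomorphic_on_tendsto[OF G_hol] that by auto
  have G_lim': "((\<lambda>z. G (s z)) \<longlongrightarrow> G (s z)) (at z)" if "isCont s z" "s z \<noteq> 0" for s z
    using isCont_tendsto_compose[of "s z" G s "at z"] that G_lim[of "s z"] by (simp add: isCont_def)
  have G_det: "det (G z) = 1" if "z \<noteq> 0" for z
  proof -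
    have "\<forall>\<^sub>F z in at z. 1 = det (G z)"
      using ev[of z] by eventually_elim (simp add: G_M M_det)
    from Lim_transform_eventually[OF tendsto_const this] tendsto_det_3[OF G_lim[OF that]]
    show ?thesis using tendsto_unique trivial_limit_at by metis
  qed
  have G_twist: "G (eps * z) ** T_mat ** transpose (G z) = T_mat" if "z \<noteq> 0" for z
  proof -
    have "\<forall>\<^sub>F z in at z. T_mat = G (eps * z) ** T_mat ** transpose (G z)"
      using ev[of z] by eventually_elim (simp add: G_M S6_eps M_twist)
    from Lim_transform_eventually[OF tendsto_const this]
    have "((\<lambda>z. G (eps * z) ** T_mat ** transpose (G z)) \<longlongrightarrow> T_mat) (at z)" .
    moreover have "((\<lambda>z. G (eps * z)) \<longlongrightarrow> G (eps * z)) (at z)"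
      by (rule G_lim') (use that in auto)
    then have "((\<lambda>z. G (eps * z) ** T_mat ** transpose (G z)) \<longlongrightarrow> G (eps * z) ** T_mat ** transpose (G z)) (at z)"
      by (intro tendsto_matrix_mult tendsto_transpose tendsto_const G_lim[OF that])
    ultimately show ?thesis
      by (intro tendsto_unique[OF trivial_limit_at])
  qed
  have G_cmat: "cmat (G (cnj z)) = G z" if "z \<noteq> 0" for z
  proof -
    have "\<forall>\<^sub>F z in at z. G z = cmat (G (cnj z))"
      using ev[of z] by eventually_elim (simp add: G_M S6_cnj M_cmat)
    from Lim_transform_eventually[OF G_lim[OF that] this]
    have "((\<lambda>z. cmat (G (cnj z))) \<longlongrightarrow> G z) (at z)" .
    moreover have "((\<lambda>z. G (cnj z)) \<longlongrightarrow> G (cnj z)) (at z)"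
      by (rule G_lim') (use that in \<open>auto intro!: continuous_intros\<close>)
    then have "((\<lambda>z. cmat (G (cnj z))) \<longlongrightarrow> cmat (G (cnj z))) (at z)"
      by (rule tendsto_cmat)
    ultimately show ?thesis
      by (intro tendsto_unique[OF trivial_limit_at])
  qed
  show ?thesis
  proof (rule that)
    show "G \<in> Lambda_plus_SL"
    proof -
      have "cnj (G (cnj z) $ i $ j) = G z $ i $ j" if "z \<noteq> 0" for z i j
        by (simp flip: G_cmat[OF that])
      moreover have "sigma (G z) = G (eps * z)" if "z \<noteq> 0" for z
        using G_det[OF that] G_twist[OF that] by (simp add: sigma_eq_iff invertible_det_nz)
      ultimately show ?thesis
        using G_hol G_det by (simp add: Lambda_plus_SL_def tau_sigma_on_def)
    qed
    show "g_simple \<alpha> a b z ** f z = G z ** g_simple \<alpha> a1 b1 z"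
      if "z \<noteq> 0" "z ^ 3 \<noteq> of_real \<alpha> ^ 3" "z ^ 3 \<noteq> - (of_real \<alpha> ^ 3)" for z
    proof -
      have "z \<notin> S6"
        using that \<beta> by (auto simp: S6_def \<beta>_def power_divide field_simps)
      from M_g[OF this] G_M[OF this] show ?thesis
        by (simp add: g_simple_eq \<alpha> A_def B_def A1_def B1_def \<beta>_def)
    qed
  qed
qed

text \<open>The row identity \<open>(a, b, 1) M = c (a1, b1, 1)\<close>: right multiplication by
  \<open>M\<close> takes the line of \<open>(a, b, 1)\<close> to that of
  \<open>(a1, b1, 1)\<close>.\<close>

definition line_relation :: "real \<Rightarrow> real \<Rightarrow> complex^3^3 \<Rightarrow> real \<Rightarrow> real \<Rightarrow> complex \<Rightarrow> bool" where
  "line_relation a b M a1 b1 c \<longleftrightarrow>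
    of_real a * M $ 1 $ 1 + of_real b * M $ 2 $ 1 + M $ 3 $ 1 = c * of_real a1 \<and>
    of_real a * M $ 1 $ 2 + of_real b * M $ 2 $ 2 + M $ 3 $ 2 = c * of_real b1 \<and>
    of_real a * M $ 1 $ 3 + of_real b * M $ 2 $ 3 + M $ 3 $ 3 = c"

section \<open>Dressing of a family of loops\<close>

context
  fixes r \<alpha> a b :: real and D :: "(real \<times> real) set"
    and F :: "real \<times> real \<Rightarrow> complex \<Rightarrow> complex^3^3" and a1 b1 :: "real \<times> real \<Rightarrow> real"
    and c :: "real \<times> real \<Rightarrow> complex"
  assumes r: "0 < r" "r < \<bar>\<alpha>\<bar>" "\<bar>\<alpha>\<bar> < 1 / r"
    and ab: "2 * a * b \<noteq> 1"
    and F: "\<And>p. p \<in> D \<Longrightarrow> F p \<in> Lambda_plus_SL"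
    and ab1: "\<And>p. p \<in> D \<Longrightarrow> 2 * a1 p * b1 p \<noteq> 1"
    and line: "\<And>p. p \<in> D \<Longrightarrow> line_relation a b (F p (of_real \<alpha>)) (a1 p) (b1 p) (c p)"
begin

lemma dressing_g_simple_pointwise:
  assumes "p \<in> D"
  obtains G where "G \<in> Lambda_plus_SL"
    "\<And>z. z \<noteq> 0 \<Longrightarrow> z ^ 3 \<noteq> of_real \<alpha> ^ 3 \<Longrightarrow> z ^ 3 \<noteq> - (of_real \<alpha> ^ 3) \<Longrightarrow>
      g_simple \<alpha> a b z ** F p z = G z ** g_simple \<alpha> (a1 p) (b1 p) z"
proof -
  have "\<alpha> \<noteq> 0" using r by auto
  from simple_factorization[OF F[OF assms] this ab ab1[OF assms]] line[OF assms] that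
  show ?thesis unfolding line_relation_def by metis
qed

lemma Om_cube': "z \<in> Om r \<Longrightarrow> z ^ 3 \<noteq> of_real \<alpha> ^ 3 \<and> z ^ 3 \<noteq> - (of_real \<alpha> ^ 3)"
  using Om_cube[OF r, of z] r by (auto simp: power_divide)

lemma dressing_defined_g_simple: "dressing_defined r D (g_simple \<alpha> a b) F"
proof -
  have "\<exists>G. G \<in> Lambda_plus_SL \<and> (\<exists>gt\<in>Lambda_minus_GL r. \<forall>z\<in>Om r - {0}. g_simple \<alpha> a b z ** F p z = G z ** gt z)"
    if p: "p \<in> D" for p
  proof -
    obtain G where G: "G \<in> Lambda_plus_SL"
      "\<And>z. z \<noteq> 0 \<Longrightarrow> z ^ 3 \<noteq> of_real \<alpha> ^ 3 \<Longrightarrow> z ^ 3 \<noteq> - (of_real \<alpha> ^ 3) \<Longrightarrow>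
        g_simple \<alpha> a b z ** F p z = G z ** g_simple \<alpha> (a1 p) (b1 p) z"
      using dressing_g_simple_pointwise[OF p] by blast
    have "\<forall>z\<in>Om r - {0}. g_simple \<alpha> a b z ** F p z = G z ** g_simple \<alpha> (a1 p) (b1 p) z"
      using G(2) Om_cube' by blast
    with G(1) g_simple_Lambda_minus[OF r ab1[OF p]] show ?thesis by blast
  qed
  then have "\<exists>Ft. \<forall>p\<in>D. Ft p \<in> Lambda_plus_SL \<and>
      (\<exists>gt\<in>Lambda_minus_GL r. \<forall>z\<in>Om r - {0}. g_simple \<alpha> a b z ** F p z = Ft p z ** gt z)"
    by (intro bchoice) blast
  then show ?thesis
    using g_simple_Lambda_minus[OF r ab] unfolding dressing_defined_def dressing_def by blast
qed

text \<open>\<open>dressing\<close> supplies some minus factor and an identity on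
  \<open>Om r\<close> only. By uniqueness \<open>Ft p\<close> is the loop constructed above on the
  whole punctured plane, so the minus factor may be taken to be the simple element and the identity
  holds at every regular parameter.\<close>

lemma dressing_g_simple_factor:
  assumes "dressing r D (g_simple \<alpha> a b) F Ft" "p \<in> D" "z \<noteq> 0"
    "z ^ 3 \<noteq> of_real \<alpha> ^ 3" "z ^ 3 \<noteq> - (of_real \<alpha> ^ 3)"
  shows "g_simple \<alpha> a b z ** F p z = Ft p z ** g_simple \<alpha> (a1 p) (b1 p) z"
proof -
  obtain G where G: "G \<in> Lambda_plus_SL"
    "\<And>z. z \<noteq> 0 \<Longrightarrow> z ^ 3 \<noteq> of_real \<alpha> ^ 3 \<Longrightarrow> z ^ 3 \<noteq> - (of_real \<alpha> ^ 3) \<Longrightarrow>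
      g_simple \<alpha> a b z ** F p z = G z ** g_simple \<alpha> (a1 p) (b1 p) z"
    using dressing_g_simple_pointwise[OF assms(2)] by blast
  have "Ft p \<in> Lambda_plus_SL \<and>
      (\<exists>gt\<in>Lambda_minus_GL r. \<forall>z\<in>Om r - {0}. g_simple \<alpha> a b z ** F p z = Ft p z ** gt z)"
    using assms(1,2) by (simp add: dressing_def)
  then obtain gt where Ft: "Ft p \<in> Lambda_plus_SL" and gt: "gt \<in> Lambda_minus_GL r"
    "\<forall>z\<in>Om r - {0}. g_simple \<alpha> a b z ** F p z = Ft p z ** gt z"
    by (elim conjE bexE) 
  have eq: "Ft p z ** gt z = G z ** g_simple \<alpha> (a1 p) (b1 p) z" if "z \<in> Om r - {0}" for z
    using bspec[OF gt(2) that] G(2)[of z] Om_cube'[of z] that by simp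
  have "Ft p z = G z"
    by (rule Birkhoff_unique[OF r(1) Ft G(1) gt(1) g_simple_Lambda_minus[OF r ab1[OF assms(2)]]])
      (use eq assms(3) in blast)+
  then show ?thesis
    by (simp only: G(2)[OF assms(3-5)])
qed

end

text \<open>Since \<open>h\<^sub>\<alpha> = (\<lambda>\<^sup>3 + \<alpha>\<^sup>3) / (\<lambda>\<^sup>3 - \<alpha>\<^sup>3) g\<^sub>-\<^sub>\<alpha>\<close>, both elements dress a frame in the same way.\<close>

lemma dressing_h_simple_iff:
  assumes r: "0 < r" "r < \<bar>\<alpha>\<bar>" "\<bar>\<alpha>\<bar> < 1 / r" and ab: "2 * a * b \<noteq> 1"
  shows "dressing r D (h_simple \<alpha> a b) F Ft \<longleftrightarrow> dressing r D (g_simple (- \<alpha>) a b) F Ft"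
proof -
  define s where "s = (\<lambda>\<alpha> z. (z ^ 3 + complex_of_real \<alpha> ^ 3) / (z ^ 3 - of_real \<alpha> ^ 3))"
  have r': "0 < r" "r < \<bar>- \<alpha>\<bar>" "\<bar>- \<alpha>\<bar> < 1 / r" using r by auto
  have \<alpha>: "\<alpha> \<noteq> 0" using r by auto
  have hg: "h_simple \<alpha> a b z = smat (s \<alpha> z) (g_simple (- \<alpha>) a b z)"
    and ss: "s (- \<alpha>) z * s \<alpha> z = 1" if "z \<in> Om r" for z
  proof -
    have z: "z ^ 3 \<noteq> of_real \<alpha> ^ 3" "z ^ 3 \<noteq> - (of_real \<alpha> ^ 3)"
      using Om_cube[OF r that] \<alpha> by (auto simp: power_divide)
    then show "h_simple \<alpha> a b z = smat (s \<alpha> z) (g_simple (- \<alpha>) a b z)"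
      unfolding s_def by (intro h_simple_eq_smat \<alpha> ab)
    have "z ^ 3 - of_real \<alpha> ^ 3 \<noteq> 0" "z ^ 3 + of_real \<alpha> ^ 3 \<noteq> 0"
      using z by (auto simp: add_eq_0_iff2)
    then show "s (- \<alpha>) z * s \<alpha> z = 1"
      by (simp add: s_def)
  qed
  have L: "h_simple \<alpha> a b \<in> Lambda_minus_GL r" "g_simple (- \<alpha>) a b \<in> Lambda_minus_GL r"
    using h_simple_Lambda_minus[OF r ab] g_simple_Lambda_minus[OF r' ab] by simp_all
  \<comment> \<open>The scalar commutes with everything and is absorbed into the minus factor
    \<open>gt\<close>, leaving \<open>Ft\<close> unchanged; the two directions use the scalars
    \<open>s \<alpha>\<close> and \<open>s (- \<alpha>)\<close>, inverse to each other.\<close>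
  have "(\<exists>gt\<in>Lambda_minus_GL r. \<forall>z\<in>Om r - {0}. h_simple \<alpha> a b z ** F p z = Ft p z ** gt z) \<longleftrightarrow>
      (\<exists>gt\<in>Lambda_minus_GL r. \<forall>z\<in>Om r - {0}. g_simple (- \<alpha>) a b z ** F p z = Ft p z ** gt z)" for p
  proof (intro iffI; elim bexE)
    fix gt assume gt: "gt \<in> Lambda_minus_GL r" "\<forall>z\<in>Om r - {0}. h_simple \<alpha> a b z ** F p z = Ft p z ** gt z"
    have "g_simple (- \<alpha>) a b z ** F p z = Ft p z ** smat (s (- \<alpha>) z) (gt z)" if "z \<in> Om r - {0}" for z
    proof -
      have e: "h_simple \<alpha> a b z ** F p z = Ft p z ** gt z"
        using gt(2) that by blast
      have "g_simple (- \<alpha>) a b z = smat (s (- \<alpha>) z) (h_simple \<alpha> a b z)"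
        using that by (subst hg) (simp_all add: smat_smat ss)
      then show ?thesis
        by (simp only: smat_mult_left e smat_mult_right)
    qed
    moreover have "(\<lambda>z. smat (s (- \<alpha>) z) (gt z)) \<in> Lambda_minus_GL r"
      using simple_scalar[OF r' gt(1)] unfolding s_def .
    ultimately show "\<exists>gt\<in>Lambda_minus_GL r. \<forall>z\<in>Om r - {0}. g_simple (- \<alpha>) a b z ** F p z = Ft p z ** gt z"
      by (intro bexI[of _ "\<lambda>z. smat (s (- \<alpha>) z) (gt z)"] ballI)
  next
    fix gt assume gt: "gt \<in> Lambda_minus_GL r" "\<forall>z\<in>Om r - {0}. g_simple (- \<alpha>) a b z ** F p z = Ft p z ** gt z"
    have "h_simple \<alpha> a b z ** F p z = Ft p z ** smat (s \<alpha> z) (gt z)" if "z \<in> Om r - {0}" for z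
    proof -
      have e: "g_simple (- \<alpha>) a b z ** F p z = Ft p z ** gt z"
        using gt(2) that by blast
      have "h_simple \<alpha> a b z = smat (s \<alpha> z) (g_simple (- \<alpha>) a b z)"
        using that by (intro hg) simp
      then show ?thesis
        by (simp only: smat_mult_left e smat_mult_right)
    qed
    moreover have "(\<lambda>z. smat (s \<alpha> z) (gt z)) \<in> Lambda_minus_GL r"
      using simple_scalar[OF r gt(1)] unfolding s_def .
    ultimately show "\<exists>gt\<in>Lambda_minus_GL r. \<forall>z\<in>Om r - {0}. h_simple \<alpha> a b z ** F p z = Ft p z ** gt z"
      by (intro bexI[of _ "\<lambda>z. smat (s \<alpha> z) (gt z)"] ballI)
  qed
  with L show ?thesis
    by (simp add: dressing_def)
qed

lemma Lambda_plus_reflect: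
  assumes "f \<in> Lambda_plus_SL"
  shows "(\<lambda>z. f (- z)) \<in> Lambda_plus_SL"
proof -
  have "(\<lambda>z. f (- z) $ i $ j) holomorphic_on - {0}" for i j
  proof -
    have "(\<lambda>z. f z $ i $ j) holomorphic_on - {0}"
      using assms by (simp add: Lambda_plus_SL_def matrix_holomorphic_on_def)
    moreover have "uminus holomorphic_on - {0}"
      by (intro holomorphic_intros)
    ultimately have "((\<lambda>z. f z $ i $ j) \<circ> uminus) holomorphic_on - {0}"
      by (intro holomorphic_on_compose_gen[where t = "- {0}"]) auto
    then show ?thesis by (simp add: o_def)
  qed
  moreover have "cnj (f (- cnj z) $ i $ j) = f (- z) $ i $ j" "sigma (f (- z)) = f (- (eps * z))"
    "det (f (- z)) = 1" if "z \<noteq> 0" for z i j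
    using assms that Lambda_plus_SLD(3)[OF assms, of "- z"]
    by (simp_all add: Lambda_plus_SL_def tau_sigma_on_def)
  ultimately show ?thesis
    by (simp add: Lambda_plus_SL_def tau_sigma_on_def matrix_holomorphic_on_def)
qed

section \<open>The gauge transformation\<close>

definition mU :: "complex \<Rightarrow> complex \<Rightarrow> complex^3^3" where
  "mU q z = vector [vector [q, 0, z], vector [z, - q, 0], vector [0, z, 0]]"

definition mV :: "complex \<Rightarrow> complex \<Rightarrow> complex^3^3" where
  "mV h z = vector [vector [0, 1 / h ^ 2 / z, 0], vector [0, 0, h / z], vector [h / z, 0, 0]]"

text \<open>The derivative of \<open>simple_res\<close> at fixed \<open>w\<close> when
  \<open>(a, b)\<close> moves with velocity \<open>(a', b')\<close>; \<open>k'\<close> is the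
  derivative of \<open>k = 2ab-1\<close>.\<close>

definition d_res :: "complex \<Rightarrow> complex \<Rightarrow> complex \<Rightarrow> complex \<Rightarrow> complex \<Rightarrow> complex^3^3" where
  "d_res a b a' b' w = (let k = 2 * a * b - 1; k' = 2 * (a' * b + a * b') in vector [
     vector [(a' * b + a * b') / k - a * b * k' / k ^ 2, w ^ 2 * (2 * b * b' / k - b ^ 2 * k' / k ^ 2),
       w * (b' / k - b * k' / k ^ 2)],
     vector [w * (2 * a * a'), a' * b + a * b', w ^ 2 * a'],
     vector [w ^ 2 * a', w * b', 0]])"

text \<open>For \<open>g = 1 + (2/(w^3-1)) M\<close> the gauge equation
  \<open>g U - g' = U' g\<close> is the second hypothesis divided by \<open>w^3 - 1\<close>, which
  leaves only polynomial work.\<close>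

lemma gauge_aux:
  fixes M M' U U' :: "complex^3^3"
  assumes "w ^ 3 \<noteq> 1" "\<And>i j. (w ^ 3 - 1) * (U - U') $ i $ j + 2 * (M ** U - M' - U' ** M) $ i $ j = 0"
  shows "(mat 1 + smat (2 / (w ^ 3 - 1)) M) ** U - smat (2 / (w ^ 3 - 1)) M' = U' ** (mat 1 + smat (2 / (w ^ 3 - 1)) M)"
proof -
  define m where "m = w ^ 3 - 1"
  have m: "m \<noteq> 0" using assms(1) by (simp add: m_def)
  have "(U - U') $ i $ j = - (2 / m) * (M ** U - M' - U' ** M) $ i $ j" for i j
  proof -
    have "m * x + 2 * y = 0 \<Longrightarrow> x = - (2 / m) * y" for x y
      using m by (simp add: field_simps eq_neg_iff_add_eq_0)
    then show ?thesis using assms(2)[of i j] by (simp only: m_def)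
  qed
  then have "U - U' = smat (- (2 / m)) (M ** U - M' - U' ** M)"
    by (simp add: vec_eq_iff)
  then have "U = U' + smat (- (2 / m)) (M ** U - M' - U' ** M)"
    by (simp add: algebra_simps)
  moreover have "smat (- (2 / m)) (M ** U - M' - U' ** M) =
      smat (2 / m) M' + smat (2 / m) (U' ** M) - smat (2 / m) (M ** U)"
  proof -
    have "- k * (x - y - z) = k * y + k * z - k * x" for k x y z :: complex
      by algebra
    then show ?thesis
      by (simp only: vec_eq_iff smat_nth vector_minus_component vector_add_component) simp
  qed
  ultimately show ?thesis
    unfolding m_def[symmetric]
    by (simp add: matrix_add_ldistrib matrix_add_rdistrib smat_mult_left smat_mult_right) (simp add: algebra_simps)
qed

text \<open>\<open>\<alpha> w\<close> is the loop parameter and \<open>q\<close> stands for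
  \<open>h_x/h\<close>. The formulas for \<open>a'\<close>, \<open>b'\<close> are the Riccati
  equations in \<open>x\<close>, and \<open>q'\<close> is the logarithmic
  \<open>x\<close>-derivative of \<open>h (2ab-1)\<close>: the added fraction is the one of
  \<open>2ab-1\<close>.\<close>

lemma gauge_x:
  assumes "w ^ 3 \<noteq> 1" "2 * a * b \<noteq> 1"
    and a': "a' = q * a + \<alpha> * b - \<alpha> * a ^ 2" and b': "b' = \<alpha> * (1 - a * b) - q * b"
    and q': "q' = q + 2 * \<alpha> * (b ^ 2 - a * (2 * a * b - 1)) / (2 * a * b - 1)"
  shows "simple_elt a b w ** mU q (\<alpha> * w) - smat (2 / (w ^ 3 - 1)) (d_res a b a' b' w) = mU q' (\<alpha> * w) ** simple_elt a b w"
  unfolding simple_elt_def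
proof (rule gauge_aux[OF assms(1)])
  define K where "K = 1 / (2 * a * b - 1)"
  have K: "K * (2 * a * b - 1) = 1" "\<And>x. x / (2 * a * b - 1) = x * K" "\<And>x. x / (2 * a * b - 1) ^ 2 = x * K ^ 2"
    using assms(2) by (simp_all add: K_def power_divide)
  have "\<forall>i j. (w ^ 3 - 1) * (mU q (\<alpha> * w) - mU q' (\<alpha> * w)) $ i $ j +
      2 * (simple_res a b w ** mU q (\<alpha> * w) - d_res a b a' b' w - mU q' (\<alpha> * w) ** simple_res a b w) $ i $ j = 0" (is "\<forall>i j. ?eq i j")
    unfolding forall_3 mU_def simple_res_def d_res_def Let_def matrix_mult_3 q' K(2,3) a' b'
    apply (simp only: vector_minus_component vector_3)
    apply (intro conjI; (algebra | use K(1) in algebra))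
    done
  then show "\<And>i j. ?eq i j" by blast
qed

text \<open>The counterpart in \<open>y\<close>; here the new function \<open>h (2ab-1)\<close>
  enters directly and not through its derivative.\<close>

lemma gauge_y:
  assumes "w ^ 3 \<noteq> 1" "2 * a * b \<noteq> 1" "w \<noteq> 0" "h \<noteq> 0" "\<alpha> \<noteq> 0"
    and a': "a' = h / \<alpha> * (1 - a * b)" and b': "b' = a / (\<alpha> * h ^ 2) - h * b ^ 2 / \<alpha>"
  shows "simple_elt a b w ** mV h (\<alpha> * w) - smat (2 / (w ^ 3 - 1)) (d_res a b a' b' w) =
    mV (h * (2 * a * b - 1)) (\<alpha> * w) ** simple_elt a b w"
  unfolding simple_elt_def
proof (rule gauge_aux[OF assms(1)])
  define K A H W where "K = 1 / (2 * a * b - 1)" and "A = 1 / \<alpha>" and "H = 1 / h" and "W = 1 / w"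
  have K: "K * (2 * a * b - 1) = 1" "\<And>x. x / (2 * a * b - 1) = x * K" "\<And>x. x / (2 * a * b - 1) ^ 2 = x * K ^ 2"
    and W: "w * W = 1" "h * H = 1"
    using assms(2-4) by (simp_all add: K_def W_def H_def power_divide)
  have V: "mV h (\<alpha> * w) = vector [vector [0, A * H ^ 2 * W, 0], vector [0, 0, A * h * W], vector [A * h * W, 0, 0]]"
    "mV (h * (2 * a * b - 1)) (\<alpha> * w) = vector [vector [0, A * H ^ 2 * K ^ 2 * W, 0],
      vector [0, 0, A * h * (2 * a * b - 1) * W], vector [A * h * (2 * a * b - 1) * W, 0, 0]]"
    by (simp_all add: mV_def A_def H_def W_def K_def matrix_3_eq_iff power_divide power_mult_distrib)
  have a'': "a' = A * (h * (1 - a * b))" and b'': "b' = A * (a * H ^ 2 - h * b ^ 2)"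
    by (simp_all add: a' b' A_def H_def power_divide diff_divide_distrib)
  have "\<forall>i j. (w ^ 3 - 1) * (mV h (\<alpha> * w) - mV (h * (2 * a * b - 1)) (\<alpha> * w)) $ i $ j +
      2 * (simple_res a b w ** mV h (\<alpha> * w) - d_res a b a' b' w - mV (h * (2 * a * b - 1)) (\<alpha> * w) ** simple_res a b w) $ i $ j = 0" (is "\<forall>i j. ?eq i j")
    unfolding forall_3 V simple_res_def d_res_def Let_def matrix_mult_3 K(2,3) a'' b''
    apply (simp only: vector_minus_component vector_3)
    apply (intro conjI; (algebra | use K(1) W in algebra))
    done
  then show "\<And>i j. ?eq i j" by blast
qed

section \<open>Affine frames\<close>

lemma frame_UV: "frame_U h p z = mU (of_real (dx h p / h p)) z" "frame_V h p z = mV (of_real (h p)) z"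
  by (simp_all add: frame_U_def mU_def frame_V_def mV_def matrix_3_eq_iff)

lemma frame_equations_iff:
  assumes "\<And>p. p \<in> D \<Longrightarrow> invertible (G p)"
  shows "frame_equations D h z G \<longleftrightarrow> smooth_on D G \<and>
    (\<forall>p\<in>D. dx G p = G p ** mU (of_real (dx h p / h p)) z \<and> dy G p = G p ** mV (of_real (h p)) z)"
proof -
  have "matrix_inv A ** B = C \<longleftrightarrow> B = A ** C" if "invertible A" for A B C :: "complex^3^3"
  proof
    assume "matrix_inv A ** B = C"
    then have "A ** C = (A ** matrix_inv A) ** B"
      by (simp only: matrix_mul_assoc[symmetric])
    then show "B = A ** C" by (simp add: matrix_inv_right[OF that])
  next
    assume "B = A ** C"
    then have "matrix_inv A ** B = (matrix_inv A ** A) ** C"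
      by (simp only: matrix_mul_assoc)
    then show "matrix_inv A ** B = C" by (simp add: matrix_inv_left[OF that])
  qed
  then show ?thesis
    using assms unfolding frame_equations_def frame_UV by auto
qed

lemma solves_system_cong:
  assumes "open D" "\<And>p. p \<in> D \<Longrightarrow> X p = Y p"
  shows "solves_system D h \<gamma> X \<longleftrightarrow> solves_system D h \<gamma> Y"
proof -
  have 1: "dx X p = dx Y p" "dy X p = dy Y p" if "p \<in> D" for p
    using dx_cong[OF assms(1) that assms(2)] dy_cong[OF assms(1) that assms(2)] by auto
  have 2: "dx (dx X) p = dx (dx Y) p" "dy (dx X) p = dy (dx Y) p" "dy (dy X) p = dy (dy Y) p" if "p \<in> D" for p
    using dx_cong[OF assms(1) that 1(1)] dy_cong[OF assms(1) that 1(1)] dy_cong[OF assms(1) that 1(2)] by auto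
  show ?thesis
    using smooth_on_cong[OF assms] 1 2 assms(2) by (simp add: solves_system_def)
qed

lemma solves_system_linear:
  assumes "open D" "bounded_linear L" "solves_system D h \<gamma> X"
  shows "solves_system D h \<gamma> (\<lambda>p. L (X p))"
proof -
  interpret L: bounded_linear L by fact
  have X: "smooth_on D X" using assms(3) by (simp add: solves_system_def)
  have 1: "dx (\<lambda>p. L (X p)) p = L (dx X p)" "dy (\<lambda>p. L (X p)) p = L (dy X p)" if "p \<in> D" for p
    using dx_linear[OF assms(2)] dy_linear[OF assms(2)] smooth_on_imp_differentiable[OF X that] by auto
  have "dx (dx (\<lambda>p. L (X p))) p = L (dx (dx X) p)" "dy (dx (\<lambda>p. L (X p))) p = L (dy (dx X) p)"
    "dy (dy (\<lambda>p. L (X p))) p = L (dy (dy X) p)" if "p \<in> D" for p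
    using dx_cong[OF assms(1) that 1(1)] dy_cong[OF assms(1) that 1(1)] dy_cong[OF assms(1) that 1(2)]
      dx_linear[OF assms(2) smooth_on_imp_differentiable[OF smooth_on_dx[OF assms(1) X] that]]
      dy_linear[OF assms(2) smooth_on_imp_differentiable[OF smooth_on_dx[OF assms(1) X] that]]
      dy_linear[OF assms(2) smooth_on_imp_differentiable[OF smooth_on_dy[OF assms(1) X] that]] by auto
  with 1 assms(3) smooth_on_bounded_linear[OF assms(1,2) X] show ?thesis
    by (simp add: solves_system_def L.add L.scaleR)
qed

definition re_col :: "3 \<Rightarrow> complex^3^3 \<Rightarrow> real^3" where
  "re_col j M = column j (re_matrix M)"

lemma re_col_nth [simp]: "re_col j M $ i = Re (M $ i $ j)"
  by (simp add: re_col_def column_def re_matrix_def)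

lemma bounded_linear_re_col: "bounded_linear (re_col j)"
  by (intro linear_conv_bounded_linear[THEN iffD1] linearI) (simp_all add: vec_eq_iff)

lemma third_col_eq: "third_col F l p = re_col 3 (F p (of_real l))"
  by (simp add: third_col_def re_col_def)

context
  fixes D :: "(real \<times> real) set" and h :: "real \<times> real \<Rightarrow> real" and l :: real and G :: "real \<times> real \<Rightarrow> complex^3^3"
  assumes D: "open D" and h: "smooth_on D h" "\<And>p. p \<in> D \<Longrightarrow> h p \<noteq> 0" and l: "l \<noteq> 0"
    and G: "frame_equations D h (of_real l) G" "\<And>p. p \<in> D \<Longrightarrow> invertible (G p)"
begin

lemma smooth_on_re_col: "smooth_on D (\<lambda>p. re_col j (G p))"
  using G frame_equations_iff[of D G] by (intro smooth_on_bounded_linear[OF D bounded_linear_re_col]) auto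

lemma
  assumes "p \<in> D"
  shows dx_re_col: "dx (\<lambda>p. re_col 1 (G p)) p = (dx h p / h p) *\<^sub>R re_col 1 (G p) + l *\<^sub>R re_col 2 (G p)" (is ?x1)
      "dx (\<lambda>p. re_col 2 (G p)) p = - (dx h p / h p) *\<^sub>R re_col 2 (G p) + l *\<^sub>R re_col 3 (G p)" (is ?x2)
      "dx (\<lambda>p. re_col 3 (G p)) p = l *\<^sub>R re_col 1 (G p)" (is ?x3)
    and dy_re_col: "dy (\<lambda>p. re_col 1 (G p)) p = (h p / l) *\<^sub>R re_col 3 (G p)" (is ?y1)
      "dy (\<lambda>p. re_col 2 (G p)) p = (1 / (h p ^ 2 * l)) *\<^sub>R re_col 1 (G p)" (is ?y2)
      "dy (\<lambda>p. re_col 3 (G p)) p = (h p / l) *\<^sub>R re_col 2 (G p)" (is ?y3)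
proof -
  have eqs: "dx G p = G p ** mU (of_real (dx h p / h p)) (of_real l)" "dy G p = G p ** mV (of_real (h p)) (of_real l)"
    and sm: "smooth_on D G"
    using G frame_equations_iff[of D G] assms by auto
  have "dx (\<lambda>p. re_col j (G p)) p = re_col j (dx G p)" "dy (\<lambda>p. re_col j (G p)) p = re_col j (dy G p)" for j
    using dx_linear[OF bounded_linear_re_col] dy_linear[OF bounded_linear_re_col]
      smooth_on_imp_differentiable[OF sm assms] by auto
  moreover have "1 / of_real (h p) ^ 2 / of_real l = complex_of_real (1 / (h p ^ 2 * l))"
    "of_real (h p) / of_real l = complex_of_real (h p / l)" by simp_all
  then have V: "mV (of_real (h p)) (of_real l) = vector [vector [0, of_real (1 / (h p ^ 2 * l)), 0],
      vector [0, 0, of_real (h p / l)], vector [of_real (h p / l), 0, 0]]"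
    unfolding mV_def by simp
  \<comment> \<open>Taking real parts commutes with right multiplication by a real matrix, so the
    real columns satisfy the same linear system.\<close>
  have col: "re_col j (A ** vector [vector [of_real m11, of_real m12, of_real m13],
        vector [of_real m21, of_real m22, of_real m23], vector [of_real m31, of_real m32, of_real m33]]) =
      (vector [m11, m12, m13] :: real^3) $ j *\<^sub>R re_col 1 A + (vector [m21, m22, m23] :: real^3) $ j *\<^sub>R re_col 2 A +
      (vector [m31, m32, m33] :: real^3) $ j *\<^sub>R re_col 3 A"
    for A :: "complex^3^3" and m11 m12 m13 m21 m22 m23 m31 m32 m33 :: real and j
    using exhaust_3[of j] by (auto simp: vec_eq_iff matrix_matrix_mult_def sum_3 algebra_simps)
  note calculation
  note U' = col[of _ "G p" "dx h p / h p" 0 l l "- (dx h p / h p)" 0 0 l 0]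
    and V' = col[of _ "G p" 0 "1 / (h p ^ 2 * l)" 0 0 0 "h p / l" "h p / l" 0 0]
  note U'' = U'[unfolded of_real_minus of_real_0, folded mU_def] and V'' = V'[unfolded of_real_0, folded V]
  show ?x1 ?x2 ?x3
    unfolding calculation eqs U'' by simp_all
  show ?y1 ?y2 ?y3
    unfolding calculation eqs V'' by simp_all
qed

text \<open>The first derivatives of the third column are multiples of the other two columns.
  Eliminating these turns the first order system of the frame into the second order system for the
  sphere.\<close>

lemma frame_solves_system: "solves_system D h (l ^ 3) (\<lambda>p. re_col 3 (G p))"
proof -
  have diff: "(\<lambda>p. re_col j (G p)) differentiable (at p)" "h differentiable (at p)" if "p \<in> D" for p j
    using smooth_on_imp_differentiable that smooth_on_re_col h by blast+
  have "dx (dx (\<lambda>p. re_col 3 (G p))) p = (dx h p / h p) *\<^sub>R dx (\<lambda>p. re_col 3 (G p)) p + (l ^ 3 / h p) *\<^sub>R dy (\<lambda>p. re_col 3 (G p)) p"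
    "dy (dx (\<lambda>p. re_col 3 (G p))) p = h p *\<^sub>R re_col 3 (G p)"
    "dy (dy (\<lambda>p. re_col 3 (G p))) p = (1 / (l ^ 3 * h p)) *\<^sub>R dx (\<lambda>p. re_col 3 (G p)) p + (dy h p / h p) *\<^sub>R dy (\<lambda>p. re_col 3 (G p)) p"
    if p: "p \<in> D" for p
  proof -
    have "dx (dx (\<lambda>p. re_col 3 (G p))) p = l *\<^sub>R dx (\<lambda>p. re_col 1 (G p)) p"
      using dx_cong[OF D p dx_re_col(3)] dx_linear[OF bounded_linear_scaleR_right diff(1)[OF p]] by simp
    then show "dx (dx (\<lambda>p. re_col 3 (G p))) p = (dx h p / h p) *\<^sub>R dx (\<lambda>p. re_col 3 (G p)) p + (l ^ 3 / h p) *\<^sub>R dy (\<lambda>p. re_col 3 (G p)) p"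
      using l h(2)[OF p] unfolding dx_re_col[OF p] dy_re_col[OF p]
      by (simp add: scaleR_add_right power3_eq_cube mult.commute)
    have "dy (dx (\<lambda>p. re_col 3 (G p))) p = l *\<^sub>R dy (\<lambda>p. re_col 1 (G p)) p"
      using dy_cong[OF D p dx_re_col(3)] dy_linear[OF bounded_linear_scaleR_right diff(1)[OF p]] by simp
    then show "dy (dx (\<lambda>p. re_col 3 (G p))) p = h p *\<^sub>R re_col 3 (G p)"
      using l unfolding dy_re_col[OF p] by simp
    have hl: "(\<lambda>p. h p / l) differentiable (at p)"
      using diff(2)[OF p] l by simp
    have "dy (\<lambda>p. h p / l) p = dy h p / l"
      using dy_linear[OF bounded_linear_divide diff(2)[OF p]] .
    then have "dy (dy (\<lambda>p. re_col 3 (G p))) p = (h p / l) *\<^sub>R dy (\<lambda>p. re_col 2 (G p)) p + (dy h p / l) *\<^sub>R re_col 2 (G p)"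
      using dy_cong[OF D p dy_re_col(3)] dy_bilinear[OF bounded_bilinear_scaleR hl diff(1)[OF p]] by simp
    then show "dy (dy (\<lambda>p. re_col 3 (G p))) p = (1 / (l ^ 3 * h p)) *\<^sub>R dx (\<lambda>p. re_col 3 (G p)) p + (dy h p / h p) *\<^sub>R dy (\<lambda>p. re_col 3 (G p)) p"
      using l h(2)[OF p] unfolding dx_re_col[OF p] dy_re_col[OF p]
      by (simp add: power2_eq_square power3_eq_cube field_simps)
  qed
  with smooth_on_re_col show ?thesis
    by (simp add: solves_system_def)
qed

end

lemma affine_frameD:
  assumes "affine_frame D h F" "z \<noteq> 0"
  shows "frame_equations D h z (\<lambda>p. F p z)" "p \<in> D \<Longrightarrow> F p \<in> Lambda_plus_SL" "p \<in> D \<Longrightarrow> invertible (F p z)"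
  using assms Lambda_plus_SLD(2)[of "F p"] by (auto simp: affine_frame_def)

lemma Lambda_plus_real:
  assumes "f \<in> Lambda_plus_SL" "l \<noteq> 0"
  shows "f (of_real l) $ i $ j = of_real (Re (f (of_real l) $ i $ j))"
  using Lambda_plus_SLD(3)[OF assms(1), of "of_real l" i j] assms(2)
  by (metis Reals_cnj_iff complex_cnj_complex_of_real of_real_Re of_real_eq_0_iff)

text \<open>The twisting condition at \<open>-\<lambda>\<close> identifies the third column at \<open>-\<lambda>\<close> with a column of cofactors.\<close>

lemma third_col_minus:
  assumes f: "f \<in> Lambda_plus_SL" and l: "l \<noteq> 0"
  shows "re_col 3 (f (- of_real l)) = P_mat *v cross3 (re_col 1 (f (of_real l))) (re_col 2 (f (of_real l)))"
proof -
  define A B where "A = f (of_real l)" and "B = f (- of_real l)"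
  have BA: "B ** P_mat ** transpose A = P_mat" and d: "det A = 1"
    using Lambda_plus_SLD(1,5)[OF f, of "of_real l"] l by (simp_all add: A_def B_def)
  have At: "transpose A ** transpose (adj3 A) = mat 1"
    using adj3_left[of A] d by (metis matrix_transpose_mul smat_1 transpose_mat)
  have "B = B ** P_mat ** (transpose A ** transpose (adj3 A)) ** P_mat"
    by (simp add: At flip: matrix_mul_assoc)
  also have "\<dots> = P_mat ** transpose (adj3 A) ** P_mat"
    by (simp only: matrix_mul_assoc BA)
  finally have B: "B = P_mat ** transpose (adj3 A) ** P_mat" .
  have "A $ i $ j = of_real (Re (A $ i $ j))" for i j
    unfolding A_def by (rule Lambda_plus_real[OF f l])
  then have "Im (A $ i $ j) = 0" for i j
    by (metis Im_complex_of_real)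
  then show ?thesis
    unfolding A_def[symmetric] B_def[symmetric]
    by (simp add: vec_eq_iff forall_3 B matrix_matrix_mult_def matrix_vector_mult_def sum_3 P_mat_def
        transpose_def adj3_def minor2_def cross3_simps)
qed

section \<open>The Tzitzeica transformation\<close>

lemma bounded_linear_smat: "bounded_linear (smat c :: complex^'n^'m \<Rightarrow> _)"
  by (intro linear_conv_bounded_linear[THEN iffD1] linearI) (simp_all add: vec_eq_iff distrib_left)

lemma simple_elt_smooth:
  fixes A B :: "'a::real_normed_vector \<Rightarrow> real"
  assumes D: "open D" and s: "smooth_on D A" "smooth_on D B" and nz: "\<And>p. p \<in> D \<Longrightarrow> 2 * A p * B p \<noteq> 1"
  shows "smooth_on D (\<lambda>p. simple_elt (of_real (A p)) (of_real (B p)) w)"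
proof -
  define a b where "a = (\<lambda>p. complex_of_real (A p))" and "b = (\<lambda>p. complex_of_real (B p))"
  have ab: "smooth_on D a" "smooth_on D b"
    unfolding a_def b_def by (intro smooth_on_of_real[OF D] s)+
  have k: "2 * a p * b p - 1 \<noteq> 0" if "p \<in> D" for p
    using of_real_nondegenerate[OF nz[OF that]] by (simp add: a_def b_def)
  have "\<forall>i j. smooth_on D (\<lambda>p. simple_res (a p) (b p) w $ i $ j)"
    unfolding forall_3 simple_res_def vector_3
    by (intro conjI smooth_on_const[OF D] smooth_on_divide[OF D k] smooth_on_mult[OF D] smooth_on_power[OF D]
        smooth_on_diff[OF D] ab)
  then have "smooth_on D (\<lambda>p. simple_res (a p) (b p) w)"
    by (intro smooth_on_vec[OF D]) blast
  then show ?thesis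
    unfolding simple_elt_def a_def b_def
    by (intro smooth_on_add[OF D] smooth_on_const[OF D] smooth_on_bounded_linear[OF D bounded_linear_smat])
qed

text \<open>The differential is found entry by entry as a linear map of the velocities; both partial
  derivatives are its values at \<open>(1, 0)\<close> and \<open>(0, 1)\<close>.\<close>

lemma
  assumes D: "open D" "p \<in> D" and s: "smooth_on D A" "smooth_on D B" and nz: "\<And>p. p \<in> D \<Longrightarrow> 2 * A p * B p \<noteq> 1"
  shows dx_simple_elt: "dx (\<lambda>p. simple_elt (of_real (A p)) (of_real (B p)) w) p =
      smat (2 / (w ^ 3 - 1)) (d_res (of_real (A p)) (of_real (B p)) (of_real (dx A p)) (of_real (dx B p)) w)" (is ?dx)
    and dy_simple_elt: "dy (\<lambda>p. simple_elt (of_real (A p)) (of_real (B p)) w) p =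
      smat (2 / (w ^ 3 - 1)) (d_res (of_real (A p)) (of_real (B p)) (of_real (dy A p)) (of_real (dy B p)) w)" (is ?dy)
proof -
  define A' B' where "A' = frechet_derivative A (at p)" and "B' = frechet_derivative B (at p)"
  have dA: "(A has_derivative A') (at p)" and dB: "(B has_derivative B') (at p)"
    using smooth_on_imp_differentiable[OF s(1) D(2)] smooth_on_imp_differentiable[OF s(2) D(2)]
    by (simp_all add: A'_def B'_def frechet_derivative_works)
  define a b where "a = (\<lambda>p. complex_of_real (A p))" and "b = (\<lambda>p. complex_of_real (B p))"
  define a' b' where "a' = (\<lambda>v. complex_of_real (A' v))" and "b' = (\<lambda>v. complex_of_real (B' v))"
  have da: "(a has_derivative a') (at p)" and db: "(b has_derivative b') (at p)"
    unfolding a_def b_def a'_def b'_def by (intro has_derivative_of_real dA dB)+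
  have k: "2 * a p * b p - 1 \<noteq> 0"
    using of_real_nondegenerate[OF nz[OF D(2)]] by (simp add: a_def b_def)
  have dab: "((\<lambda>q. a q * b q) has_derivative (\<lambda>v. a' v * b p + a p * b' v)) (at p)"
    by (rule has_derivative_eq_rhs[OF has_derivative_mult[OF da db]]) (simp add: fun_eq_iff)
  have dk: "((\<lambda>q. 2 * a q * b q - 1) has_derivative (\<lambda>v. 2 * (a' v * b p + a p * b' v))) (at p)"
    using has_derivative_diff[OF has_derivative_mult_right[OF dab, of 2] has_derivative_const[of 1]]
    by (simp add: mult.assoc)
  have dq: "((\<lambda>q. f q / (2 * a q * b q - 1)) has_derivative
      (\<lambda>v. f' v / (2 * a p * b p - 1) - f p * (2 * (a' v * b p + a p * b' v)) / (2 * a p * b p - 1) ^ 2)) (at p)"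
    if "(f has_derivative f') (at p)" for f f'
    by (rule has_derivative_eq_rhs[OF has_derivative_divide'[OF that dk k]])
      (use k in \<open>simp add: fun_eq_iff diff_divide_distrib power2_eq_square\<close>)
  have sq: "((\<lambda>q. f q ^ 2) has_derivative (\<lambda>v. 2 * f p * f' v)) (at p)" if "(f has_derivative f') (at p)"
    for f f' :: "_ \<Rightarrow> complex"
    unfolding power2_eq_square
    by (rule has_derivative_eq_rhs[OF has_derivative_mult[OF that that]]) (simp add: fun_eq_iff)
  have e: "((\<lambda>q. w ^ n * f q / (2 * a q * b q - 1)) has_derivative (\<lambda>v. w ^ n *
      (f' v / (2 * a p * b p - 1) - f p * (2 * (a' v * b p + a p * b' v)) / (2 * a p * b p - 1) ^ 2))) (at p)"
    if "(f has_derivative f') (at p)" for f f' n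
    using has_derivative_mult_right[OF dq[OF that], of "w ^ n"] by (simp only: times_divide_eq_right)
  have "\<forall>i j. ((\<lambda>q. simple_res (a q) (b q) w $ i $ j) has_derivative
      (\<lambda>v. d_res (a p) (b p) (a' v) (b' v) w $ i $ j)) (at p)"
    unfolding forall_3 simple_res_def d_res_def Let_def vector_3
    by (intro conjI dq[OF dab] e[OF sq[OF db]] e[OF db, of 1, unfolded power_one_right]
        has_derivative_mult_right dab has_derivative_const da db sq)
  then have "((\<lambda>q. simple_res (a q) (b q) w $ i $ j) has_derivative
      (\<lambda>v. d_res (a p) (b p) (a' v) (b' v) w $ i $ j)) (at p)" for i j
    by blast
  note dres = this
  have res: "((\<lambda>q. simple_elt (a q) (b q) w $ i $ j) has_derivative
      (\<lambda>v. 2 / (w ^ 3 - 1) * d_res (a p) (b p) (a' v) (b' v) w $ i $ j)) (at p)" for i j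
    using has_derivative_add[OF has_derivative_const[of "mat 1 $ i $ j"]
        has_derivative_mult_right[OF dres[of i j], of "2 / (w ^ 3 - 1)"]]
    by (simp only: simple_elt_def vector_add_component smat_nth add_0)
  have ab': "dx A p = A' (1, 0)" "dx B p = B' (1, 0)" "dy A p = A' (0, 1)" "dy B p = B' (0, 1)"
    using dx_eqI[OF dA] dx_eqI[OF dB] dy_eqI[OF dA] dy_eqI[OF dB] by auto
  have diff: "(\<lambda>p. simple_elt (a p) (b p) w) differentiable (at p)"
    using smooth_on_imp_differentiable[OF simple_elt_smooth[OF D(1) s nz] D(2)] by (simp add: a_def b_def)
  have lin: "bounded_linear (\<lambda>M :: complex^3^3. M $ i $ j)" for i j
    by (intro bounded_linear_compose[OF bounded_linear_vec_nth bounded_linear_vec_nth])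
  have "dx (\<lambda>q. simple_elt (a q) (b q) w) p $ i $ j = 2 / (w ^ 3 - 1) * d_res (a p) (b p) (a' (1, 0)) (b' (1, 0)) w $ i $ j"
    "dy (\<lambda>q. simple_elt (a q) (b q) w) p $ i $ j = 2 / (w ^ 3 - 1) * d_res (a p) (b p) (a' (0, 1)) (b' (0, 1)) w $ i $ j"
    for i j
    unfolding dx_linear[OF lin diff, symmetric] dy_linear[OF lin diff, symmetric]
    by (rule dx_eqI[OF res], rule dy_eqI[OF res])
  then show ?dx ?dy
    unfolding ab' vec_eq_iff smat_nth by (simp_all add: a_def b_def a'_def b'_def)
qed

text \<open>Entry \<open>j\<close> of the row \<open>(a, b, 1) F(\<alpha>)\<close>; entry 3 is the
  scalar solution \<phi>.\<close>

definition frame_row :: "(real \<times> real \<Rightarrow> complex \<Rightarrow> complex^3^3) \<Rightarrow> real \<Rightarrow> real \<Rightarrow> real \<Rightarrow> 3 \<Rightarrow> real \<times> real \<Rightarrow> real" where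
  "frame_row F \<alpha> a b j p = vector [a, b, 1] \<bullet> re_col j (F p (of_real \<alpha>))"

text \<open>The last two assumptions state in coordinates that the line
  \<open>(a, b, 1) F(\<alpha>)\<close> avoids \<open>Delta0\<close>. Since \<alpha> may have either
  sign, the rank 2 case is the instance at \<open>- \<alpha>\<close>.\<close>

locale simple_dressing =
  fixes D :: "(real \<times> real) set" and h :: "real \<times> real \<Rightarrow> real"
    and F :: "real \<times> real \<Rightarrow> complex \<Rightarrow> complex^3^3" and \<alpha> a b :: real
  assumes D: "open D" and tz: "tzitzeica_solution D h" and F: "affine_frame D h F"
    and \<alpha>: "\<alpha> \<noteq> 0" and ab: "2 * a * b \<noteq> 1"
    and w3: "\<And>p. p \<in> D \<Longrightarrow> frame_row F \<alpha> a b 3 p \<noteq> 0"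
    and w123: "\<And>p. p \<in> D \<Longrightarrow> 2 * frame_row F \<alpha> a b 1 p * frame_row F \<alpha> a b 2 p \<noteq> frame_row F \<alpha> a b 3 p ^ 2"
begin

definition w where "w = frame_row F \<alpha> a b"
definition \<phi> where "\<phi> = scalar_solution a b (third_col F \<alpha>)"
text \<open>The transformed line is spanned by \<open>(a1, b1, 1)\<close>. As \<open>w 3\<close> is
  \<phi>, its derivatives give \<open>a1 = \<phi>_x / (\<alpha> \<phi>)\<close> and
  \<open>b1 = \<alpha> \<phi>_y / (h \<phi>)\<close>; this is how the logarithmic derivatives enter
  the transform.\<close>

definition a1 where "a1 p = w 1 p / w 3 p"
definition b1 where "b1 p = w 2 p / w 3 p"
definition k where "k p = 2 * a1 p * b1 p - 1"
definition hhat where "hhat = tz_h h \<phi>"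

lemma h: "smooth_on D h" "p \<in> D \<Longrightarrow> h p \<noteq> 0"
  using tz by (auto simp: tzitzeica_solution_def)

lemma F\<alpha>: "frame_equations D h (of_real \<alpha>) (\<lambda>p. F p (of_real \<alpha>))" "p \<in> D \<Longrightarrow> invertible (F p (of_real \<alpha>))"
  using affine_frameD[OF F, of "of_real \<alpha>"] \<alpha> by auto

lemma w_alt: "w j = (\<lambda>p. vector [a, b, 1] \<bullet> re_col j (F p (of_real \<alpha>)))"
  by (simp add: w_def frame_row_def fun_eq_iff)

lemma \<phi>_eq: "\<phi> = w 3"
  by (simp add: \<phi>_def scalar_solution_def w_alt fun_eq_iff third_col_eq)

lemma w_smooth: "smooth_on D (w j)"
  unfolding w_alt
  by (intro smooth_on_bounded_linear[OF D bounded_linear_inner_right] smooth_on_re_col[OF D h \<alpha> F\<alpha>])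

lemma w_diff: "p \<in> D \<Longrightarrow> w j differentiable (at p)"
  using smooth_on_imp_differentiable[OF w_smooth] .

lemma
  assumes p: "p \<in> D"
  shows dx_w: "dx (w 1) p = dx h p / h p * w 1 p + \<alpha> * w 2 p" (is ?x1) "dx (w 2) p = - (dx h p / h p) * w 2 p + \<alpha> * w 3 p" (is ?x2)
      "dx (w 3) p = \<alpha> * w 1 p" (is ?x3)
    and dy_w: "dy (w 1) p = h p / \<alpha> * w 3 p" (is ?y1) "dy (w 2) p = 1 / (h p ^ 2 * \<alpha>) * w 1 p" (is ?y2) "dy (w 3) p = h p / \<alpha> * w 2 p" (is ?y3)
proof -
  have "(\<lambda>p. re_col j (F p (of_real \<alpha>))) differentiable (at p)" for j
    using smooth_on_imp_differentiable[OF smooth_on_re_col[OF D h \<alpha> F\<alpha>] p] .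
  from dx_linear[OF bounded_linear_inner_right this] dy_linear[OF bounded_linear_inner_right this]
  have d: "dx (w j) p = vector [a, b, 1] \<bullet> dx (\<lambda>p. re_col j (F p (of_real \<alpha>))) p"
    "dy (w j) p = vector [a, b, 1] \<bullet> dy (\<lambda>p. re_col j (F p (of_real \<alpha>))) p" for j
    by (simp_all only: w_alt)
  let ?c = "\<lambda>j p. re_col j (F p (of_real \<alpha>))"
  have cols: "dx (?c 1) p = (dx h p / h p) *\<^sub>R ?c 1 p + \<alpha> *\<^sub>R ?c 2 p"
      "dx (?c 2) p = - (dx h p / h p) *\<^sub>R ?c 2 p + \<alpha> *\<^sub>R ?c 3 p" "dx (?c 3) p = \<alpha> *\<^sub>R ?c 1 p"
      "dy (?c 1) p = (h p / \<alpha>) *\<^sub>R ?c 3 p" "dy (?c 2) p = (1 / (h p ^ 2 * \<alpha>)) *\<^sub>R ?c 1 p"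
      "dy (?c 3) p = (h p / \<alpha>) *\<^sub>R ?c 2 p"
    by (rule dx_re_col[OF D h(1) _ \<alpha> F\<alpha>(1) _ p] dy_re_col[OF D h(1) _ \<alpha> F\<alpha>(1) _ p];
        (erule h(2) | erule F\<alpha>(2)))+
  show ?x1 ?x2 ?x3 ?y1 ?y2 ?y3
    unfolding d cols by (simp_all only: inner_add_right inner_scaleR_right w_alt)
qed

lemma w3_nz: "p \<in> D \<Longrightarrow> w 3 p \<noteq> 0"
  using w3 by (simp add: w_def)

lemma k_nz: "p \<in> D \<Longrightarrow> k p \<noteq> 0"
  using w3[of p] w123[of p] by (auto simp: k_def a1_def b1_def w_def power2_eq_square field_simps)

lemma ab1: "p \<in> D \<Longrightarrow> 2 * a1 p * b1 p \<noteq> 1"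
  using k_nz by (auto simp: k_def)

lemma a1_smooth: "smooth_on D a1" and b1_smooth: "smooth_on D b1"
proof -
  have "smooth_on D (\<lambda>p. w j p / w 3 p)" for j
    by (intro smooth_on_divide[OF D] w3_nz w_smooth)
  then show "smooth_on D a1" "smooth_on D b1"
    by (simp_all add: a1_def[abs_def] b1_def[abs_def])
qed

lemma ab_diff: "p \<in> D \<Longrightarrow> a1 differentiable (at p)" "p \<in> D \<Longrightarrow> b1 differentiable (at p)"
  using smooth_on_imp_differentiable[OF a1_smooth] smooth_on_imp_differentiable[OF b1_smooth] by auto

text \<open>Ratios of the entries of a solution of a linear system satisfy Riccati equations. These
  are exactly the conditions on \<open>a'\<close>, \<open>b'\<close> in \<open>gauge_x\<close> and
  \<open>gauge_y\<close>.\<close>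

lemma
  assumes p: "p \<in> D"
  shows dx_a1: "dx a1 p = dx h p / h p * a1 p + \<alpha> * b1 p - \<alpha> * a1 p ^ 2" (is ?x1)
    and dx_b1: "dx b1 p = \<alpha> * (1 - a1 p * b1 p) - dx h p / h p * b1 p" (is ?x2)
    and dy_a1: "dy a1 p = h p / \<alpha> * (1 - a1 p * b1 p)" (is ?y1)
    and dy_b1: "dy b1 p = a1 p / (\<alpha> * h p ^ 2) - h p * b1 p ^ 2 / \<alpha>" (is ?y2)
proof -
  note d = dx_divide[OF w_diff[OF p] w_diff[OF p] w3_nz[OF p]] dy_divide[OF w_diff[OF p] w_diff[OF p] w3_nz[OF p]]
  note nz = w3_nz[OF p] h(2)[OF p] \<alpha>
  have "(x * y - u * (\<alpha> * v)) / y ^ 2 = x / y - \<alpha> * (u / y) * (v / y)"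
    "(x * y - u * (h p / \<alpha> * v)) / y ^ 2 = x / y - h p / \<alpha> * (u / y) * (v / y)" if "y \<noteq> 0" for x y u v :: real
    using that \<alpha> by (simp_all add: power2_eq_square field_simps)
  note q = this[OF nz(1)]
  show ?x1 ?x2 ?y1 ?y2
    unfolding a1_def[abs_def] b1_def[abs_def] d dx_w[OF p] dy_w[OF p] q
    using nz by (simp_all add: add_divide_distrib diff_divide_distrib power2_eq_square right_diff_distrib ac_simps)
qed

text \<open>Since \<open>(ln \<phi>)_x = \<alpha> a1\<close>, the mixed derivative is
  \<open>\<alpha>\<close> times the \<open>y\<close>-derivative of \<open>a1\<close>, that is
  \<open>h (1 - a1 b1)\<close>; subtracting twice this from \<open>h\<close> leaves
  \<open>h (2 a1 b1 - 1)\<close>.\<close>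

lemma hhat_eq: "p \<in> D \<Longrightarrow> hhat p = h p * k p"
proof -
  assume p: "p \<in> D"
  have "dx \<phi> q / \<phi> q = \<alpha> * a1 q" if "q \<in> D" for q
    using dx_w(3)[OF that] by (simp add: \<phi>_eq a1_def)
  then have "dy (\<lambda>q. dx \<phi> q / \<phi> q) p = dy (\<lambda>q. \<alpha> * a1 q) p"
    by (rule dy_cong[OF D p])
  also have "\<dots> = \<alpha> * dy a1 p"
    by (rule dy_linear[OF bounded_linear_mult_right ab_diff(1)[OF p]])
  finally show ?thesis
    using \<alpha> by (simp add: hhat_def tz_h_def dy_a1[OF p] k_def algebra_simps)
qed

lemma hhat_nz: "p \<in> D \<Longrightarrow> hhat p \<noteq> 0"
  using hhat_eq k_nz h by simp

lemma hhat_smooth: "smooth_on D hhat"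
proof -
  have "smooth_on D (\<lambda>p. h p * k p)"
    unfolding k_def by (intro smooth_on_intros[OF D] h a1_smooth b1_smooth)
  then show ?thesis
    using smooth_on_cong[OF D, of hhat "\<lambda>p. h p * k p"] hhat_eq by blast
qed

text \<open>The Riccati system gives \<open>k_x = 2 \<alpha> (b1^2 - a1 k)\<close> and
  \<open>k_y = (2/\<alpha>) (a1^2/h^2 - h b1 k)\<close>. Kept in this form, the formulas contain a
  single second derivative, that of \<open>h\<close>, which the equation for \<open>h\<close> can
  remove.\<close>

lemma
  assumes p: "p \<in> D"
  shows dx_hhat: "dx hhat p = dx h p * k p + h p * (2 * \<alpha> * (b1 p ^ 2 - a1 p * k p))" (is ?x)
    and dy_hhat: "dy hhat p = dy h p * k p + h p * (2 / \<alpha> * (a1 p ^ 2 / h p ^ 2 - h p * b1 p * k p))" (is ?y)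
    and dydx_hhat: "dy (dx hhat) p = dy (dx h) p * k p + dx h p * (2 / \<alpha> * (a1 p ^ 2 / h p ^ 2 - h p * b1 p * k p))
      + dy h p * (2 * \<alpha> * (b1 p ^ 2 - a1 p * k p))
      + h p * (2 * \<alpha> * (2 * b1 p * dy b1 p - (dy a1 p * k p + a1 p * (2 / \<alpha> * (a1 p ^ 2 / h p ^ 2 - h p * b1 p * k p)))))" (is ?yx)
proof -
  have hd: "h differentiable (at q)" "dx h differentiable (at q)" if "q \<in> D" for q
    using smooth_on_imp_differentiable[OF h(1) that] smooth_on_imp_differentiable[OF smooth_on_dx[OF D h(1)] that] by auto
  have abd: "(\<lambda>q. a1 q * b1 q) differentiable (at q)" if "q \<in> D" for q
    using ab_diff[OF that] by (intro differentiable_mult)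
  have k': "k = (\<lambda>q. 2 * (a1 q * b1 q) - 1)"
    by (simp add: k_def fun_eq_iff)
  have kd: "k differentiable (at q)" if "q \<in> D" for q
    unfolding k' by (rule differentiable_diff[OF differentiable_mult[OF differentiable_const abd[OF that]] differentiable_const])
  have dxk: "dx k q = 2 * (a1 q * dx b1 q + dx a1 q * b1 q)"
    and dyk: "dy k q = 2 * (a1 q * dy b1 q + dy a1 q * b1 q)" if "q \<in> D" for q
  proof -
    have c: "(\<lambda>q. 2 * (a1 q * b1 q)) differentiable (at q)"
      by (rule differentiable_mult[OF differentiable_const abd[OF that]])
    show "dx k q = 2 * (a1 q * dx b1 q + dx a1 q * b1 q)" "dy k q = 2 * (a1 q * dy b1 q + dy a1 q * b1 q)"
      unfolding k' dx_diff[OF c differentiable_const] dy_diff[OF c differentiable_const]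
        dx_linear[OF bounded_linear_mult_right abd[OF that]] dy_linear[OF bounded_linear_mult_right abd[OF that]]
        dx_mult[OF ab_diff[OF that]] dy_mult[OF ab_diff[OF that]] by simp_all
  qed
  have dxk': "dx k q = 2 * \<alpha> * (b1 q ^ 2 - a1 q * k q)" if "q \<in> D" for q
    unfolding dxk[OF that] dx_a1[OF that] dx_b1[OF that] k_def by algebra
  have dyk': "dy k q = 2 / \<alpha> * (a1 q ^ 2 / h q ^ 2 - h q * b1 q * k q)" if "q \<in> D" for q
    unfolding dyk[OF that] dy_a1[OF that] dy_b1[OF that] k_def
    using \<alpha> by (simp add: power2_eq_square diff_divide_distrib right_diff_distrib algebra_simps)
  have dxhhat: "dx hhat q = dx h q * k q + h q * (2 * \<alpha> * (b1 q ^ 2 - a1 q * k q))" if "q \<in> D" for q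
    using dx_cong[OF D that hhat_eq] dx_mult[OF hd(1)[OF that] kd[OF that]] by (simp add: dxk'[OF that])
  show ?x
    by (rule dxhhat[OF p])
  show ?y
    using dy_cong[OF D p hhat_eq] dy_mult[OF hd(1)[OF p] kd[OF p]] by (simp add: dyk'[OF p])
  have m: "(\<lambda>q. b1 q * b1 q) differentiable (at p)" "(\<lambda>q. a1 q * k q) differentiable (at p)"
    using ab_diff[OF p] kd[OF p] by (auto intro: differentiable_mult)
  have m2: "(\<lambda>q. b1 q * b1 q - a1 q * k q) differentiable (at p)"
    using m by (rule differentiable_diff)
  have m3: "(\<lambda>q. 2 * \<alpha> * (b1 q * b1 q - a1 q * k q)) differentiable (at p)"
    using m2 by (intro differentiable_mult differentiable_const)
  have m4: "(\<lambda>q. dx h q * k q) differentiable (at p)" "(\<lambda>q. h q * (2 * \<alpha> * (b1 q * b1 q - a1 q * k q))) differentiable (at p)"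
    using hd[OF p] kd[OF p] m3 by (auto intro: differentiable_mult)
  have "dy (dx hhat) p = dy (\<lambda>q. dx h q * k q + h q * (2 * \<alpha> * (b1 q * b1 q - a1 q * k q))) p"
    by (rule dy_cong[OF D p]) (simp add: dxhhat power2_eq_square)
  also have "\<dots> = (dx h p * dy k p + dy (dx h) p * k p) +
      (h p * (2 * \<alpha> * ((b1 p * dy b1 p + dy b1 p * b1 p) - (a1 p * dy k p + dy a1 p * k p))) +
       dy h p * (2 * \<alpha> * (b1 p * b1 p - a1 p * k p)))"
    unfolding dy_add[OF m4] dy_mult[OF hd(2)[OF p] kd[OF p]] dy_mult[OF hd(1)[OF p] m3]
      dy_linear[OF bounded_linear_mult_right m2] dy_diff[OF m] dy_mult[OF ab_diff(2)[OF p] ab_diff(2)[OF p]]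
      dy_mult[OF ab_diff(1)[OF p] kd[OF p]] ..
  finally show ?yx
    unfolding dyk'[OF p] by (simp add: power2_eq_square algebra_simps)
qed

lemma hhat_tzitzeica: "tzitzeica_solution D hhat"
proof -
  have "dy (dx hhat) p * hhat p - dx hhat p * dy hhat p = hhat p ^ 3 - 1" if p: "p \<in> D" for p
  proof -
    \<comment> \<open>With the reciprocals as letters, the equation for \<open>hhat\<close> lies in
      the ideal generated by the equation for \<open>h\<close> and the two relations
      \<open>AH\<close>.\<close>
    define A H where "A = 1 / \<alpha>" and "H = 1 / h p"
    have AH: "A * \<alpha> = 1" "H * h p = 1" using \<alpha> h(2)[OF p] by (simp_all add: A_def H_def)
    have t: "dy (dx h) p * h p - dx h p * dy h p = h p ^ 3 - 1"
      using tz p by (simp add: tzitzeica_solution_def)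
    have e: "\<And>x. x / \<alpha> = x * A" "\<And>x. x / h p ^ 2 = x * H ^ 2" "\<And>x. x / (\<alpha> * h p ^ 2) = x * A * H ^ 2"
      by (simp_all add: A_def H_def power_divide)
    show ?thesis
      unfolding hhat_eq[OF p] dx_hhat[OF p] dy_hhat[OF p] dydx_hhat[OF p] dy_a1[OF p] dy_b1[OF p] e k_def
      using t AH by algebra
  qed
  then show ?thesis
    using hhat_smooth hhat_nz by (simp add: tzitzeica_solution_def)
qed

lemma \<phi>_solves: "solves_system D h (\<alpha> ^ 3) \<phi>"
proof -
  have "solves_system D h (\<alpha> ^ 3) (\<lambda>p. re_col 3 (F p (of_real \<alpha>)))"
    by (rule frame_solves_system[OF D h(1) _ \<alpha> F\<alpha>(1)]; (erule h(2) | erule F\<alpha>(2)))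
  from solves_system_linear[OF D bounded_linear_inner_right this, of "vector [a, b, 1]"]
  show ?thesis by (simp only: \<phi>_eq w_alt)
qed

lemma F_plus: "p \<in> D \<Longrightarrow> F p \<in> Lambda_plus_SL"
  using F by (simp add: affine_frame_def)

lemma line: "p \<in> D \<Longrightarrow> line_relation a b (F p (of_real \<alpha>)) (a1 p) (b1 p) (of_real (\<phi> p))"
proof -
  assume p: "p \<in> D"
  have r: "F p (of_real \<alpha>) $ i $ j = of_real (Re (F p (of_real \<alpha>) $ i $ j))" for i j
    by (rule Lambda_plus_real[OF F_plus[OF p] \<alpha>])
  have "of_real a * F p (of_real \<alpha>) $ 1 $ j + of_real b * F p (of_real \<alpha>) $ 2 $ j + F p (of_real \<alpha>) $ 3 $ j
      = complex_of_real (w j p)" for j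
    by (subst (1 2 3) r) (simp add: w_alt inner_vec_def sum_3)
  moreover have "w 1 p = \<phi> p * a1 p" "w 2 p = \<phi> p * b1 p" "w 3 p = \<phi> p"
    using w3_nz[OF p] by (simp_all add: \<phi>_eq a1_def b1_def)
  ultimately show ?thesis
    by (simp add: line_relation_def)
qed

section \<open>The dressed frame and its differential equations\<close>

abbreviation gt where "gt p z \<equiv> g_simple \<alpha> (a1 p) (b1 p) z"

context
  fixes Ft z
  assumes Ft: "\<And>p. p \<in> D \<Longrightarrow> Ft p \<in> Lambda_plus_SL"
    and fact: "\<And>p. p \<in> D \<Longrightarrow> g_simple \<alpha> a b z ** F p z = Ft p z ** gt p z"
    and z: "z \<noteq> 0" "z ^ 3 \<noteq> of_real \<alpha> ^ 3" "z ^ 3 \<noteq> - (of_real \<alpha> ^ 3)"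
begin

definition u where "u = z / of_real \<alpha>"

lemma u: "u ^ 3 \<noteq> 1" "u ^ 3 \<noteq> - 1" "u \<noteq> 0" "z = of_real \<alpha> * u"
  using z \<alpha> by (auto simp: u_def power_divide divide_eq_eq)

lemma gt_eq: "gt p z = simple_elt (of_real (a1 p)) (of_real (b1 p)) u"
  using g_simple_eq[OF \<alpha>] by (simp add: u_def)

lemma Ft_eq: "p \<in> D \<Longrightarrow> Ft p z = g_simple \<alpha> a b z ** F p z ** simple_inv (of_real (a1 p)) (of_real (b1 p)) u"
  using simple_inv_right[OF u(1,2) of_real_nondegenerate[OF ab1]] fact[of p]
  by (simp add: gt_eq flip: matrix_mul_assoc)

text \<open>Smoothness comes from \<open>Ft_eq\<close>, a product of smooth factors. Differentiating
  \<open>g F = Ft g1\<close> with constant \<open>g\<close> then shows that the connection form of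
  \<open>Ft\<close> is that of \<open>F\<close> gauged by \<open>g1\<close>.\<close>

lemma frame_Ft: "frame_equations D hhat z (\<lambda>p. Ft p z)"
proof -
  have inv: "invertible (Ft p z)" if "p \<in> D" for p
    using Lambda_plus_SLD(2)[OF Ft[OF that] z(1)] .
  have invF: "invertible (F p z)" if "p \<in> D" for p
    using Lambda_plus_SLD(2)[OF F_plus[OF that] z(1)] .
  have F_smooth: "smooth_on D (\<lambda>p. F p z)"
    using affine_frameD(1)[OF F z(1)] by (simp add: frame_equations_def)
  have Feq: "dx (\<lambda>p. F p z) p = F p z ** mU (of_real (dx h p / h p)) z" "dy (\<lambda>p. F p z) p = F p z ** mV (of_real (h p)) z"
    if "p \<in> D" for p
    using affine_frameD(1)[OF F z(1)] frame_equations_iff[of D "\<lambda>p. F p z"] invF that by auto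
  define G where "G = (\<lambda>p. simple_elt (of_real (a1 p)) (of_real (b1 p)) u)"
  have G_smooth: "smooth_on D G"
    unfolding G_def by (rule simple_elt_smooth[OF D a1_smooth b1_smooth ab1])
  have "smooth_on D (\<lambda>p. simple_inv (of_real (a1 p)) (of_real (b1 p)) u)"
    unfolding simple_inv_def
    by (intro smooth_on_bilinear[OF D bounded_bilinear_matrix_mult] smooth_on_const[OF D]
        smooth_on_bounded_linear[OF D bounded_linear_transpose] simple_elt_smooth[OF D a1_smooth b1_smooth ab1])
  then have "smooth_on D (\<lambda>p. g_simple \<alpha> a b z ** F p z ** simple_inv (of_real (a1 p)) (of_real (b1 p)) u)"
    by (intro smooth_on_bilinear[OF D bounded_bilinear_matrix_mult] smooth_on_const[OF D] F_smooth)
  then have Ft_smooth: "smooth_on D (\<lambda>p. Ft p z)"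
    by (subst smooth_on_cong[OF D Ft_eq])
  have "dx (\<lambda>p. Ft p z) p = Ft p z ** mU (of_real (dx hhat p / hhat p)) z \<and>
      dy (\<lambda>p. Ft p z) p = Ft p z ** mV (of_real (hhat p)) z" if p: "p \<in> D" for p
  proof -
    note dF = smooth_on_imp_differentiable[OF F_smooth p] and dFt = smooth_on_imp_differentiable[OF Ft_smooth p]
      and dG = smooth_on_imp_differentiable[OF G_smooth p]
    have invG: "invertible (G p)"
      using simple_inv_left[OF u(1,2) of_real_nondegenerate[OF ab1[OF p]]]
        simple_inv_right[OF u(1,2) of_real_nondegenerate[OF ab1[OF p]]]
      unfolding invertible_def G_def by blast
    have eq: "g_simple \<alpha> a b z ** F q z = Ft q z ** G q" if "q \<in> D" for q
      using fact[OF that] by (simp add: G_def gt_eq)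
    have lin: "bounded_linear (\<lambda>M :: complex^3^3. g_simple \<alpha> a b z ** M)"
      by (rule bounded_bilinear.bounded_linear_right[OF bounded_bilinear_matrix_mult])
    \<comment> \<open>Here \<open>X\<close> and \<open>G'\<close> play the derivatives of
      \<open>Ft\<close> and of the right factor \<open>G\<close>, and \<open>U\<close>,
      \<open>U'\<close> the old and new connection matrices. The first premise is the differentiated
      factorization, the second the gauge relation.\<close>
    have cancel: "X = Ft p z ** U'"
      if "g_simple \<alpha> a b z ** (F p z ** U) = Ft p z ** G' + X ** G p" "G p ** U - G' = U' ** G p" for X U G' U'
    proof -
      have "g_simple \<alpha> a b z ** (F p z ** U) = Ft p z ** (G p ** U)"
        by (simp only: matrix_mul_assoc eq[OF p])
      also have "G p ** U = U' ** G p + G'"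
        using that(2) by (simp add: algebra_simps)
      finally have "X ** G p = (Ft p z ** U') ** G p"
        using that(1) by (simp add: matrix_add_ldistrib matrix_mul_assoc)
      then show ?thesis
        using matrix_mul_right_cancel[OF invG] by blast
    qed
    have kc: "complex_of_real (k p) = 2 * of_real (a1 p) * of_real (b1 p) - 1"
      by (simp add: k_def)
    have nz: "complex_of_real (h p) \<noteq> 0" "of_real \<alpha> \<noteq> (0 :: complex)"
      using h(2)[OF p] \<alpha> by auto
    note nd = of_real_nondegenerate[OF ab1[OF p]]
    have q': "complex_of_real (dx hhat p / hhat p) = of_real (dx h p / h p) + 2 * of_real \<alpha> *
        (of_real (b1 p) ^ 2 - of_real (a1 p) * (2 * of_real (a1 p) * of_real (b1 p) - 1)) / (2 * of_real (a1 p) * of_real (b1 p) - 1)"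
    proof -
      have "dx hhat p / hhat p = dx h p / h p + 2 * \<alpha> * (b1 p ^ 2 - a1 p * k p) / k p"
        unfolding dx_hhat[OF p] hhat_eq[OF p] using h(2)[OF p] k_nz[OF p] by (simp add: add_divide_distrib)
      then show ?thesis by (simp add: k_def)
    qed
    have "dx (\<lambda>q. g_simple \<alpha> a b z ** F q z) p = dx (\<lambda>q. Ft q z ** G q) p"
      using dx_cong[OF D p eq] .
    then have X: "g_simple \<alpha> a b z ** (F p z ** mU (of_real (dx h p / h p)) z) = Ft p z ** dx G p + dx (\<lambda>p. Ft p z) p ** G p"
      unfolding dx_linear[OF lin dF] dx_bilinear[OF bounded_bilinear_matrix_mult dFt dG] Feq(1)[OF p] .
    have "dy (\<lambda>q. g_simple \<alpha> a b z ** F q z) p = dy (\<lambda>q. Ft q z ** G q) p"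
      using dy_cong[OF D p eq] .
    then have Y: "g_simple \<alpha> a b z ** (F p z ** mV (of_real (h p)) z) = Ft p z ** dy G p + dy (\<lambda>p. Ft p z) p ** G p"
      unfolding dy_linear[OF lin dF] dy_bilinear[OF bounded_bilinear_matrix_mult dFt dG] Feq(2)[OF p] .
    have dxG: "dx G p = smat (2 / (u ^ 3 - 1)) (d_res (of_real (a1 p)) (of_real (b1 p)) (of_real (dx a1 p)) (of_real (dx b1 p)) u)"
      and dyG: "dy G p = smat (2 / (u ^ 3 - 1)) (d_res (of_real (a1 p)) (of_real (b1 p)) (of_real (dy a1 p)) (of_real (dy b1 p)) u)"
      unfolding G_def by (rule dx_simple_elt[OF D p a1_smooth b1_smooth ab1], assumption,
          rule dy_simple_elt[OF D p a1_smooth b1_smooth ab1], assumption)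
    have gx: "G p ** mU (of_real (dx h p / h p)) (of_real \<alpha> * u) - dx G p = mU (of_real (dx hhat p / hhat p)) (of_real \<alpha> * u) ** G p"
      unfolding dxG unfolding G_def
      by (rule gauge_x[OF u(1) nd _ _ q']) (simp_all add: dx_a1[OF p] dx_b1[OF p])
    have gy: "G p ** mV (of_real (h p)) (of_real \<alpha> * u) - dy G p = mV (of_real (hhat p)) (of_real \<alpha> * u) ** G p"
      unfolding dyG unfolding G_def hhat_eq[OF p] of_real_mult kc
      by (rule gauge_y[OF u(1) nd u(3) nz]) (simp_all add: dy_a1[OF p] dy_b1[OF p])
    show ?thesis
      by (rule conjI[OF cancel[OF X gx[folded u(4)]] cancel[OF Y gy[folded u(4)]]])
  qed
  with Ft_smooth show ?thesis
    using frame_equations_iff[of D "\<lambda>p. Ft p z"] inv by blast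
qed

end

end

section \<open>The transformed spheres\<close>

definition cx :: "real^'n^'m \<Rightarrow> complex^'n^'m" where
  "cx M = (\<chi> i j. of_real (M $ i $ j))"

lemma cx_nth [simp]: "cx M $ i $ j = of_real (M $ i $ j)"
  by (simp add: cx_def)

lemma complex_vec_nth [simp]: "complex_vec v $ i = of_real (v $ i)"
  by (simp add: complex_vec_def)

lemma cx_mult: "cx (A ** B) = cx A ** cx B"
  by (simp add: vec_eq_iff matrix_matrix_mult_def)

lemma cx_transpose: "cx (transpose A) = transpose (cx A)"
  by (simp add: vec_eq_iff transpose_def)

lemma cx_P_mat: "cx P_mat = P_mat"
  by (simp add: vec_eq_iff forall_3 P_mat_def)

lemma cx_inject: "cx A = cx B \<longleftrightarrow> A = B"
  by (simp add: vec_eq_iff)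

lemma complex_vec_mult: "complex_vec (M *v v) = cx M *v complex_vec v"
  by (simp add: vec_eq_iff matrix_vector_mult_def)

lemma det_cx: "det (cx M) = of_real (det M)" for M :: "real^3^3"
  by (simp add: det_3)

lemma column_mult: "column j (A ** B) = A *v column j B"
  by (simp add: vec_eq_iff column_def matrix_matrix_mult_def matrix_vector_mult_def)

lemma re_matrix_cx: "(\<And>i j. Im (A $ i $ j) = 0) \<Longrightarrow> cx (re_matrix A) = A"
  by (simp add: vec_eq_iff re_matrix_def complex_eq_iff)

text \<open>Transposing and conjugating by \<open>P\<close> turns column 3 into row 3 of the simple
  element at \<open>-u\<close>, with its first two entries exchanged. Only this column matters for
  the third column of the dressed frame.\<close>

lemma simple_inv_col3:
  assumes "u ^ 3 \<noteq> - 1"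
  shows "simple_inv a b u $ 1 $ 3 = 2 / (u ^ 3 + 1) * (u * b)"
    and "simple_inv a b u $ 2 $ 3 = - (2 / (u ^ 3 + 1) * (u ^ 2 * a))"
    and "simple_inv a b u $ 3 $ 3 = (u ^ 3 - 1) / (u ^ 3 + 1)"
proof -
  have nz: "u ^ 3 + 1 \<noteq> 0"
    using assms by (simp add: eq_neg_iff_add_eq_0)
  have c: "2 / ((- u) ^ 3 - 1) = - (2 / (u ^ 3 + 1))"
    using minus_divide_divide[of "- 2" "u ^ 3 + 1"] by simp
  have s: "simple_inv a b u $ i $ 3 = simple_elt a b (- u) $ 3 $ (if i = 1 then 2 else if i = 2 then 1 else 3)" for i
    using exhaust_3[of i]
    by (auto simp: simple_inv_def P_mat_def matrix_matrix_mult_def sum_3 transpose_def)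
  show "simple_inv a b u $ 1 $ 3 = 2 / (u ^ 3 + 1) * (u * b)"
    "simple_inv a b u $ 2 $ 3 = - (2 / (u ^ 3 + 1) * (u ^ 2 * a))"
    unfolding s simple_elt_def simple_res_def vector_add_component smat_nth c by (simp_all add: mat_def)
  have "1 - 2 / (u ^ 3 + 1) = (u ^ 3 - 1) / (u ^ 3 + 1)"
    using nz by (simp add: field_simps)
  then show "simple_inv a b u $ 3 $ 3 = (u ^ 3 - 1) / (u ^ 3 + 1)"
    unfolding s simple_elt_def simple_res_def vector_add_component smat_nth c by (simp add: mat_def)
qed

text \<open>One coordinate of the comparison between the two descriptions of the new sphere.
  \<open>R1\<close>, \<open>R2\<close>, \<open>R3\<close> are the entries of the columns of
  \<open>F(l)\<close>, with \<open>X_x = l R1\<close>, \<open>X_y = (h/l) R2\<close> and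
  \<open>X = R3\<close>. After \<open>l = \<alpha> U\<close> the factor \<open>\<alpha>^3 h\<close>
  cancels.\<close>

lemma transform_coefficients:
  fixes l \<alpha> h :: real
  assumes "\<alpha> \<noteq> 0" "h \<noteq> 0" "l \<noteq> 0" "l ^ 3 \<noteq> - (\<alpha> ^ 3)" and U: "U = l / \<alpha>"
  shows "1 / ((l ^ 3 + \<alpha> ^ 3) * h) * ((l ^ 3 - \<alpha> ^ 3) * h * R3 - 2 * l ^ 3 * (\<alpha> * a) * (h / l * R2) +
      2 * \<alpha> ^ 3 * (h / \<alpha> * b) * (l * R1)) =
    R1 * (2 / (U ^ 3 + 1) * (U * b)) + R2 * - (2 / (U ^ 3 + 1) * (U ^ 2 * a)) + R3 * ((U ^ 3 - 1) / (U ^ 3 + 1))"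
proof -
  have l: "l = \<alpha> * U" using assms by auto
  have s: "l ^ 3 + \<alpha> ^ 3 = \<alpha> ^ 3 * (U ^ 3 + 1)"
    by (simp add: l power_mult_distrib algebra_simps)
  then have nz: "U ^ 3 + 1 \<noteq> 0" using assms by auto
  define M where "M = (U ^ 3 - 1) * R3 - 2 * U ^ 2 * a * R2 + 2 * U * b * R1"
  have "(l ^ 3 - \<alpha> ^ 3) * h * R3 - 2 * l ^ 3 * (\<alpha> * a) * (h / l * R2) + 2 * \<alpha> ^ 3 * (h / \<alpha> * b) * (l * R1) = \<alpha> ^ 3 * h * M"
  proof -
    have "2 * l ^ 3 * (\<alpha> * a) * (h / l * R2) = 2 * l ^ 2 * (\<alpha> * a) * (h * R2)"
      using assms(3) by (simp add: power2_eq_square power3_eq_cube)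
    moreover have "2 * \<alpha> ^ 3 * (h / \<alpha> * b) * (l * R1) = 2 * \<alpha> ^ 2 * (h * b) * (l * R1)"
      using assms(1) by (simp add: power2_eq_square power3_eq_cube)
    ultimately show ?thesis
      unfolding M_def l by algebra
  qed
  then have "1 / ((l ^ 3 + \<alpha> ^ 3) * h) * ((l ^ 3 - \<alpha> ^ 3) * h * R3 - 2 * l ^ 3 * (\<alpha> * a) * (h / l * R2) +
      2 * \<alpha> ^ 3 * (h / \<alpha> * b) * (l * R1)) = 1 / (\<alpha> ^ 3 * (U ^ 3 + 1) * h) * (\<alpha> ^ 3 * h * M)"
    by (simp only: s)
  also have "\<dots> = M / (U ^ 3 + 1)"
    using assms(1,2) nz by simp
  also have "\<dots> = R1 * (2 / (U ^ 3 + 1) * (U * b)) + R2 * - (2 / (U ^ 3 + 1) * (U ^ 2 * a)) + R3 * ((U ^ 3 - 1) / (U ^ 3 + 1))"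
    unfolding M_def by (simp add: add_divide_distrib diff_divide_distrib ring_distribs ac_simps)
  finally show ?thesis .
qed

text \<open>The rank 2 formula is the rank 1 formula with the sign of one parameter reversed; for
  \<gamma> this also needs a factor \<open>-1\<close> cancelled between numerator and denominator.
  The first form serves the passage from \<alpha> to \<open>-\<alpha>\<close>, the second the
  passage from \<open>l\<close> to \<open>-l\<close>.\<close>

lemma dual_transform_eq:
  "dual_transform h \<gamma> \<gamma>1 \<phi> X p = tz_transform h \<gamma> (- \<gamma>1) \<phi> X p"
  "dual_transform h \<gamma> \<gamma>1 \<phi> X p = tz_transform h (- \<gamma>) \<gamma>1 \<phi> X p"
proof -
  show "dual_transform h \<gamma> \<gamma>1 \<phi> X p = tz_transform h \<gamma> (- \<gamma>1) \<phi> X p"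
    by (simp add: dual_transform_def tz_transform_def)
  have e: "(- \<gamma> + \<gamma>1) * h p = - ((\<gamma> - \<gamma>1) * h p)" "(- \<gamma> - \<gamma>1) * h p = - ((\<gamma> + \<gamma>1) * h p)"
    by (simp_all add: algebra_simps)
  have n: "(- x) *\<^sub>R u - (2 * - \<gamma> * y) *\<^sub>R v + z *\<^sub>R w = - (x *\<^sub>R u - (2 * \<gamma> * y) *\<^sub>R v - z *\<^sub>R w)"
    for x y z and u v w :: "real^3" by simp
  show "dual_transform h \<gamma> \<gamma>1 \<phi> X p = tz_transform h (- \<gamma>) \<gamma>1 \<phi> X p"
    unfolding dual_transform_def tz_transform_def e n
    by (simp only: divide_minus_right scaleR_minus_left scaleR_minus_right minus_minus)
qed

lemma dual_transform_linear:
  assumes "open D" "p \<in> D" "\<And>q. q \<in> D \<Longrightarrow> Y q = M *v X q" "X differentiable (at p)"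
  shows "dual_transform h \<gamma> \<gamma>1 \<phi> Y p = M *v dual_transform h \<gamma> \<gamma>1 \<phi> X p"
proof -
  have "dx Y p = M *v dx X p" "dy Y p = M *v dy X p"
    using dx_cong[OF assms(1,2), of Y "\<lambda>q. M *v X q"] dy_cong[OF assms(1,2), of Y "\<lambda>q. M *v X q"] assms(3)
      dx_linear[OF matrix_vector_mul_bounded_linear assms(4)] dy_linear[OF matrix_vector_mul_bounded_linear assms(4)] by auto
  then show ?thesis
    using assms(2,3) unfolding dual_transform_def
    by (simp add: matrix_vector_mult_diff_distrib matrix_vector_mult_scaleR)
qed

text \<open>The factors \<open>l\<close> and \<open>h/l\<close> of the derivatives cancel against
  \<open>1/h\<close> in the dual, leaving the cross product of the first two columns, which is
  \<open>third_col_minus\<close> up to \<open>P\<close>.\<close>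

lemma third_col_dual:
  assumes D: "open D" and h: "smooth_on D h" "\<And>p. p \<in> D \<Longrightarrow> h p \<noteq> 0" and l: "l \<noteq> 0"
    and G: "frame_equations D h (of_real l) (\<lambda>p. G p (of_real l))" "\<And>p. p \<in> D \<Longrightarrow> G p \<in> Lambda_plus_SL"
    and p: "p \<in> D"
  shows "third_col G (- l) p = P_mat *v dual_sphere h (third_col G l) p"
proof -
  have inv: "invertible (G q (of_real l))" if "q \<in> D" for q
    using Lambda_plus_SLD(2)[OF G(2)[OF that]] l by simp
  have X: "third_col G l = (\<lambda>p. re_col 3 (G p (of_real l)))"
    by (simp add: fun_eq_iff third_col_eq)
  have "dx (third_col G l) p = l *\<^sub>R re_col 1 (G p (of_real l))" "dy (third_col G l) p = (h p / l) *\<^sub>R re_col 2 (G p (of_real l))"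
    unfolding X by (rule dx_re_col(3)[OF D h l G(1) inv p] dy_re_col(3)[OF D h l G(1) inv p]; assumption)+
  then have "dual_sphere h (third_col G l) p = cross3 (re_col 1 (G p (of_real l))) (re_col 2 (G p (of_real l)))"
    using l h(2)[OF p] by (simp add: dual_sphere_def cross_mult_left cross_mult_right)
  then show ?thesis
    using third_col_minus[OF G(2)[OF p] l] by (simp add: third_col_eq)
qed

lemma P_mat_vec: "P_mat *v (P_mat *v v) = (v :: real^3)"
  by (simp add: matrix_vector_mul_assoc)

context simple_dressing
begin

definition X where "X = third_col F"
definition Xhat where "Xhat l = tz_transform h (l ^ 3) (\<alpha> ^ 3) \<phi> (X l)"
definition gr where "gr l = re_matrix (g_simple \<alpha> a b (of_real l))"

lemma g_real: "g_simple \<alpha> a b (of_real l) = cx (gr l)"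
proof -
  have "cmat (g_simple \<alpha> a b (of_real l)) = g_simple \<alpha> a b (of_real l)"
    using cmat_simple_elt[of a b "of_real l / of_real \<alpha>"] by (simp add: g_simple_eq \<alpha>)
  then have "cnj (g_simple \<alpha> a b (of_real l) $ i $ j) = g_simple \<alpha> a b (of_real l) $ i $ j" for i j
    by (metis cmat_nth)
  then have "Im (g_simple \<alpha> a b (of_real l) $ i $ j) = 0" for i j
    by (metis Reals_cnj_iff complex_is_Real_iff)
  then show ?thesis
    unfolding gr_def by (rule re_matrix_cx[symmetric])
qed

lemma X_derivs:
  assumes l: "l \<noteq> 0" and p: "p \<in> D"
  shows "dx (X l) p = l *\<^sub>R re_col 1 (F p (of_real l))" "dy (X l) p = (h p / l) *\<^sub>R re_col 2 (F p (of_real l))"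
proof -
  have l': "of_real l \<noteq> (0 :: complex)" using l by simp
  have XX: "X l = (\<lambda>p. re_col 3 (F p (of_real l)))"
    by (simp add: X_def fun_eq_iff third_col_eq)
  show "dx (X l) p = l *\<^sub>R re_col 1 (F p (of_real l))" "dy (X l) p = (h p / l) *\<^sub>R re_col 2 (F p (of_real l))"
    unfolding XX
    by (rule dx_re_col(3)[OF D h(1) _ l affine_frameD(1)[OF F l'] _ p] dy_re_col(3)[OF D h(1) _ l affine_frameD(1)[OF F l'] _ p];
        (erule h(2) | erule affine_frameD(3)[OF F l']))+
qed

lemma X_diff: "l \<noteq> 0 \<Longrightarrow> p \<in> D \<Longrightarrow> X l differentiable (at p)"
proof -
  assume l: "l \<noteq> 0" and p: "p \<in> D"
  then have "smooth_on D (\<lambda>p. F p (of_real l))"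
    using affine_frameD(1)[OF F, of "of_real l"] by (simp add: frame_equations_def)
  from smooth_on_imp_differentiable[OF smooth_on_bounded_linear[OF D bounded_linear_re_col this] p]
  have "(\<lambda>p. re_col 3 (F p (of_real l))) differentiable (at p)" .
  then show "X l differentiable (at p)"
    by (simp add: X_def third_col_eq[abs_def])
qed

lemma X_dual: "l \<noteq> 0 \<Longrightarrow> p \<in> D \<Longrightarrow> X (- l) p = P_mat *v dual_sphere h (X l) p"
proof -
  assume l: "l \<noteq> 0" and p: "p \<in> D"
  then have fe: "frame_equations D h (of_real l) (\<lambda>p. F p (of_real l))"
    using affine_frameD(1)[OF F, of "of_real l"] by simp
  show "X (- l) p = P_mat *v dual_sphere h (X l) p"
    unfolding X_def by (rule third_col_dual[of D h l F p]) (use D h l p F_plus fe in simp_all)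
qed

lemma col_Xhat:
  assumes l: "l \<noteq> 0" "l ^ 3 \<noteq> - (\<alpha> ^ 3)" and p: "p \<in> D"
  shows "column 3 (F p (of_real l) ** simple_inv (of_real (a1 p)) (of_real (b1 p)) (of_real l / of_real \<alpha>)) = complex_vec (Xhat l p)"
proof -
  define U where "U = l / \<alpha>"
  have U: "of_real l / of_real \<alpha> = complex_of_real U"
    by (simp add: U_def)
  have U3: "complex_of_real U ^ 3 \<noteq> - 1"
  proof
    assume "complex_of_real U ^ 3 = - 1"
    then have "complex_of_real (U ^ 3) = of_real (- 1)" by simp
    then have "U ^ 3 = - 1" by (simp only: of_real_eq_iff)
    then show False using l(2) \<alpha> by (simp add: U_def power_divide divide_eq_eq)
  qed
  have r: "F p (of_real l) $ i $ j = of_real (re_col j (F p (of_real l)) $ i)" for i j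
    using Lambda_plus_real[OF F_plus[OF p] l(1)] by simp
  have log: "dx \<phi> p / \<phi> p = \<alpha> * a1 p" "dy \<phi> p / \<phi> p = h p / \<alpha> * b1 p"
    using dx_w(3)[OF p] dy_w(3)[OF p] by (simp_all add: \<phi>_eq a1_def b1_def)
  show ?thesis
  proof (subst vec_eq_iff, rule allI)
    fix i
    let ?R = "\<lambda>j. re_col j (F p (of_real l)) $ i"
    have "column 3 (F p (of_real l) ** simple_inv (of_real (a1 p)) (of_real (b1 p)) (of_real l / of_real \<alpha>)) $ i =
      F p (of_real l) $ i $ 1 * (2 / (of_real U ^ 3 + 1) * (of_real U * of_real (b1 p))) +
      F p (of_real l) $ i $ 2 * - (2 / (of_real U ^ 3 + 1) * (of_real U ^ 2 * of_real (a1 p))) +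
      F p (of_real l) $ i $ 3 * ((of_real U ^ 3 - 1) / (of_real U ^ 3 + 1))"
      unfolding U by (simp add: column_def matrix_matrix_mult_def sum_3 simple_inv_col3[OF U3])
    also have "\<dots> = of_real (?R 1 * (2 / (U ^ 3 + 1) * (U * b1 p)) + ?R 2 * - (2 / (U ^ 3 + 1) * (U ^ 2 * a1 p)) +
        ?R 3 * ((U ^ 3 - 1) / (U ^ 3 + 1)))"
      by (subst (1 2 3) r) simp
    also have "\<dots> = of_real (Xhat l p $ i)"
    proof -
      have X3: "X l p $ i = ?R 3"
        by (simp add: X_def third_col_eq)
      have "Xhat l p $ i = 1 / ((l ^ 3 + \<alpha> ^ 3) * h p) * ((l ^ 3 - \<alpha> ^ 3) * h p * ?R 3 -
          2 * l ^ 3 * (\<alpha> * a1 p) * (h p / l * ?R 2) + 2 * \<alpha> ^ 3 * (h p / \<alpha> * b1 p) * (l * ?R 1))"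
        unfolding Xhat_def tz_transform_def log X_derivs[OF l(1) p]
        by (simp only: vector_scaleR_component vector_add_component vector_minus_component X3 real_scaleR_def)
      then show ?thesis
        by (simp only: transform_coefficients[OF \<alpha> h(2)[OF p] l U_def])
    qed
    finally show "column 3 (F p (of_real l) ** simple_inv (of_real (a1 p)) (of_real (b1 p)) (of_real l / of_real \<alpha>)) $ i
      = complex_vec (Xhat l p) $ i" by simp
  qed
qed

context
  fixes l :: real
  assumes l: "l \<noteq> 0" "l ^ 3 \<noteq> \<alpha> ^ 3" "l ^ 3 \<noteq> - (\<alpha> ^ 3)"
begin

lemma l_complex: "of_real l \<noteq> (0 :: complex)" "complex_of_real l ^ 3 \<noteq> of_real \<alpha> ^ 3" "complex_of_real l ^ 3 \<noteq> - (of_real \<alpha> ^ 3)"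
proof -
  show "of_real l \<noteq> (0 :: complex)" using l by simp
  have "complex_of_real (l ^ 3) \<noteq> of_real (\<alpha> ^ 3)" "complex_of_real (l ^ 3) \<noteq> of_real (- (\<alpha> ^ 3))"
    using l(2,3) by (simp_all only: of_real_eq_iff) simp_all
  then show "complex_of_real l ^ 3 \<noteq> of_real \<alpha> ^ 3" "complex_of_real l ^ 3 \<noteq> - (of_real \<alpha> ^ 3)"
    by simp_all
qed

lemma l_quotient: "(of_real l / of_real \<alpha>) ^ 3 \<noteq> (1 :: complex)" "(of_real l / of_real \<alpha>) ^ 3 \<noteq> (- 1 :: complex)"
  using l_complex \<alpha> by (simp_all add: power_divide divide_eq_eq)

lemma det_gr: "det (gr l) = (l ^ 3 + \<alpha> ^ 3) / (l ^ 3 - \<alpha> ^ 3)"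
proof -
  have "complex_of_real (det (gr l)) = ((of_real l / of_real \<alpha>) ^ 3 + 1) / ((of_real l / of_real \<alpha>) ^ 3 - 1)"
    using det_simple_elt[OF l_quotient(1) of_real_nondegenerate[OF ab]]
    by (simp flip: det_cx g_real add: g_simple_eq \<alpha>)
  also have "\<dots> = of_real (((l / \<alpha>) ^ 3 + 1) / ((l / \<alpha>) ^ 3 - 1))" by simp
  finally have "det (gr l) = ((l / \<alpha>) ^ 3 + 1) / ((l / \<alpha>) ^ 3 - 1)"
    by (simp only: of_real_eq_iff)
  moreover have "(l / \<alpha>) ^ 3 + 1 = (l ^ 3 + \<alpha> ^ 3) / \<alpha> ^ 3" "(l / \<alpha>) ^ 3 - 1 = (l ^ 3 - \<alpha> ^ 3) / \<alpha> ^ 3"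
    using \<alpha> by (simp_all add: power_divide add_divide_distrib diff_divide_distrib)
  ultimately show ?thesis using \<alpha> by simp
qed

lemma det_gr_nz: "det (gr l) \<noteq> 0"
  using l by (simp add: det_gr add_eq_0_iff2)

lemma gr_invertible: "invertible (gr l)"
  using det_gr_nz by (simp add: invertible_det_nz)

lemma g_invertible: "invertible (g_simple \<alpha> a b (of_real l))"
  using det_gr_nz by (simp add: invertible_det_nz g_real det_cx)

context
  fixes Ft
  assumes Ft: "\<And>p. p \<in> D \<Longrightarrow> Ft p \<in> Lambda_plus_SL"
    and fact: "\<And>p. p \<in> D \<Longrightarrow> g_simple \<alpha> a b (of_real l) ** F p (of_real l) = Ft p (of_real l) ** gt p (of_real l)"
begin

lemma col_Ft: "p \<in> D \<Longrightarrow> column 3 (Ft p (of_real l)) = complex_vec (gr l *v Xhat l p)"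
proof -
  assume p: "p \<in> D"
  let ?inv = "simple_inv (of_real (a1 p)) (of_real (b1 p)) (of_real l / of_real \<alpha>)"
  have "gt p (of_real l) ** ?inv = mat 1"
    unfolding g_simple_eq[OF \<alpha>] by (rule simple_inv_right[OF l_quotient of_real_nondegenerate[OF ab1[OF p]]])
  then have "Ft p (of_real l) = Ft p (of_real l) ** (gt p (of_real l) ** ?inv)" by simp
  also have "\<dots> = g_simple \<alpha> a b (of_real l) ** (F p (of_real l) ** ?inv)"
    by (simp only: matrix_mul_assoc fact[OF p])
  finally have "Ft p (of_real l) = g_simple \<alpha> a b (of_real l) ** (F p (of_real l) ** ?inv)" .
  then have "column 3 (Ft p (of_real l)) = g_simple \<alpha> a b (of_real l) *v complex_vec (Xhat l p)"
    by (simp only: column_mult[where A = "g_simple \<alpha> a b (of_real l)"] col_Xhat[OF l(1,3) p])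
  then show ?thesis
    by (simp add: g_real complex_vec_mult)
qed

lemma third_col_Ft: "p \<in> D \<Longrightarrow> third_col Ft l p = gr l *v Xhat l p"
proof -
  assume "p \<in> D"
  from col_Ft[OF this] have "Ft p (of_real l) $ i $ 3 = of_real ((gr l *v Xhat l p) $ i)" for i
    by (simp add: column_def vec_eq_iff)
  then show "third_col Ft l p = gr l *v Xhat l p"
    by (simp add: vec_eq_iff third_col_eq)
qed

lemma frame_Ft_l: "frame_equations D hhat (of_real l) (\<lambda>p. Ft p (of_real l))"
  by (rule frame_Ft[OF Ft fact l_complex])

lemma third_col_Ft_solves: "solves_system D hhat (l ^ 3) (third_col Ft l)"
proof -
  have "solves_system D hhat (l ^ 3) (\<lambda>p. re_col 3 (Ft p (of_real l)))"
    using Lambda_plus_SLD(2)[OF Ft l_complex(1)]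
    by (intro frame_solves_system[OF D hhat_smooth hhat_nz l(1) frame_Ft_l])
  then show ?thesis
    by (simp add: third_col_eq[abs_def])
qed

lemma Xhat_eq: "p \<in> D \<Longrightarrow> Xhat l p = matrix_inv (gr l) *v third_col Ft l p"
  by (simp add: third_col_Ft matrix_vector_mul_assoc matrix_inv_left[OF gr_invertible])

lemma Xhat_solves: "solves_system D hhat (l ^ 3) (Xhat l)"
  using solves_system_linear[OF D matrix_vector_mul_bounded_linear third_col_Ft_solves, of "matrix_inv (gr l)"]
    solves_system_cong[OF D, of "Xhat l" "\<lambda>p. matrix_inv (gr l) *v third_col Ft l p"] Xhat_eq by simp

lemma complex_Xhat: "p \<in> D \<Longrightarrow> complex_vec (Xhat l p) = matrix_inv (g_simple \<alpha> a b (of_real l)) *v column 3 (Ft p (of_real l))"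
  by (simp add: col_Ft complex_vec_mult g_real[symmetric] matrix_vector_mul_assoc matrix_inv_left[OF g_invertible])

text \<open>Duality of the dressed frame between \<open>l\<close> and \<open>-l\<close> is
  transported to \<open>Xhat\<close> by the cofactor identity
  \<open>A^t (Ax \<times> Ay) = det A (x \<times> y)\<close> for the constant matrix
  \<open>A = gr l\<close>.\<close>

lemma dual_Ft:
  assumes p: "p \<in> D"
  shows "det (gr l) *\<^sub>R dual_sphere hhat (Xhat l) p = transpose (gr l) *v (P_mat *v third_col Ft (- l) p)"
proof -
  have Xd: "Xhat l differentiable (at p)"
    using Xhat_solves smooth_on_imp_differentiable p unfolding solves_system_def by blast
  have d: "dx (third_col Ft l) p = gr l *v dx (Xhat l) p" "dy (third_col Ft l) p = gr l *v dy (Xhat l) p"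
    using dx_cong[OF D p, of "third_col Ft l" "\<lambda>p. gr l *v Xhat l p"] dy_cong[OF D p, of "third_col Ft l" "\<lambda>p. gr l *v Xhat l p"]
      third_col_Ft dx_linear[OF matrix_vector_mul_bounded_linear Xd] dy_linear[OF matrix_vector_mul_bounded_linear Xd] by auto
  have "P_mat *v third_col Ft (- l) p = dual_sphere hhat (third_col Ft l) p"
    using third_col_dual[OF D hhat_smooth hhat_nz l(1) frame_Ft_l Ft p] by (simp add: P_mat_vec)
  also have "\<dots> = (1 / hhat p) *\<^sub>R cross3 (gr l *v dx (Xhat l) p) (gr l *v dy (Xhat l) p)"
    by (simp add: dual_sphere_def d)
  finally have e: "P_mat *v third_col Ft (- l) p = (1 / hhat p) *\<^sub>R cross3 (gr l *v dx (Xhat l) p) (gr l *v dy (Xhat l) p)" .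
  show ?thesis
    unfolding e dual_sphere_def matrix_vector_mult_scaleR cross_matrix_mult scaleR_scaleR
    by (simp only: mult.commute)
qed

end

text \<open>The inverse formula \<open>P g(-w)^t P\<close> for real parameters. It cancels the
  constant matrices at \<open>l\<close> and \<open>-l\<close> when the dual of \<open>Xhat\<close>
  is computed.\<close>

lemma gr_P: "transpose (gr l) ** P_mat ** gr (- l) = P_mat"
proof -
  have "simple_inv (of_real a) (of_real b) (of_real l / of_real \<alpha>) ** simple_elt (of_real a) (of_real b) (of_real l / of_real \<alpha>) = mat 1"
    by (rule simple_inv_left[OF l_quotient of_real_nondegenerate[OF ab]])
  then have "P_mat ** transpose (cx (gr (- l))) ** P_mat ** cx (gr l) = mat 1"
    by (simp add: simple_inv_def g_simple_eq[OF \<alpha>] flip: g_real)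
  then have "P_mat ** (P_mat ** transpose (cx (gr (- l))) ** P_mat ** cx (gr l)) = P_mat" by simp
  then have "transpose (cx (gr (- l))) ** P_mat ** cx (gr l) = P_mat"
    by (simp add: matrix_mul_assoc)
  then have "transpose (transpose (cx (gr (- l))) ** P_mat ** cx (gr l)) = transpose P_mat" by simp
  then have "transpose (cx (gr l)) ** P_mat ** cx (gr (- l)) = P_mat"
    by (simp add: matrix_transpose_mul matrix_mul_assoc)
  then have "cx (transpose (gr l) ** P_mat ** gr (- l)) = cx P_mat"
    by (simp add: cx_mult cx_transpose cx_P_mat)
  then show ?thesis by (simp only: cx_inject)
qed

end

end

section \<open>Lines and residues\<close>

lemma real_line_nondegenerate:
  assumes "\<not> real_line a b \<subseteq> Delta0"
  shows "2 * a * b \<noteq> 1"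
proof
  assume *: "2 * a * b = 1"
  have "v \<in> Delta0" if v: "v \<in> real_line a b" for v
  proof -
    obtain t where "v = t *\<^sub>R vector [a, b, 1]"
      using v by (auto simp: real_line_def span_singleton)
    then have "2 * v $ 1 * v $ 2 = (2 * a * b) * (v $ 3)\<^sup>2"
      by (simp add: power2_eq_square)
    then show ?thesis using * by (simp add: Delta0_def)
  qed
  with assms show False by blast
qed

lemma line_times_nth:
  "((t *\<^sub>R vector [a, b, 1]) v* re_matrix M) $ j = t * (vector [a, b, 1] \<bullet> re_col j M)"
  by (simp add: vector_matrix_mult_def sum_3 inner_vec_def re_matrix_def algebra_simps)

lemma line_times_nondegenerate:
  assumes "\<not> line_times (real_line a b) M \<subseteq> Delta0"
  shows "vector [a, b, 1] \<bullet> re_col 3 M \<noteq> 0"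
    and "2 * (vector [a, b, 1] \<bullet> re_col 1 M) * (vector [a, b, 1] \<bullet> re_col 2 M) \<noteq> (vector [a, b, 1] \<bullet> re_col 3 M) ^ 2"
proof -
  obtain t where t: "(t *\<^sub>R vector [a, b, 1]) v* re_matrix M \<notin> Delta0"
    using assms by (auto simp: line_times_def real_line_def span_singleton)
  then show "vector [a, b, 1] \<bullet> re_col 3 M \<noteq> 0"
    "2 * (vector [a, b, 1] \<bullet> re_col 1 M) * (vector [a, b, 1] \<bullet> re_col 2 M) \<noteq> (vector [a, b, 1] \<bullet> re_col 3 M) ^ 2"
    unfolding Delta0_def mem_Collect_eq line_times_nth by (auto simp: power2_eq_square)
qed

lemma line_times_eq_real_line:
  assumes "vector [a, b, 1] \<bullet> re_col 3 M \<noteq> 0"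
  shows "line_times (real_line a b) M = real_line ((vector [a, b, 1] \<bullet> re_col 1 M) / (vector [a, b, 1] \<bullet> re_col 3 M))
    ((vector [a, b, 1] \<bullet> re_col 2 M) / (vector [a, b, 1] \<bullet> re_col 3 M))" (is "_ = real_line ?a ?b")
proof -
  let ?c = "vector [a, b, 1] \<bullet> re_col 3 M"
  have e: "(t *\<^sub>R vector [a, b, 1]) v* re_matrix M = (t * ?c) *\<^sub>R vector [?a, ?b, 1]" for t
    using assms by (simp add: vec_eq_iff forall_3 line_times_nth)
  have e': "(t *\<^sub>R vector [?a, ?b, 1]) = ((t / ?c) *\<^sub>R vector [a, b, 1]) v* re_matrix M" for t
    unfolding e using assms by simp
  have "line_times (real_line a b) M = range (\<lambda>t. (t *\<^sub>R vector [a, b, 1]) v* re_matrix M)"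
    by (simp add: line_times_def real_line_def span_singleton image_image)
  also have "\<dots> = range (\<lambda>t. t *\<^sub>R vector [?a, ?b, 1])"
  proof (intro subset_antisym image_subsetI)
    fix t
    show "(t *\<^sub>R vector [a, b, 1]) v* re_matrix M \<in> range (\<lambda>t. t *\<^sub>R vector [?a, ?b, 1])"
      unfolding e by (rule rangeI)
    show "t *\<^sub>R vector [?a, ?b, 1] \<in> range (\<lambda>t. (t *\<^sub>R vector [a, b, 1]) v* re_matrix M)"
      unfolding e' by (rule rangeI)
  qed
  finally show ?thesis
    by (simp add: real_line_def span_singleton)
qed

section \<open>The residue of the rank 2 element and the dual line\<close>

lemma residue_cube_pole:
  assumes "\<beta> \<noteq> 0" "n holomorphic_on UNIV"
  shows "residue (\<lambda>z. d + 2 / ((z / \<beta>) ^ 3 - 1) * n z) \<beta> = 2 * \<beta> / 3 * n \<beta>"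
proof (rule residue_simple')
  \<comment> \<open>The complement of the other two roots of \<open>z^3 = \<beta>^3\<close>, so that
    \<beta> is the only possible singularity in \<open>S\<close>.\<close>
  define S where "S = - {\<beta> * eps ^ 2, \<beta> * eps ^ 4}"
  show "open S" by (auto simp: S_def)
  have "eps ^ 2 \<noteq> 1"
    unfolding eps_sq by (simp add: eps_Re_Im complex_eq_iff)
  moreover have "eps ^ 4 \<noteq> 1"
  proof -
    have "eps ^ 4 = - eps" using eps_sq by algebra
    then show ?thesis by (simp add: eps_Re_Im complex_eq_iff)
  qed
  ultimately show "\<beta> \<in> S"
    using assms(1) by (simp add: S_def)
  have "(z / \<beta>) ^ 3 - 1 \<noteq> 0" if "z \<in> S - {\<beta>}" for z
    using that assms(1) cube_eq_1_iff[of "z / \<beta>"] by (auto simp: S_def divide_eq_eq mult.commute)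
  then show "(\<lambda>z. d + 2 / ((z / \<beta>) ^ 3 - 1) * n z) holomorphic_on S - {\<beta>}"
    using assms by (intro holomorphic_intros) (auto intro: holomorphic_on_subset)
  have "((\<lambda>z. (z / \<beta>) ^ 3 - 1) has_field_derivative (3 * (\<beta> / \<beta>) ^ 2 * (1 / \<beta>))) (at \<beta>)"
    by (auto intro!: derivative_eq_intros)
  then have q: "((\<lambda>z. ((z / \<beta>) ^ 3 - 1) / (z - \<beta>)) \<longlongrightarrow> 3 / \<beta>) (at \<beta>)"
    using assms(1) by (simp add: has_field_derivative_iff)
  have n: "(n \<longlongrightarrow> n \<beta>) (at \<beta>)"
    using holomorphic_on_imp_continuous_on[OF assms(2)] by (simp add: continuous_on_eq_continuous_at isCont_def)
  have nz: "3 / \<beta> \<noteq> 0" using assms(1) by simp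
  have "((\<lambda>z. d * (z - \<beta>) + 2 / (((z / \<beta>) ^ 3 - 1) / (z - \<beta>)) * n z) \<longlongrightarrow> d * (\<beta> - \<beta>) + 2 / (3 / \<beta>) * n \<beta>) (at \<beta>)"
    by (rule tendsto_add[OF tendsto_mult[OF tendsto_const tendsto_diff[OF tendsto_ident_at tendsto_const]]
        tendsto_mult[OF tendsto_divide[OF tendsto_const q nz] n]])
  moreover have "d * (\<beta> - \<beta>) + 2 / (3 / \<beta>) * n \<beta> = 2 * \<beta> / 3 * n \<beta>"
    by simp
  moreover have "d * (z - \<beta>) + 2 / (((z / \<beta>) ^ 3 - 1) / (z - \<beta>)) * n z = (d + 2 / ((z / \<beta>) ^ 3 - 1) * n z) * (z - \<beta>)" for z
    by (simp add: distrib_right)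
  ultimately show "((\<lambda>z. (d + 2 / ((z / \<beta>) ^ 3 - 1) * n z) * (z - \<beta>)) \<longlongrightarrow> 2 * \<beta> / 3 * n \<beta>) (at \<beta>)"
    by simp
qed

lemma matrix_holomorphic_on_simple_res:
  "s holomorphic_on S \<Longrightarrow> matrix_holomorphic_on (\<lambda>z. simple_res a b (s z)) S"
  unfolding matrix_holomorphic_on_def forall_3 simple_res_def by (auto intro!: holomorphic_intros)

text \<open>The factor \<open>1/3\<close> comes from the derivative \<open>3/\<alpha>\<close> of
  \<open>(z/\<alpha>)^3\<close> at the pole, after the division by \<open>2 \<alpha>\<close> in the
  definition.\<close>

lemma res_matrix_eq:
  assumes "\<alpha> \<noteq> 0" "2 * a * b \<noteq> 1"
  shows "res_matrix \<alpha> a b = smat (1 / 3) (mat 1 - simple_res (of_real a) (of_real b) (- 1))"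
proof -
  define n where "n = (\<lambda>i j z. (mat 1 - simple_res (of_real a) (of_real b) (- (z / of_real \<alpha>))) $ i $ j)"
  have "(\<lambda>z. - (z / of_real \<alpha>)) holomorphic_on UNIV"
    using assms(1) by (intro holomorphic_intros) auto
  from matrix_holomorphic_on_simple_res[OF this] have hol: "n i j holomorphic_on UNIV" for i j
    unfolding n_def vector_minus_component matrix_holomorphic_on_def
    by (intro holomorphic_on_diff holomorphic_on_const) blast
  have "residue (\<lambda>z. h_simple \<alpha> a b z $ i $ j) (of_real \<alpha>) / (2 * of_real \<alpha>) = 1 / 3 * n i j (of_real \<alpha>)" for i j
  proof -
    have "(\<lambda>z. h_simple \<alpha> a b z $ i $ j) = (\<lambda>z. mat 1 $ i $ j + 2 / ((z / of_real \<alpha>) ^ 3 - 1) * n i j z)"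
      by (simp only: h_simple_eq[OF assms refl] n_def vector_add_component smat_nth)
    then show ?thesis
      using residue_cube_pole[OF _ hol, of "of_real \<alpha>" "mat 1 $ i $ j" i j] assms(1) by simp
  qed
  then show ?thesis
    unfolding res_matrix_def using assms(1) by (simp add: vec_eq_iff n_def)
qed

text \<open>The kernel is spanned by \<open>(b, a, 1)^t\<close>, which is \<open>P\<close> applied
  to \<open>(a, b, 1)^t\<close>; this ties the kernel condition to the original line.\<close>

lemma res_matrix_kernel:
  assumes "2 * a * b \<noteq> 1"
  shows "(mat 1 - simple_res a b (- 1)) *v y = 0 \<longleftrightarrow> y $ 1 = b * y $ 3 \<and> y $ 2 = a * y $ 3"
proof -
  define K where "K = 1 / (2 * a * b - 1)"
  have K: "K * (2 * a * b - 1) = 1" "\<And>x. x / (2 * a * b - 1) = x * K"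
    using assms by (simp_all add: K_def)
  define y1 y2 y3 where "y1 = y $ 1" and "y2 = y $ 2" and "y3 = y $ 3"
  have "(mat 1 - simple_res a b (- 1)) *v y = 0 \<longleftrightarrow>
      (1 - a * b * K) * y1 - b\<^sup>2 * K * y2 + b * K * y3 = 0 \<and> a\<^sup>2 * y1 + (1 - a * b) * y2 - a * y3 = 0 \<and> b * y2 - a * y1 = 0"
    unfolding y1_def y2_def y3_def
    by (simp add: vec_eq_iff forall_3 matrix_vector_mult_def sum_3 simple_res_def K(2) mat_def)
  also have "\<dots> \<longleftrightarrow> y1 = b * y3 \<and> y2 = a * y3"
  proof (intro iffI conjI; (elim conjE)?)
    assume e: "(1 - a * b * K) * y1 - b\<^sup>2 * K * y2 + b * K * y3 = 0" "a\<^sup>2 * y1 + (1 - a * b) * y2 - a * y3 = 0" "b * y2 - a * y1 = 0"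
    show y2: "y2 = a * y3" using e(2,3) by algebra
    show "y1 = b * y3" using e(1,3) K(1) y2 by algebra
  next
    assume e: "y1 = b * y3" "y2 = a * y3"
    show "(1 - a * b * K) * y1 - b\<^sup>2 * K * y2 + b * K * y3 = 0" unfolding e using K(1) by algebra
    show "a\<^sup>2 * y1 + (1 - a * b) * y2 - a * y3 = 0" unfolding e by algebra
    show "b * y2 - a * y1 = 0" unfolding e by algebra
  qed
  finally show ?thesis by (simp add: y1_def y2_def y3_def)
qed

text \<open>By the reflected twisting condition the inverse of \<open>F(\<alpha>) P\<close> is
  \<open>F(-\<alpha>)^t P\<close>, which takes the kernel vector \<open>(b, a, 1)^t\<close> to the
  transpose of \<open>(a, b, 1) F(-\<alpha>)\<close>. This makes the hypothesis of the rank 2 case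
  the one of \<open>simple_dressing\<close> at \<open>- \<alpha>\<close>.\<close>

lemma dual_line_eq:
  assumes f: "f \<in> Lambda_plus_SL" and \<alpha>: "\<alpha> \<noteq> 0" and ab: "2 * a * b \<noteq> 1"
  shows "dual_line \<alpha> a b (f (of_real \<alpha>)) = line_times (real_line a b) (f (of_real (- \<alpha>)))"
proof -
  define R S where "R = re_matrix (f (of_real \<alpha>))" and "S = re_matrix (f (of_real (- \<alpha>)))"
  have real: "cx (re_matrix (f (of_real l))) = f (of_real l)" if "l \<noteq> 0" for l
    using Lambda_plus_real[OF f that] by (intro re_matrix_cx) (metis Im_complex_of_real)
  have R: "f (of_real \<alpha>) = cx R" and S: "f (- of_real \<alpha>) = cx S"
    using real[of \<alpha>] real[of "- \<alpha>"] \<alpha> by (simp_all add: R_def S_def)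
  have "f (- of_real \<alpha>) ** P_mat ** transpose (f (of_real \<alpha>)) = P_mat"
    using Lambda_plus_SLD(5)[OF f, of "of_real \<alpha>"] \<alpha> by simp
  then have "cx (S ** P_mat ** transpose R) = cx P_mat"
    by (simp add: R S cx_mult cx_transpose cx_P_mat)
  then have "S ** P_mat ** transpose R = P_mat"
    by (simp only: cx_inject)
  then have "transpose (S ** P_mat ** transpose R) ** P_mat = P_mat ** P_mat"
    by simp
  then have RS: "(R ** P_mat) ** (transpose S ** P_mat) = mat 1"
    by (simp add: matrix_transpose_mul matrix_mul_assoc)
  then have SR: "(transpose S ** P_mat) ** (R ** P_mat) = mat 1"
    by (simp add: matrix_left_right_inverse)
  have "v \<in> dual_line \<alpha> a b (f (of_real \<alpha>)) \<longleftrightarrow> (\<exists>t. (R ** P_mat) *v v = t *\<^sub>R vector [b, a, 1])" for v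
  proof -
    define y where "y = (R ** P_mat) *v v"
    have "(res_matrix \<alpha> a b ** f (of_real \<alpha>) ** P_mat) *v complex_vec v =
        smat (1 / 3) (mat 1 - simple_res (of_real a) (of_real b) (- 1)) *v complex_vec y"
      unfolding y_def complex_vec_mult cx_mult cx_P_mat R res_matrix_eq[OF \<alpha> ab]
      by (simp only: matrix_vector_mul_assoc matrix_mul_assoc)
    also have "\<dots> = 0 \<longleftrightarrow> (mat 1 - simple_res (of_real a) (of_real b) (- 1)) *v complex_vec y = 0"
      by (simp add: smat_vec vec_eq_iff)
    also have "\<dots> \<longleftrightarrow> complex_of_real (y $ 1) = of_real (b * y $ 3) \<and> complex_of_real (y $ 2) = of_real (a * y $ 3)"
      unfolding res_matrix_kernel[OF of_real_nondegenerate[OF ab]] by simp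
    also have "\<dots> \<longleftrightarrow> y $ 1 = b * y $ 3 \<and> y $ 2 = a * y $ 3"
      by (simp only: of_real_eq_iff)
    also have "\<dots> \<longleftrightarrow> (\<exists>t. y = t *\<^sub>R vector [b, a, 1])"
      by (auto simp: vec_eq_iff forall_3 mult.commute)
    finally show ?thesis by (simp add: dual_line_def y_def)
  qed
  moreover have "(\<exists>t. (R ** P_mat) *v v = t *\<^sub>R vector [b, a, 1]) \<longleftrightarrow> (\<exists>t. v = (t *\<^sub>R vector [a, b, 1]) v* S)" for v
  proof -
    have "(R ** P_mat) *v v = u \<longleftrightarrow> v = (transpose S ** P_mat) *v u" for u
      using RS SR by (metis matrix_vector_mul_assoc matrix_vector_mul_lid)
    moreover have "(transpose S ** P_mat) *v (t *\<^sub>R vector [b, a, 1]) = (t *\<^sub>R vector [a, b, 1]) v* S" for t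
    proof -
      have "P_mat *v (t *\<^sub>R vector [b, a, 1]) = (t *\<^sub>R vector [a, b, 1] :: real^3)"
        by (simp add: vec_eq_iff forall_3 matrix_vector_mult_def sum_3 P_mat_def)
      then show ?thesis
        by (simp flip: matrix_vector_mul_assoc)
    qed
    ultimately show ?thesis by simp
  qed
  ultimately show ?thesis
    by (auto simp: line_times_def real_line_def span_singleton image_iff S_def)
qed

lemma simple_dressingI:
  assumes "open D" "tzitzeica_solution D h" "affine_frame D h F" "\<alpha> \<noteq> 0" "\<not> real_line a b \<subseteq> Delta0"
    and "\<And>p. p \<in> D \<Longrightarrow> \<not> line_times (real_line a b) (F p (of_real \<alpha>)) \<subseteq> Delta0"
  shows "simple_dressing D h F \<alpha> a b"
  using assms real_line_nondegenerate line_times_nondegenerate[OF assms(6)]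
  by unfold_locales (auto simp: frame_row_def)

text \<open>Where \<open>h_simple_eq_smat\<close> applies, both sides carry the same scalar. The
  points \<open>z^3 = -\<alpha>^3\<close>, regular for \<open>h_simple\<close> but poles of
  \<open>g_{-\<alpha>}\<close>, are recovered by continuity.\<close>

lemma h_simple_factor:
  assumes \<alpha>: "\<alpha> \<noteq> 0" and ab: "2 * a * b \<noteq> 1" "2 * a1 * b1 \<noteq> 1"
    and f: "f \<in> Lambda_plus_SL" "G \<in> Lambda_plus_SL"
    and eq: "\<And>z. z \<noteq> 0 \<Longrightarrow> z ^ 3 \<noteq> of_real \<alpha> ^ 3 \<Longrightarrow> z ^ 3 \<noteq> - (of_real \<alpha> ^ 3) \<Longrightarrow>
      g_simple (- \<alpha>) a b z ** f z = G z ** g_simple (- \<alpha>) a1 b1 z"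
    and z: "z \<noteq> 0" "z ^ 3 \<noteq> of_real \<alpha> ^ 3"
  shows "h_simple \<alpha> a b z ** f z = G z ** h_simple \<alpha> a1 b1 z"
proof -
  define S where "S = - {0} - {z. z ^ 3 = complex_of_real \<alpha> ^ 3}"
  have "closed {z. z ^ 3 = complex_of_real \<alpha> ^ 3}"
    by (intro closed_Collect_eq continuous_intros)
  then have S: "open S" "z \<in> S" using z by (auto simp: S_def)
  have "matrix_holomorphic_on (h_simple \<alpha> a b) S" if "2 * a * b \<noteq> 1" for a b
  proof -
    have nz: "(z / of_real \<alpha>) ^ 3 - 1 \<noteq> 0" if "z \<in> S" for z
      using that \<alpha> by (auto simp: S_def power_divide)
    have c: "(\<lambda>z. 2 / ((z / of_real \<alpha>) ^ 3 - 1)) holomorphic_on S"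
      using nz \<alpha> by (intro holomorphic_intros) auto
    have "(\<lambda>z. - (z / of_real \<alpha>)) holomorphic_on S"
      using \<alpha> by (intro holomorphic_intros) auto
    from matrix_holomorphic_on_simple_res[OF this]
    have m: "(\<lambda>z. simple_res (of_real a) (of_real b) (- (z / of_real \<alpha>)) $ i $ j) holomorphic_on S" for i j
      unfolding matrix_holomorphic_on_def by blast
    show ?thesis
      unfolding matrix_holomorphic_on_def h_simple_eq[OF \<alpha> that refl] vector_add_component vector_minus_component smat_nth
      by (intro allI holomorphic_on_add holomorphic_on_mult holomorphic_on_diff holomorphic_on_const c m)
  qed
  note hol = this[OF ab(1)] this[OF ab(2)]
  have sub: "S \<subseteq> - {0}" by (auto simp: S_def)
  have fG: "matrix_holomorphic_on f S" "matrix_holomorphic_on G S"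
    using f matrix_holomorphic_on_subset[OF _ sub] by (auto simp: Lambda_plus_SL_def)
  have l: "((\<lambda>z. h_simple \<alpha> a b z ** f z) \<longlongrightarrow> h_simple \<alpha> a b z ** f z) (at z)"
    and r: "((\<lambda>z. G z ** h_simple \<alpha> a1 b1 z) \<longlongrightarrow> G z ** h_simple \<alpha> a1 b1 z) (at z)"
    using S by (intro tendsto_matrix_mult matrix_holomorphic_on_tendsto hol fG; simp)+
  have fin: "finite ({z. z ^ 3 = - (complex_of_real \<alpha> ^ 3)} \<union> {z. z ^ 3 = complex_of_real \<alpha> ^ 3} \<union> {0})"
    by (simp add: finite_nth_roots)
  have "\<forall>\<^sub>F x in at z. x \<notin> {z. z ^ 3 = - (complex_of_real \<alpha> ^ 3)} \<union> {z. z ^ 3 = complex_of_real \<alpha> ^ 3} \<union> {0}"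
    using islimpt_finite[OF fin, of z] by (simp add: islimpt_iff_eventually)
  then have "\<forall>\<^sub>F x in at z. h_simple \<alpha> a b x ** f x = G x ** h_simple \<alpha> a1 b1 x"
  proof eventually_elim
    case (elim x)
    then have x: "x \<noteq> 0" "x ^ 3 \<noteq> of_real \<alpha> ^ 3" "x ^ 3 \<noteq> - (of_real \<alpha> ^ 3)" by auto
    show ?case
      unfolding h_simple_eq_smat[OF \<alpha> x(2,3) ab(1)] h_simple_eq_smat[OF \<alpha> x(2,3) ab(2)]
        smat_mult_left smat_mult_right eq[OF x] ..
  qed
  from Lim_transform_eventually[OF l this] r show ?thesis
    by (intro tendsto_unique[OF trivial_limit_at])
qed

context simple_dressing
begin

context
  fixes r :: real
  assumes r: "0 < r" "r < \<bar>\<alpha>\<bar>" "\<bar>\<alpha>\<bar> < 1 / r"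
begin

lemma dressing_defined_g: "dressing_defined r D (g_simple \<alpha> a b) F"
  by (rule dressing_defined_g_simple[where ?a1.0 = a1 and ?b1.0 = b1 and c = "\<lambda>p. of_real (\<phi> p)"])
    (use r ab F_plus ab1 line in auto)

lemma dressing_factor:
  assumes "dressing r D (g_simple \<alpha> a b) F Ft" "p \<in> D" "z \<noteq> 0" "z ^ 3 \<noteq> of_real \<alpha> ^ 3" "z ^ 3 \<noteq> - (of_real \<alpha> ^ 3)"
  shows "g_simple \<alpha> a b z ** F p z = Ft p z ** gt p z"
  by (rule dressing_g_simple_factor[where ?a1.0 = a1 and ?b1.0 = b1 and c = "\<lambda>p. of_real (\<phi> p)" and r = r and D = D])
    (use r ab F_plus ab1 line assms in auto)

text \<open>The reversed frame at \<open>-\<alpha>\<close> is \<open>F(\<alpha>)\<close>, so the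
  line functions \<open>a1\<close>, \<open>b1\<close> and \<phi> are those of the rank 1 case; and
  \<open>g_{-\<alpha>}(-z) = g_\<alpha>(z)\<close> turns the rank 2 factorization at
  \<open>-z\<close> into the rank 1 factorization at \<open>z\<close>.\<close>

lemma dual_frame_dressing:
  shows "dressing_defined r D (h_simple \<alpha> a b) (dual_frame F)"
    and "\<And>Ft p z. dressing r D (h_simple \<alpha> a b) (dual_frame F) Ft \<Longrightarrow> p \<in> D \<Longrightarrow> z \<noteq> 0 \<Longrightarrow>
      z ^ 3 \<noteq> of_real \<alpha> ^ 3 \<Longrightarrow> z ^ 3 \<noteq> - (of_real \<alpha> ^ 3) \<Longrightarrow>
      g_simple \<alpha> a b z ** F p z = Ft p (- z) ** gt p z"
proof -
  have plus: "dual_frame F p \<in> Lambda_plus_SL" if "p \<in> D" for p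
    using Lambda_plus_reflect[OF F_plus[OF that]] by (simp add: dual_frame_def[abs_def])
  have dline: "line_relation a b (dual_frame F p (of_real (- \<alpha>))) (a1 p) (b1 p) (of_real (\<phi> p))" if "p \<in> D" for p
    using line[OF that] by (simp add: dual_frame_def)
  have r': "0 < r" "r < \<bar>- \<alpha>\<bar>" "\<bar>- \<alpha>\<bar> < 1 / r" using r by auto
  have "dressing_defined r D (g_simple (- \<alpha>) a b) (dual_frame F)"
    by (rule dressing_defined_g_simple[where ?a1.0 = a1 and ?b1.0 = b1 and c = "\<lambda>p. of_real (\<phi> p)"])
      (use r' ab plus ab1 dline in auto)
  then show "dressing_defined r D (h_simple \<alpha> a b) (dual_frame F)"
    unfolding dressing_defined_def dressing_h_simple_iff[OF r ab] .
  fix Ft p and z :: complex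
  assume d: "dressing r D (h_simple \<alpha> a b) (dual_frame F) Ft" and p: "p \<in> D"
    and z: "z \<noteq> 0" "z ^ 3 \<noteq> of_real \<alpha> ^ 3" "z ^ 3 \<noteq> - (of_real \<alpha> ^ 3)"
  have "(- z) ^ 3 = - (z ^ 3)" "complex_of_real (- \<alpha>) ^ 3 = - (of_real \<alpha> ^ 3)" by simp_all
  then have z': "- z \<noteq> 0" "(- z) ^ 3 \<noteq> of_real (- \<alpha>) ^ 3" "(- z) ^ 3 \<noteq> - (of_real (- \<alpha>) ^ 3)"
    using z by (simp, metis minus_minus, metis minus_minus)
  have "g_simple (- \<alpha>) a b (- z) ** dual_frame F p (- z) = Ft p (- z) ** g_simple (- \<alpha>) (a1 p) (b1 p) (- z)"
    by (rule dressing_g_simple_factor[where ?a1.0 = a1 and ?b1.0 = b1 and c = "\<lambda>p. of_real (\<phi> p)" and r = r and D = D])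
      (use r' ab plus ab1 dline p z' d[unfolded dressing_h_simple_iff[OF r ab]] in auto)
  then show "g_simple \<alpha> a b z ** F p z = Ft p (- z) ** gt p z"
    using \<alpha> by (simp add: dual_frame_def g_simple_eq)
qed

end

end

theorem theorem4p6:
  fixes D :: "(real \<times> real) set" and h :: "real \<times> real \<Rightarrow> real"
    and F :: "real \<times> real \<Rightarrow> complex \<Rightarrow> complex^3^3"
    and \<alpha> a b r :: real
  assumes "open D" and "connected D"
    and "tzitzeica_solution D h"
    and "affine_frame D h F"
    and "\<alpha> \<noteq> 0"
    and "\<not> real_line a b \<subseteq> Delta0"
    and "0 < r" and "r < 1" and "r < \<bar>\<alpha>\<bar>" and "\<bar>\<alpha>\<bar> < 1 / r"
  shows "((\<forall>p\<in>D. \<not> line_times (real_line a b) (F p (of_real \<alpha>)) \<subseteq> Delta0) \<longrightarrow>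
      (let X = third_col F; \<phi> = scalar_solution a b (X \<alpha>);
           hhat = tz_h h \<phi>; Xhat = (\<lambda>l. tz_transform h (l ^ 3) (\<alpha> ^ 3) \<phi> (X l))
       in solves_system D h (\<alpha> ^ 3) \<phi> \<and>
          tzitzeica_solution D hhat \<and>
          dressing_defined r D (g_simple \<alpha> a b) F \<and>
          (\<forall>Ft. dressing r D (g_simple \<alpha> a b) F Ft \<longrightarrow>
             (\<forall>z. z \<noteq> 0 \<and> z ^ 3 \<noteq> of_real (\<alpha> ^ 3) \<and> z ^ 3 \<noteq> - of_real (\<alpha> ^ 3) \<longrightarrow>
                frame_equations D hhat z (\<lambda>p. Ft p z)) \<and>
             (\<forall>l::real. l \<noteq> 0 \<and> l ^ 3 \<noteq> \<alpha> ^ 3 \<and> l ^ 3 \<noteq> - (\<alpha> ^ 3) \<longrightarrow>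
                solves_system D hhat (l ^ 3) (Xhat l) \<and>
                invertible (g_simple \<alpha> a b (of_real l)) \<and>
                (\<forall>p\<in>D. complex_vec (Xhat l p)
                   = matrix_inv (g_simple \<alpha> a b (of_real l)) *v column 3 (Ft p (of_real l)))))))
    \<and> ((\<forall>p\<in>D. \<not> dual_line \<alpha> a b (F p (of_real \<alpha>)) \<subseteq> Delta0) \<longrightarrow>
      (let X = third_col F; \<phi> = scalar_solution a b (X (- \<alpha>));
           Xtilde = (\<lambda>l. dual_transform h (l ^ 3) (\<alpha> ^ 3) \<phi> (X l))
       in solves_system D h (- (\<alpha> ^ 3)) \<phi> \<and>
          dressing_defined r D (h_simple \<alpha> a b) F \<and>
          (\<forall>Ft. dressing r D (h_simple \<alpha> a b) F Ft \<longrightarrow>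
             (\<exists>a1 b1. \<forall>p\<in>D. dual_line \<alpha> a b (F p (of_real \<alpha>)) = real_line (a1 p) (b1 p) \<and>
                (\<forall>z. z \<noteq> 0 \<and> z ^ 3 \<noteq> of_real (\<alpha> ^ 3) \<longrightarrow>
                   h_simple \<alpha> a b z ** F p z = Ft p z ** h_simple \<alpha> (a1 p) (b1 p) z)) \<and>
             (\<forall>l::real. l \<noteq> 0 \<and> l ^ 3 \<noteq> \<alpha> ^ 3 \<and> l ^ 3 \<noteq> - (\<alpha> ^ 3) \<longrightarrow>
                (\<exists>L::real^3^3. invertible L \<and>
                   (\<forall>p\<in>D. column 3 (Ft p (of_real l)) = complex_vec (L *v Xtilde l p)))))))
    \<and> ((\<forall>p\<in>D. \<not> line_times (real_line a b) (F p (of_real \<alpha>)) \<subseteq> Delta0) \<longrightarrow>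
      (let X = third_col F; \<phi> = scalar_solution a b (X \<alpha>);
           hhat = tz_h h \<phi>; Xhat = (\<lambda>l. tz_transform h (l ^ 3) (\<alpha> ^ 3) \<phi> (X l));
           Xtilde = (\<lambda>l Y. dual_transform h (l ^ 3) (\<alpha> ^ 3) \<phi> Y)
       in dressing_defined r D (h_simple \<alpha> a b) (dual_frame F) \<and>
          (\<forall>l::real. l \<noteq> 0 \<and> l ^ 3 \<noteq> \<alpha> ^ 3 \<and> l ^ 3 \<noteq> - (\<alpha> ^ 3) \<longrightarrow>
             (\<forall>p\<in>D. Xhat l p = Xtilde (- l) (X l) p \<and>
                X (- l) p = P_mat *v dual_sphere h (X l) p \<and>
                dual_sphere hhat (Xhat l) p
                  = ((l ^ 3 - \<alpha> ^ 3) / (l ^ 3 + \<alpha> ^ 3)) *\<^sub>R Xtilde l (dual_sphere h (X l)) p) \<and>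
             (\<forall>Ft. dressing r D (h_simple \<alpha> a b) (dual_frame F) Ft \<longrightarrow>
                (\<exists>L::real^3^3. invertible L \<and>
                   (\<forall>p\<in>D. column 3 (Ft p (of_real l)) = complex_vec (L *v Xtilde l (X (- l)) p)))))))"
proof -
  have ab: "2 * a * b \<noteq> 1"
    using assms real_line_nondegenerate by blast
  have r: "0 < r" "r < \<bar>\<alpha>\<bar>" "\<bar>\<alpha>\<bar> < 1 / r"
    using assms by auto
  have F_plus: "p \<in> D \<Longrightarrow> F p \<in> Lambda_plus_SL" for p
    using assms by (simp add: affine_frame_def)
  have neg3: "(- x) ^ 3 = - (x ^ 3)" for x :: real
    by simp
  show ?thesis (is "(?c1 \<longrightarrow> ?p1) \<and> (?c2 \<longrightarrow> ?p2) \<and> (?c1 \<longrightarrow> ?p3)")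
  proof (intro conjI impI)
    assume c: ?c1
    interpret M: simple_dressing D h F \<alpha> a b
      by (rule simple_dressingI) (use assms c in auto)
    have 1: "frame_equations D M.hhat z (\<lambda>p. Ft p z)"
      if "dressing r D (g_simple \<alpha> a b) F Ft" "z \<noteq> 0" "z ^ 3 \<noteq> of_real (\<alpha> ^ 3)" "z ^ 3 \<noteq> - of_real (\<alpha> ^ 3)" for Ft z
      by (rule M.frame_Ft) (use that M.dressing_factor[OF r that(1)] in \<open>auto simp: dressing_def\<close>)
    have 2: "solves_system D M.hhat (l ^ 3) (M.Xhat l) \<and> invertible (g_simple \<alpha> a b (of_real l)) \<and>
        (\<forall>p\<in>D. complex_vec (M.Xhat l p) = matrix_inv (g_simple \<alpha> a b (of_real l)) *v column 3 (Ft p (of_real l)))"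
      if d: "dressing r D (g_simple \<alpha> a b) F Ft" and l: "l \<noteq> 0" "l ^ 3 \<noteq> \<alpha> ^ 3" "l ^ 3 \<noteq> - (\<alpha> ^ 3)" for Ft l
    proof -
      have Ft: "p \<in> D \<Longrightarrow> Ft p \<in> Lambda_plus_SL" for p
        using d by (simp add: dressing_def)
      have fact: "p \<in> D \<Longrightarrow> g_simple \<alpha> a b (of_real l) ** F p (of_real l) = Ft p (of_real l) ** M.gt p (of_real l)" for p
        by (rule M.dressing_factor[OF r d _ M.l_complex[OF l]])
      show ?thesis
        using M.Xhat_solves[OF l Ft fact] M.g_invertible[OF l] M.complex_Xhat[OF l Ft fact] by blast
    qed
    show ?p1
      unfolding Let_def unfolding M.\<phi>_def[symmetric] unfolding M.hhat_def[symmetric] M.X_def[symmetric] unfolding M.Xhat_def[symmetric]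
      using M.\<phi>_solves M.hhat_tzitzeica M.dressing_defined_g[OF r] 1 2 by blast
    show ?p3
      unfolding Let_def unfolding M.\<phi>_def[symmetric] unfolding M.hhat_def[symmetric] M.X_def[symmetric] unfolding M.Xhat_def[symmetric]
    proof (intro conjI allI impI ballI)
      show "dressing_defined r D (h_simple \<alpha> a b) (dual_frame F)"
        by (rule M.dual_frame_dressing[OF r])
      fix l :: real
      assume "l \<noteq> 0 \<and> l ^ 3 \<noteq> \<alpha> ^ 3 \<and> l ^ 3 \<noteq> - (\<alpha> ^ 3)"
      then have l: "l \<noteq> 0" "l ^ 3 \<noteq> \<alpha> ^ 3" "l ^ 3 \<noteq> - (\<alpha> ^ 3)"
        by auto
      have l': "- l \<noteq> 0" "(- l) ^ 3 \<noteq> \<alpha> ^ 3" "(- l) ^ 3 \<noteq> - (\<alpha> ^ 3)"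
        unfolding neg3 using l by (simp, metis minus_minus, simp)
      have tilde: "dual_transform h (l ^ 3) (\<alpha> ^ 3) M.\<phi> (M.X (- l)) p = M.Xhat (- l) p" for p
        unfolding M.Xhat_def neg3 by (rule dual_transform_eq(2))
      {
        fix p assume p: "p \<in> D"
        show "M.Xhat l p = dual_transform h ((- l) ^ 3) (\<alpha> ^ 3) M.\<phi> (M.X l) p"
          unfolding M.Xhat_def neg3 dual_transform_eq(2) minus_minus ..
        show "M.X (- l) p = P_mat *v dual_sphere h (M.X l) p"
          by (rule M.X_dual[OF l(1) p])
        \<comment> \<open>The duality formula mentions no dressed frame. One is chosen as an
          auxiliary object, because its third columns at \<open>l\<close> and \<open>-l\<close> are
          dual to each other.\<close>
        obtain Ft where d: "dressing r D (g_simple \<alpha> a b) F Ft"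
          using M.dressing_defined_g[OF r] unfolding dressing_defined_def by blast
        have Ft: "p \<in> D \<Longrightarrow> Ft p \<in> Lambda_plus_SL" for p
          using d by (simp add: dressing_def)
        have fact: "p \<in> D \<Longrightarrow> g_simple \<alpha> a b (of_real l) ** F p (of_real l) = Ft p (of_real l) ** M.gt p (of_real l)" for p
          by (rule M.dressing_factor[OF r d _ M.l_complex[OF l]])
        have fact': "p \<in> D \<Longrightarrow> g_simple \<alpha> a b (of_real (- l)) ** F p (of_real (- l)) = Ft p (of_real (- l)) ** M.gt p (of_real (- l))" for p
          by (rule M.dressing_factor[OF r d _ M.l_complex[OF l']])
        have "det (M.gr l) *\<^sub>R dual_sphere M.hhat (M.Xhat l) p = transpose (M.gr l) *v (P_mat *v (M.gr (- l) *v M.Xhat (- l) p))"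
          using M.dual_Ft[OF l Ft fact p] M.third_col_Ft[OF l' Ft fact' p] by simp
        also have "\<dots> = P_mat *v M.Xhat (- l) p"
          by (simp only: matrix_vector_mul_assoc matrix_mul_assoc M.gr_P[OF l])
        \<comment> \<open>The quotient \<open>1/det (gr l)\<close> is the factor
          \<open>(l^3-\<alpha>^3)/(l^3+\<alpha>^3)\<close> of the statement: duality respects linear
          maps without an extra scalar only when their determinant is 1, and \<open>gr l\<close> is
          not normalized.\<close>
        finally have "(1 / det (M.gr l)) *\<^sub>R (det (M.gr l) *\<^sub>R dual_sphere M.hhat (M.Xhat l) p) = (1 / det (M.gr l)) *\<^sub>R (P_mat *v M.Xhat (- l) p)"
          by simp
        moreover have "dual_transform h (l ^ 3) (\<alpha> ^ 3) M.\<phi> (dual_sphere h (M.X l)) p = P_mat *v M.Xhat (- l) p"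
          unfolding tilde[symmetric]
          by (rule dual_transform_linear[OF assms(1) p]) (use M.X_dual[OF l(1)] M.X_diff[OF l'(1) p] in \<open>simp_all add: P_mat_vec\<close>)
        ultimately show "dual_sphere M.hhat (M.Xhat l) p =
            ((l ^ 3 - \<alpha> ^ 3) / (l ^ 3 + \<alpha> ^ 3)) *\<^sub>R dual_transform h (l ^ 3) (\<alpha> ^ 3) M.\<phi> (dual_sphere h (M.X l)) p"
          using M.det_gr_nz[OF l] by (simp add: M.det_gr[OF l])
      }
      fix Ft
      assume d: "dressing r D (h_simple \<alpha> a b) (dual_frame F) Ft"
      \<comment> \<open>The dressed reversed frame is reversed once more; the rank 1 results then
        apply to it at the parameter \<open>-l\<close>.\<close>
      have Ft: "p \<in> D \<Longrightarrow> (\<lambda>z. Ft p (- z)) \<in> Lambda_plus_SL" for p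
        using d Lambda_plus_reflect by (simp add: dressing_def)
      have "p \<in> D \<Longrightarrow> g_simple \<alpha> a b (of_real (- l)) ** F p (of_real (- l)) = Ft p (- of_real (- l)) ** M.gt p (of_real (- l))" for p
        by (rule M.dual_frame_dressing(2)[OF r d _ M.l_complex[OF l']])
      from M.col_Ft[OF l' Ft this] have "\<forall>p\<in>D. column 3 (Ft p (of_real l)) =
          complex_vec (M.gr (- l) *v dual_transform h (l ^ 3) (\<alpha> ^ 3) M.\<phi> (M.X (- l)) p)"
        by (simp add: tilde)
      with M.gr_invertible[OF l'] show "\<exists>L::real^3^3. invertible L \<and>
          (\<forall>p\<in>D. column 3 (Ft p (of_real l)) = complex_vec (L *v dual_transform h (l ^ 3) (\<alpha> ^ 3) M.\<phi> (M.X (- l)) p))"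
        by blast
    qed
  next
    assume c: ?c2
    have line: "dual_line \<alpha> a b (F p (of_real \<alpha>)) = line_times (real_line a b) (F p (of_real (- \<alpha>)))" if "p \<in> D" for p
      by (rule dual_line_eq[OF F_plus[OF that] assms(5) ab])
    \<comment> \<open>By \<open>line\<close> the assumption on \<open>dual_line\<close> is the line
      condition at \<open>-\<alpha>\<close>, and \<open>N.\<phi>\<close> is the last entry of
      \<open>(a, b, 1) F(-\<alpha>)\<close>.\<close>
    interpret N: simple_dressing D h F "- \<alpha>" a b
      by (rule simple_dressingI) (use assms c line in auto)
    have r': "0 < r" "r < \<bar>- \<alpha>\<bar>" "\<bar>- \<alpha>\<bar> < 1 / r"
      using r by auto
    have tilde: "dual_transform h (l ^ 3) (\<alpha> ^ 3) N.\<phi> (N.X l) p = N.Xhat l p" for l p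
      unfolding N.Xhat_def neg3 by (rule dual_transform_eq(1))
    have 1: "\<exists>a1 b1. \<forall>p\<in>D. dual_line \<alpha> a b (F p (of_real \<alpha>)) = real_line (a1 p) (b1 p) \<and>
        (\<forall>z. z \<noteq> 0 \<and> z ^ 3 \<noteq> of_real (\<alpha> ^ 3) \<longrightarrow> h_simple \<alpha> a b z ** F p z = Ft p z ** h_simple \<alpha> (a1 p) (b1 p) z)"
      if d: "dressing r D (g_simple (- \<alpha>) a b) F Ft" for Ft
    proof (rule exI[of _ N.a1], rule exI[of _ N.b1], intro ballI conjI allI impI)
      fix p assume p: "p \<in> D"
      show "dual_line \<alpha> a b (F p (of_real \<alpha>)) = real_line (N.a1 p) (N.b1 p)"
        unfolding line[OF p] N.a1_def N.b1_def N.w_alt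
        by (rule line_times_eq_real_line) (use N.w3_nz[OF p] in \<open>simp add: N.w_alt\<close>)
      fix z :: complex assume z: "z \<noteq> 0 \<and> z ^ 3 \<noteq> of_real (\<alpha> ^ 3)"
      have "g_simple (- \<alpha>) a b z ** F p z = Ft p z ** N.gt p z"
        if "z \<noteq> 0" "z ^ 3 \<noteq> of_real \<alpha> ^ 3" "z ^ 3 \<noteq> - (of_real \<alpha> ^ 3)" for z
        by (rule N.dressing_factor[OF r' d p]) (use that in auto)
      moreover have "Ft p \<in> Lambda_plus_SL"
        using d p by (simp add: dressing_def)
      ultimately show "h_simple \<alpha> a b z ** F p z = Ft p z ** h_simple \<alpha> (N.a1 p) (N.b1 p) z"
        using z by (intro h_simple_factor[OF assms(5) ab N.ab1[OF p] F_plus[OF p]]) auto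
    qed
    have 2: "\<exists>L::real^3^3. invertible L \<and> (\<forall>p\<in>D. column 3 (Ft p (of_real l)) =
        complex_vec (L *v dual_transform h (l ^ 3) (\<alpha> ^ 3) N.\<phi> (N.X l) p))"
      if d: "dressing r D (g_simple (- \<alpha>) a b) F Ft" and l0: "l \<noteq> 0 \<and> l ^ 3 \<noteq> \<alpha> ^ 3 \<and> l ^ 3 \<noteq> - (\<alpha> ^ 3)" for Ft l
    proof -
      have l: "l \<noteq> 0" "l ^ 3 \<noteq> (- \<alpha>) ^ 3" "l ^ 3 \<noteq> - ((- \<alpha>) ^ 3)"
        using l0 by auto
      have Ft: "p \<in> D \<Longrightarrow> Ft p \<in> Lambda_plus_SL" for p
        using d by (simp add: dressing_def)
      have fact: "p \<in> D \<Longrightarrow> g_simple (- \<alpha>) a b (of_real l) ** F p (of_real l) = Ft p (of_real l) ** N.gt p (of_real l)" for p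
        by (rule N.dressing_factor[OF r' d _ N.l_complex[OF l]])
      show ?thesis
        using N.gr_invertible[OF l] N.col_Ft[OF l Ft fact] unfolding tilde by blast
    qed
    have 3: "solves_system D h (- (\<alpha> ^ 3)) N.\<phi>" "dressing_defined r D (g_simple (- \<alpha>) a b) F"
      using N.\<phi>_solves N.dressing_defined_g[OF r'] by simp_all
    show ?p2
      unfolding Let_def unfolding N.\<phi>_def[symmetric] unfolding N.X_def[symmetric] dressing_defined_def dressing_h_simple_iff[OF r ab]
      using 1 2 3[unfolded dressing_defined_def] by blast
  qed
qed

end
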